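(* Let $q$ be a positive integer and let $x,y$ be real numbers with $2 \le y \le x$, $2 \le x \le q$ and $(\log x)^6 \le y \le x^{\frac{1}{32\log\log x}}$. Let $\alpha(x,y)$ be the saddle point, let $u = \frac{\log x}{\log y}$, and define $$S(x,y,q) := (\log x)^{3/2} (\log y)^{1/2} \left( y^{1/2-\alpha(x,y)} + \exp\left\{ -\frac{u}{4}\left( \frac{\log \min\{q, x^{3/2}\}}{\log x} - 1 \right)^2 \right\} \right).$$ Then $$\frac{1}{\varphi(q)} \sum_{\chi \bmod q} \Bigl| \sum_{\substack{n \le x \\ P(n) \le y}} \chi(n) \Bigr| \ll \sqrt{\Psi(x,y)\, S(x,y,q)},$$ where the implied constant is absolute (uniform in all variables $x,y,q$). Moreover, for any function $\eta$ with $\eta(x) \to \infty$ as $x \to \infty$, one has $S(x,y,q) = o_\eta(1)$ as $x \to \infty$, uniformly over all $y$ and $q$ in the range $$(\log x)^6 \le y \le x^{\frac{1}{32 \log\log x}}, \qquad \frac{\log q}{\log x} \ge 1 + \sqrt{\frac{6\log\log x + 2\log\log y + \eta(x)}{u}}.$$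
   Context: $P(n)$ denotes the largest prime factor of the positive integer $n$, with $n=1$ counted as satisfying $P(n)\le y$; thus $P(n) \le y$ means that all prime factors of $n$ are at most $y$ ($n$ is $y$-smooth). $\Psi(x,y) = \#\{ n \le x : P(n) \le y\}$. The sum $\sum_{\chi \bmod q}$ runs over all $\varphi(q)$ Dirichlet characters modulo $q$, where $\varphi$ is Euler's totient function. For $2 \le y \le x$, the saddle point $\alpha(x,y)$ is the unique real (positive) solution $\alpha$ of $$\sum_{p \le y} \frac{\log p}{p^{\alpha} - 1} = \log x,$$ the sum being over primes $p \le y$. $A \ll B$ means $|A| \le C B$ for some constant $C>0$ (here absolute). $o_\eta(1)$ denotes a quantity tending to $0$ at a rate that may depend on the function $\eta$. *)

theory Defs
  imports Complex_Main "HOL-Number_Theory.Number_Theory"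
begin

text \<open>Dirichlet characters modulo \<open>q > 0\<close> are viewed as functions on the natural numbers,
  extended by zero to the numbers not coprime to \<open>q\<close>. Non-vanishing on the residues
  coprime to \<open>q\<close> together with multiplicativity forces \<open>\<chi> 1 = 1\<close>.\<close>

definition dirichlet_characters :: "nat \<Rightarrow> (nat \<Rightarrow> complex) set" where
  "dirichlet_characters q =
     {\<chi>. (\<forall>m n. \<chi> (m * n) = \<chi> m * \<chi> n) \<and>
         (\<forall>n. \<chi> (n + q) = \<chi> n) \<and>
         (\<forall>n. \<chi> n \<noteq> 0 \<longleftrightarrow> coprime n q)}"

text \<open>The value at \<open>1\<close> implements the convention that \<open>1\<close> is \<open>y\<close>-smooth for every
  \<open>y \<ge> 1\<close>. The value at \<open>0\<close> is irrelevant.\<close>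

definition largest_prime_factor :: "nat \<Rightarrow> nat" where
  "largest_prime_factor n = (if n = 1 then 1 else Max (prime_factors n))"

definition smooth_upto :: "real \<Rightarrow> real \<Rightarrow> nat set" where
  "smooth_upto x y = {n. 0 < n \<and> real n \<le> x \<and> real (largest_prime_factor n) \<le> y}"

definition Psi :: "real \<Rightarrow> real \<Rightarrow> nat" where
  "Psi x y = card (smooth_upto x y)"

definition saddle_point :: "real \<Rightarrow> real \<Rightarrow> real" where
  "saddle_point x y =
     (THE \<alpha>. \<alpha> > 0 \<and>
        (\<Sum>p | prime p \<and> real p \<le> y. ln (real p) / (real p powr \<alpha> - 1)) = ln x)"

definition u_param :: "real \<Rightarrow> real \<Rightarrow> real" where
  "u_param x y = ln x / ln y"

definition S :: "real \<Rightarrow> real \<Rightarrow> nat \<Rightarrow> real" where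
  "S x y q =
     ln x powr (3/2) * ln y powr (1/2) *
       (y powr (1/2 - saddle_point x y) +
        exp (- (u_param x y / 4) * (ln (min (real q) (x powr (3/2))) / ln x - 1)\<^sup>2))"

text \<open>The set of characters is finite, so that sums over it are genuine sums.\<close>

lemma finite_dirichlet_characters:
  assumes "q > 0"
  shows "finite (dirichlet_characters q)"
proof -
  let ?R = "insert 0 {z::complex. z ^ totient q = 1}"
  let ?r = "\<lambda>\<chi> :: nat \<Rightarrow> complex. restrict \<chi> {..<q}"
  have per: "\<chi> n = \<chi> (n mod q)" if "\<chi> \<in> dirichlet_characters q" for \<chi> n
  proof -
    have "\<chi> (m + k * q) = \<chi> m" for m k
    proof (induction k)
      case (Suc k)
      have "\<chi> (m + Suc k * q) = \<chi> ((m + k * q) + q)" by (simp add: algebra_simps)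
      also have "\<dots> = \<chi> m" using that Suc by (simp add: dirichlet_characters_def)
      finally show ?case .
    qed simp
    from this[of "n mod q" "n div q"] show ?thesis by (simp add: mult.commute)
  qed
  have val: "\<chi> n \<in> ?R" if c: "\<chi> \<in> dirichlet_characters q" for \<chi> n
  proof (cases "coprime n q")
    case True
    have m: "\<chi> (a * b) = \<chi> a * \<chi> b" for a b
      using c by (simp add: dirichlet_characters_def)
    have "\<chi> 1 \<noteq> 0" using c by (simp add: dirichlet_characters_def)
    with m[of 1 1] have one: "\<chi> 1 = 1" by simp
    have pow: "\<chi> (n ^ k) = \<chi> n ^ k" for k
      by (induction k) (use one m in auto)
    have "[n ^ totient q = 1] (mod q)" using True by (rule euler_theorem)
    hence "\<chi> (n ^ totient q) = \<chi> 1"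
      using per[OF c, of "n ^ totient q"] per[OF c, of 1] by (simp add: cong_def)
    thus ?thesis using pow one by simp
  next
    case False
    thus ?thesis using c by (auto simp: dirichlet_characters_def)
  qed
  have "1 \<le> totient q" using assms by (simp add: Suc_le_eq)
  hence "finite ?R" by (intro finite.insertI finite_roots_unity)
  hence "finite ({..<q} \<rightarrow>\<^sub>E ?R)" by (intro finite_PiE) auto
  moreover have "?r ` dirichlet_characters q \<subseteq> {..<q} \<rightarrow>\<^sub>E ?R"
    by (intro image_subsetI restrict_PiE_iff[THEN iffD2] ballI val)
  ultimately have "finite (?r ` dirichlet_characters q)" by (rule rev_finite_subset)
  moreover have "inj_on ?r (dirichlet_characters q)"
  proof (rule inj_onI)
    fix f g assume fg: "f \<in> dirichlet_characters q" "g \<in> dirichlet_characters q" "?r f = ?r g"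
    show "f = g"
    proof
      fix n
      have "?r f (n mod q) = ?r g (n mod q)" using fg(3) by (rule fun_cong)
      thus "f n = g n" using per[OF fg(1), of n] per[OF fg(2), of n] assms by simp
    qed
  qed
  ultimately show ?thesis by (rule finite_imageD)
qed

end

theory Submission
  imports Defs "HOL-Analysis.Convex" "HOL-Real_Asymp.Real_Asymp"
begin

text \<open>
  Write \<open>u = ln x / ln y\<close>, call a prime large if it exceeds \<open>sqrt y\<close>, and let \<open>L n\<close> be the number of
  large prime factors of \<open>n\<close>, counted with multiplicity. The mean over the characters is controlled by
  Bessel's inequality: on integers up to \<open>q\<close> the mean square of \<open>\<Sum>c\<^sub>n \<chi> n\<close> is at most
  \<open>\<Sum>\<bar>c\<^sub>n\<bar>\<^sup>2\<close> (\<open>character_mean_square_le\<close>). This alone gives the bound \<open>sqrt (Psi x y)\<close>. The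
  saving comes from the many ways of splitting a smooth number into two factors.

  A smooth \<open>n\<close> with exactly \<open>k\<close> large prime factors, all distinct, is \<open>a * b\<close> with \<open>a\<close> a product of
  \<open>k div 2\<close> large primes in exactly \<open>C = k choose (k div 2)\<close> ways. The sum of \<open>\<chi> n\<close> over these \<open>n\<close> is
  therefore \<open>1 / C\<close> times a sum over pairs with \<open>a * b \<le> x\<close>. If \<open>a\<close> and \<open>b\<close> ran independently over sets
  \<open>A\<close> and \<open>B\<close>, the Cauchy-Schwarz and Bessel inequalities would bound the mean of the double sum by
  \<open>sqrt (\<bar>A\<bar> * \<bar>B\<bar>)\<close>, which is at most \<open>sqrt (C * Psi x y)\<close>, so that the factor \<open>sqrt C\<close> is gained. To
  make them independent, \<open>a\<close> is sorted into \<open>R \<approx> ln x / h\<close> bins on a logarithmic scale of step \<open>h\<close>, at the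
  expense of a factor \<open>sqrt R\<close> and of the \<open>n\<close> between \<open>x * exp (- h)\<close> and \<open>x\<close>. With \<open>k \<ge> u / 4\<close> and
  \<open>h \<ge> exp (- u / 16)\<close> the gain \<open>C \<ge> 2 ^ k / (k + 1)\<close> outweighs \<open>R\<close> by more than \<open>exp (u / 16)\<close>
  for large \<open>u\<close> (\<open>character_mean_smooth_sum_le\<close>).

  Bessel's inequality also handles the exceptional \<open>n\<close>, those which are divisible by the square of a
  large prime, or lie in the short interval below \<open>x\<close>, or have fewer than \<open>u / 4\<close> large prime factors,
  once there are at most \<open>O((ln x)\<^sup>2 / sqrt y + ln x * exp (- u / 16)) * Psi x y\<close> of them. All counts
  rest on comparisons of \<open>Psi (x / D) y\<close> with \<open>Psi x y\<close>, which come from the identity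
  \<open>ln n = \<Sum>d dvd n. mangoldt d\<close> summed over smooth \<open>n\<close>: for every \<open>\<beta> \<le> 1\<close> with
  \<open>\<Sum>d \<le> y. mangoldt d / d powr \<beta> \<ge> ln x\<close>, induction on \<open>D\<close> yields
  \<open>Psi (x / D) y \<le> 6 * ln x * D powr - \<beta> * Psi x y\<close> (\<open>Psi_divide_powr_le\<close>). Here \<open>\<beta>\<close> plays the part of
  the saddle point. The choice \<open>\<beta> = tilt x y\<close> is explicit, and the condition on it follows from Mertens'
  first theorem.

  The saddle point \<open>\<alpha>\<close> enters only through
  \<open>u / (8 * sqrt y) \<le> y powr (1 / 2 - \<alpha>) \<le> 6 * ln x / sqrt y\<close>, which is read off from its defining
  equation. The lower bound, and the fact that the exponential in \<open>S\<close> is at least \<open>exp (- u / 16)\<close>, turn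
  the count of exceptional numbers into \<open>O(S x y q * Psi x y)\<close>. The upper bound makes the first summand
  of \<open>S\<close> tend to \<open>0\<close>. The second summand is \<open>exp (- \<eta> x / 4)\<close> at most if \<open>q < x powr (3 / 2)\<close>, and
  \<open>u powr - (1 / 2)\<close> otherwise.
\<close>

section \<open>Dirichlet characters and Bessel's inequality\<close>

lemma dirichlet_character_mult:
  "\<chi> \<in> dirichlet_characters q \<Longrightarrow> \<chi> (m * n) = \<chi> m * \<chi> n"
  by (simp add: dirichlet_characters_def)

lemma dirichlet_character_eq_0_iff:
  "\<chi> \<in> dirichlet_characters q \<Longrightarrow> \<chi> n = 0 \<longleftrightarrow> \<not> coprime n q"
  by (auto simp: dirichlet_characters_def)

lemma dirichlet_character_1:
  assumes "\<chi> \<in> dirichlet_characters q"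
  shows "\<chi> (Suc 0) = 1"
proof -
  have "\<chi> 1 * \<chi> 1 = \<chi> 1"
    using dirichlet_character_mult[OF assms, of 1 1] by simp
  moreover have "\<chi> 1 \<noteq> 0" using dirichlet_character_eq_0_iff[OF assms, of 1] by simp
  ultimately show ?thesis by simp
qed

lemma dirichlet_character_mod:
  assumes "\<chi> \<in> dirichlet_characters q"
  shows "\<chi> (n mod q) = \<chi> n"
proof -
  have "\<chi> (m + k * q) = \<chi> m" for m k
  proof (induction k)
    case (Suc k)
    have "\<chi> (m + Suc k * q) = \<chi> ((m + k * q) + q)" by (simp add: algebra_simps)
    also have "\<dots> = \<chi> m" using assms Suc by (simp add: dirichlet_characters_def)
    finally show ?case .
  qed simp
  from this[of "n mod q" "n div q"] show ?thesis by (simp add: mult.commute)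
qed

lemma dirichlet_character_pow:
  assumes "\<chi> \<in> dirichlet_characters q"
  shows "\<chi> (n ^ k) = \<chi> n ^ k"
  using dirichlet_character_1[OF assms] dirichlet_character_mult[OF assms]
  by (induction k) auto

lemma norm_dirichlet_character:
  assumes "\<chi> \<in> dirichlet_characters q" "q > 0" "coprime n q"
  shows "cmod (\<chi> n) = 1"
proof -
  have "[n ^ totient q = 1] (mod q)" using assms by (intro euler_theorem)
  hence "\<chi> (n ^ totient q) = \<chi> 1"
    using dirichlet_character_mod[OF assms(1), of "n ^ totient q"]
      dirichlet_character_mod[OF assms(1), of 1] by (simp add: unique_euclidean_semiring_class.cong_def)
  hence "\<chi> n ^ totient q = 1"
    using dirichlet_character_pow[OF assms(1)] dirichlet_character_1[OF assms(1)] by simp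
  hence "cmod (\<chi> n) ^ totient q = 1" by (metis norm_one norm_power)
  thus ?thesis using assms(2) power_eq_1_iff[of "cmod (\<chi> n)" "totient q"] by auto
qed

lemma norm_dirichlet_character_le:
  assumes "\<chi> \<in> dirichlet_characters q" "q > 0"
  shows "cmod (\<chi> n) \<le> 1"
  using norm_dirichlet_character[OF assms, of n] dirichlet_character_eq_0_iff[OF assms(1), of n]
  by (cases "coprime n q") auto

text \<open>
  The representative of the class \<open>0\<close> among \<open>1, \<dots>, q\<close> is \<open>q\<close>. It is a totative only for \<open>q = 1\<close>, and
  the case distinction is there for that modulus.
\<close>

lemma bij_betw_mult_totatives:
  assumes "coprime a q" "q > 0"
  shows "bij_betw (\<lambda>n. if a * n mod q = 0 then q else a * n mod q) (totatives q) (totatives q)"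
    (is "bij_betw ?f _ _")
proof -
  have inj: "inj_on ?f (totatives q)"
  proof (rule inj_onI)
    fix m n assume mn: "m \<in> totatives q" "n \<in> totatives q" "?f m = ?f n"
    have "a * k mod q < q" for k using assms by simp
    hence "a * m mod q = a * n mod q"
      using mn(3) by (metis less_irrefl_nat)
    hence "[a * m = a * n] (mod q)" by (simp add: unique_euclidean_semiring_class.cong_def)
    hence c: "[m = n] (mod q)" using assms(1) by (simp add: cong_mult_lcancel_nat)
    show "m = n"
    proof (cases "q = 1")
      case False
      hence "m < q" "n < q" using mn totatives_less[of m q] totatives_less[of n q] assms
        by (auto)
      thus ?thesis using c by (simp add: unique_euclidean_semiring_class.cong_def)
    qed (use mn in auto)
  qed
  have "?f n \<in> totatives q" if "n \<in> totatives q" for n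
  proof -
    have "coprime (a * n) q" using that assms by (auto simp: in_totatives_iff)
    hence c: "coprime (a * n mod q) q" using assms(2) by simp
    show ?thesis
    proof (cases "a * n mod q = 0")
      case True
      with c have "q = 1" by simp
      thus ?thesis by simp
    next
      case False
      moreover have "a * n mod q \<le> q" using assms(2) by (simp add: less_imp_le)
      ultimately show ?thesis using c by (simp add: in_totatives_iff)
    qed
  qed
  hence "?f ` totatives q \<subseteq> totatives q" by blast
  hence "?f ` totatives q = totatives q"
    using inj by (intro endo_inj_surj finite_totatives)
  thus ?thesis using inj unfolding bij_betw_def by blast
qed

text \<open>
  Distinct characters differ at some \<open>a\<close> coprime to \<open>q\<close>. Replacing \<open>n\<close> by \<open>a * n\<close> permutes the
  residues and multiplies the sum by \<open>\<chi> a * cnj (\<chi>' a) \<noteq> 1\<close>, so that it vanishes.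
\<close>

lemma dirichlet_character_orthogonality:
  assumes "\<chi> \<in> dirichlet_characters q" "\<chi>' \<in> dirichlet_characters q" "q > 0"
  shows "(\<Sum>n\<in>totatives q. \<chi> n * cnj (\<chi>' n)) =
           (if \<chi> = \<chi>' then of_nat (totient q) else 0)"
proof (cases "\<chi> = \<chi>'")
  case True
  have "\<chi> n * cnj (\<chi>' n) = 1" if "n \<in> totatives q" for n
    using that norm_dirichlet_character[OF assms(1,3), of n] True
    by (simp add: in_totatives_iff complex_norm_square [symmetric])
  thus ?thesis using True by (simp add: totient_def)
next
  case False
  then obtain a where a: "\<chi> a \<noteq> \<chi>' a" by blast
  hence cop: "coprime a q"
    using dirichlet_character_eq_0_iff[OF assms(1)] dirichlet_character_eq_0_iff[OF assms(2)]
    by metis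
  let ?f = "\<lambda>n. if a * n mod q = 0 then q else a * n mod q"
  let ?w = "\<chi> a * cnj (\<chi>' a)"
  let ?T = "\<Sum>n\<in>totatives q. \<chi> n * cnj (\<chi>' n)"
  have f: "\<eta> (?f n) = \<eta> (a * n)" if "\<eta> \<in> dirichlet_characters q" for \<eta> n
    using dirichlet_character_mod[OF that, of "a * n"] dirichlet_character_mod[OF that, of q] by auto
  have "?T = (\<Sum>n\<in>totatives q. \<chi> (?f n) * cnj (\<chi>' (?f n)))"
    by (rule sum.reindex_bij_betw [OF bij_betw_mult_totatives[OF cop assms(3)], symmetric])
  also have "\<dots> = ?w * ?T"
    unfolding f[OF assms(1)] f[OF assms(2)] dirichlet_character_mult[OF assms(1)]
      dirichlet_character_mult[OF assms(2)] by (simp add: sum_distrib_left algebra_simps)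
  finally have "(?w - 1) * ?T = 0" by (simp add: algebra_simps)
  moreover have "?w \<noteq> 1"
  proof
    assume "?w = 1"
    hence "\<chi> a * (cnj (\<chi>' a) * \<chi>' a) = \<chi>' a" by (simp add: mult.assoc [symmetric])
    moreover have "cnj (\<chi>' a) * \<chi>' a = 1"
      using norm_dirichlet_character[OF assms(2,3) cop]
      by (simp add: complex_norm_square [symmetric] mult.commute)
    ultimately show False using a by simp
  qed
  ultimately show ?thesis using False by simp
qed

definition character_mean :: "nat \<Rightarrow> ((nat \<Rightarrow> complex) \<Rightarrow> real) \<Rightarrow> real" where
  "character_mean q F = 1 / real (totient q) * (\<Sum>\<chi>\<in>dirichlet_characters q. F \<chi>)"

text \<open>
  The characters form an orthogonal system of vectors of square norm \<open>totient q\<close>, and this is Bessel's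
  inequality: expand the square of the distance from \<open>c\<close> to its projection on their span.
\<close>

lemma bessel_totatives:
  assumes "q > 0"
  shows "(\<Sum>\<chi>\<in>dirichlet_characters q. (cmod (\<Sum>n\<in>totatives q. c n * \<chi> n))\<^sup>2)
           \<le> real (totient q) * (\<Sum>n\<in>totatives q. (cmod (c n))\<^sup>2)"
proof -
  define X where "X = dirichlet_characters q"
  define R where "R = totatives q"
  define \<phi> where "\<phi> = real (totient q)"
  define f where "f = (\<lambda>\<chi>. \<Sum>n\<in>R. c n * \<chi> n)"
  define v where "v = (\<lambda>n. \<Sum>\<chi>\<in>X. f \<chi> * cnj (\<chi> n))"
  define Q where "Q = (\<Sum>\<chi>\<in>X. (cmod (f \<chi>))\<^sup>2)"
  have pos: "\<phi> > 0" using assms by (simp add: \<phi>_def)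
  have finX: "finite X" using finite_dirichlet_characters[OF assms] by (simp add: X_def)
  have cross: "(\<Sum>n\<in>R. c n * cnj (v n)) = of_real Q"
  proof -
    have "(\<Sum>n\<in>R. c n * cnj (v n)) = (\<Sum>n\<in>R. \<Sum>\<chi>\<in>X. cnj (f \<chi>) * (c n * \<chi> n))"
      by (simp add: v_def sum_distrib_left algebra_simps)
    also have "\<dots> = (\<Sum>\<chi>\<in>X. cnj (f \<chi>) * f \<chi>)"
      by (subst sum.swap) (simp add: f_def sum_distrib_left)
    finally show ?thesis
      by (simp add: Q_def complex_norm_square mult.commute del: of_real_power)
  qed
  have square: "(\<Sum>n\<in>R. v n * cnj (v n)) = of_real (\<phi> * Q)"
  proof -
    have "(\<Sum>n\<in>R. v n * cnj (v n)) =
        (\<Sum>n\<in>R. \<Sum>\<chi>\<in>X. \<Sum>\<chi>'\<in>X. f \<chi> * cnj (f \<chi>') * (\<chi>' n * cnj (\<chi> n)))"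
      unfolding v_def cnj_sum sum_product by (intro sum.cong refl) (simp add: mult_ac)
    also have "\<dots> = (\<Sum>\<chi>\<in>X. \<Sum>\<chi>'\<in>X. f \<chi> * cnj (f \<chi>') * (\<Sum>n\<in>R. \<chi>' n * cnj (\<chi> n)))"
      by (subst sum.swap, intro sum.cong refl, subst sum.swap) (simp add: sum_distrib_left)
    also have "\<dots> = (\<Sum>\<chi>\<in>X. \<Sum>\<chi>'\<in>X. if \<chi>' = \<chi> then f \<chi> * cnj (f \<chi>) * \<phi> else 0)"
      by (intro sum.cong refl)
         (auto simp: R_def X_def dirichlet_character_orthogonality[OF _ _ assms] \<phi>_def)
    also have "\<dots> = (\<Sum>\<chi>\<in>X. f \<chi> * cnj (f \<chi>) * \<phi>)"
      using finX by (intro sum.cong refl) simp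
    finally show ?thesis
      by (simp add: Q_def complex_norm_square sum_distrib_left algebra_simps del: of_real_power)
  qed
  have crossR: "(\<Sum>n\<in>R. Re (c n * cnj (v n))) = Q"
    using arg_cong[OF cross, of Re] by simp
  have squareR: "(\<Sum>n\<in>R. (cmod (v n))\<^sup>2) = \<phi> * Q"
    using arg_cong[OF square, of Re]
    by (simp add: complex_norm_square [symmetric] del: of_real_power) 
  have "0 \<le> (\<Sum>n\<in>R. (cmod (of_real \<phi> * c n - v n))\<^sup>2)" by (intro sum_nonneg) auto
  also have "\<dots> = (\<Sum>n\<in>R. \<phi>\<^sup>2 * (cmod (c n))\<^sup>2 - 2 * \<phi> * Re (c n * cnj (v n)) + (cmod (v n))\<^sup>2)"
  proof (intro sum.cong refl)
    fix n
    show "(cmod (of_real \<phi> * c n - v n))\<^sup>2 =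
        \<phi>\<^sup>2 * (cmod (c n))\<^sup>2 - 2 * \<phi> * Re (c n * cnj (v n)) + (cmod (v n))\<^sup>2"
      unfolding cmod_power2 by (simp add: power2_eq_square algebra_simps)
  qed
  also have "\<dots> = \<phi>\<^sup>2 * (\<Sum>n\<in>R. (cmod (c n))\<^sup>2) - 2 * \<phi> * Q + \<phi> * Q"
    using crossR squareR by (simp add: sum.distrib sum_subtractf sum_distrib_left [symmetric])
  finally have "\<phi> * Q \<le> \<phi> * (\<phi> * (\<Sum>n\<in>R. (cmod (c n))\<^sup>2))"
    by (simp add: power2_eq_square mult_ac)
  hence "Q \<le> \<phi> * (\<Sum>n\<in>R. (cmod (c n))\<^sup>2)" using pos by simp
  thus ?thesis by (simp add: Q_def f_def R_def X_def \<phi>_def)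
qed

lemma character_mean_square_le:
  assumes "q > 0" "N \<subseteq> {0<..q}"
  shows "character_mean q (\<lambda>\<chi>. (cmod (\<Sum>n\<in>N. c n * \<chi> n))\<^sup>2) \<le> (\<Sum>n\<in>N. (cmod (c n))\<^sup>2)"
proof -
  define c' where "c' = (\<lambda>n. if n \<in> N then c n else 0)"
  have finN: "finite N" using assms(2) finite_subset by blast
  have eq: "(\<Sum>n\<in>N. c n * \<chi> n) = (\<Sum>n\<in>totatives q. c' n * \<chi> n)"
    if "\<chi> \<in> dirichlet_characters q" for \<chi>
  proof -
    have "(\<Sum>n\<in>N. c n * \<chi> n) = (\<Sum>n\<in>N \<inter> totatives q. c n * \<chi> n)"
      using finN assms(2) dirichlet_character_eq_0_iff[OF that]
      by (intro sum.mono_neutral_right) (auto simp: in_totatives_iff)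
    also have "\<dots> = (\<Sum>n\<in>N \<inter> totatives q. c' n * \<chi> n)"
      by (intro sum.cong) (auto simp: c'_def)
    also have "\<dots> = (\<Sum>n\<in>totatives q. c' n * \<chi> n)"
      by (intro sum.mono_neutral_left) (auto simp: c'_def)
    finally show ?thesis .
  qed
  have "(\<Sum>\<chi>\<in>dirichlet_characters q. (cmod (\<Sum>n\<in>N. c n * \<chi> n))\<^sup>2)
      \<le> real (totient q) * (\<Sum>n\<in>totatives q. (cmod (c' n))\<^sup>2)"
    using bessel_totatives[OF assms(1), of c'] eq by simp
  also have "(\<Sum>n\<in>totatives q. (cmod (c' n))\<^sup>2) = (\<Sum>n\<in>N \<inter> totatives q. (cmod (c n))\<^sup>2)"
    by (intro sum.mono_neutral_cong_right) (auto simp: c'_def)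
  also have "\<dots> \<le> (\<Sum>n\<in>N. (cmod (c n))\<^sup>2)"
    using finN by (intro sum_mono2) auto
  finally show ?thesis
    using assms(1) by (simp add: character_mean_def divide_simps mult.commute)
qed

text \<open>
  Bessel's inequality for the single coefficient at \<open>1\<close>, where every character has the value \<open>1\<close>.
\<close>

lemma card_dirichlet_characters_le:
  assumes "q > 0"
  shows "card (dirichlet_characters q) \<le> totient q"
proof -
  have "character_mean q (\<lambda>\<chi>. (cmod (\<Sum>n\<in>{Suc 0}. 1 * \<chi> n))\<^sup>2) \<le> (\<Sum>n\<in>{Suc 0}. (cmod 1)\<^sup>2)"
    using assms by (intro character_mean_square_le) auto
  thus ?thesis using assms
    by (simp add: character_mean_def dirichlet_character_1 divide_simps)
qed

lemma character_mean_mono: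
  assumes "\<And>\<chi>. \<chi> \<in> dirichlet_characters q \<Longrightarrow> F \<chi> \<le> G \<chi>"
  shows "character_mean q F \<le> character_mean q G"
  unfolding character_mean_def using assms by (intro mult_left_mono sum_mono) auto

lemma character_mean_add:
  "character_mean q (\<lambda>\<chi>. F \<chi> + G \<chi>) = character_mean q F + character_mean q G"
  by (simp add: character_mean_def sum.distrib algebra_simps)

lemma character_mean_sum:
  "character_mean q (\<lambda>\<chi>. \<Sum>i\<in>I. F i \<chi>) = (\<Sum>i\<in>I. character_mean q (F i))"
  unfolding character_mean_def by (subst sum.swap) (simp add: sum_distrib_left)

lemma character_mean_mult_left:
  "character_mean q (\<lambda>\<chi>. c * F \<chi>) = c * character_mean q F"
  by (simp add: character_mean_def sum_distrib_left [symmetric])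

lemma character_mean_const_le:
  assumes "q > 0" "c \<ge> 0"
  shows "character_mean q (\<lambda>\<chi>. c) \<le> c"
  using card_dirichlet_characters_le[OF assms(1)] assms
  by (simp add: character_mean_def divide_simps mult_left_mono mult.commute)

lemma character_mean_Cauchy_Schwarz:
  assumes "q > 0"
  shows "character_mean q (\<lambda>\<chi>. F \<chi> * G \<chi>)
           \<le> sqrt (character_mean q (\<lambda>\<chi>. (F \<chi>)\<^sup>2)) * sqrt (character_mean q (\<lambda>\<chi>. (G \<chi>)\<^sup>2))"
proof -
  have "(\<Sum>\<chi>\<in>dirichlet_characters q. F \<chi> * G \<chi>)
      \<le> sqrt (\<Sum>\<chi>\<in>dirichlet_characters q. (F \<chi>)\<^sup>2) * sqrt (\<Sum>\<chi>\<in>dirichlet_characters q. (G \<chi>)\<^sup>2)"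
    unfolding real_sqrt_mult [symmetric] by (intro real_le_rsqrt Cauchy_Schwarz_ineq_sum)
  hence "character_mean q (\<lambda>\<chi>. F \<chi> * G \<chi>) \<le> 1 / real (totient q) *
      (sqrt (\<Sum>\<chi>\<in>dirichlet_characters q. (F \<chi>)\<^sup>2) * sqrt (\<Sum>\<chi>\<in>dirichlet_characters q. (G \<chi>)\<^sup>2))"
    unfolding character_mean_def by (intro mult_left_mono) auto
  also have "\<dots> = sqrt (character_mean q (\<lambda>\<chi>. (F \<chi>)\<^sup>2)) * sqrt (character_mean q (\<lambda>\<chi>. (G \<chi>)\<^sup>2))"
    unfolding character_mean_def real_sqrt_mult
    by (simp add: real_sqrt_divide real_sqrt_mult_self)
  finally show ?thesis .
qed

lemma character_mean_norm_sum_le: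
  assumes "q > 0" "N \<subseteq> {0<..q}" "\<And>n. n \<in> N \<Longrightarrow> cmod (c n) \<le> 1"
  shows "character_mean q (\<lambda>\<chi>. cmod (\<Sum>n\<in>N. c n * \<chi> n)) \<le> sqrt (card N)"
proof -
  let ?F = "\<lambda>\<chi>. cmod (\<Sum>n\<in>N. c n * \<chi> n)"
  have "character_mean q (\<lambda>\<chi>. ?F \<chi> * 1)
      \<le> sqrt (character_mean q (\<lambda>\<chi>. (?F \<chi>)\<^sup>2)) * sqrt (character_mean q (\<lambda>\<chi>. 1\<^sup>2))"
    by (rule character_mean_Cauchy_Schwarz[OF assms(1)])
  also have "\<dots> \<le> sqrt (card N) * sqrt 1"
  proof (intro mult_mono real_sqrt_le_mono)
    have "character_mean q (\<lambda>\<chi>. (?F \<chi>)\<^sup>2) \<le> (\<Sum>n\<in>N. (cmod (c n))\<^sup>2)"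
      by (rule character_mean_square_le[OF assms(1,2)])
    also have "\<dots> \<le> (\<Sum>n\<in>N. 1)" using assms(3) by (intro sum_mono) (auto simp: power_le_one)
    finally show "character_mean q (\<lambda>\<chi>. (?F \<chi>)\<^sup>2) \<le> real (card N)" by simp
    show "character_mean q (\<lambda>\<chi>. 1\<^sup>2) \<le> 1"
      using character_mean_const_le[OF assms(1), of 1] by simp
  qed (auto simp: character_mean_def intro!: divide_nonneg_nonneg)
  finally show ?thesis by simp
qed

text \<open>
  This is where independence of two variables pays: a double sum over \<open>A\<close> and \<open>B\<close> is bounded by the
  square root of its number of terms, although products \<open>a * b\<close> may exceed \<open>q\<close> and may coincide.
\<close>

lemma character_mean_product_le:
  assumes "q > 0" "A \<subseteq> {0<..q}" "B \<subseteq> {0<..q}"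
  shows "character_mean q (\<lambda>\<chi>. cmod (\<Sum>a\<in>A. \<chi> a) * cmod (\<Sum>b\<in>B. \<chi> b))
           \<le> sqrt (card A * card B)"
proof -
  have sq: "character_mean q (\<lambda>\<chi>. (cmod (\<Sum>a\<in>M. \<chi> a))\<^sup>2) \<le> real (card M)"
    if "M \<subseteq> {0<..q}" for M
    using character_mean_square_le[OF assms(1) that, of "\<lambda>_. 1"] by simp
  have "character_mean q (\<lambda>\<chi>. cmod (\<Sum>a\<in>A. \<chi> a) * cmod (\<Sum>b\<in>B. \<chi> b))
      \<le> sqrt (character_mean q (\<lambda>\<chi>. (cmod (\<Sum>a\<in>A. \<chi> a))\<^sup>2)) *
        sqrt (character_mean q (\<lambda>\<chi>. (cmod (\<Sum>b\<in>B. \<chi> b))\<^sup>2))"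
    by (rule character_mean_Cauchy_Schwarz[OF assms(1)])
  also have "\<dots> \<le> sqrt (card A) * sqrt (card B)"
    using sq[OF assms(2)] sq[OF assms(3)]
    by (intro mult_mono real_sqrt_le_mono)
       (auto simp: character_mean_def intro!: divide_nonneg_nonneg sum_nonneg)
  finally show ?thesis by (simp add: real_sqrt_mult)
qed

section \<open>Chebyshev and Mertens bounds for the von Mangoldt function\<close>

lemma exp_1_le: "exp (1::real) \<le> 14 / 5"
proof -
  have "exp (1::real) = exp (1 / 16) ^ 16" by (simp add: exp_of_nat_mult [symmetric])
  also have "\<dots> \<le> (273 / 256) ^ 16"
    using exp_bound[of "1 / 16"] by (intro power_mono) (auto simp: power2_eq_square)
  also have "\<dots> \<le> 14 / 5" by (simp add: power_divide)
  finally show ?thesis .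
qed

lemma ln_2_bounds: "2 / 3 \<le> ln (2::real)" "ln (2::real) \<le> 3 / 4"
proof -
  have "exp (2 / 3 :: real) = exp (1 / 12) ^ 8"
    by (simp add: exp_of_nat_mult [symmetric])
  also have "\<dots> \<le> (157 / 144) ^ 8"
    using exp_bound[of "1 / 12"] by (intro power_mono) (auto simp: power2_eq_square)
  also have "\<dots> \<le> 2" by (simp add: power_divide)
  finally show "2 / 3 \<le> ln (2::real)" by (subst ln_ge_iff) auto
  have "2 \<le> exp (3 / 4 :: real)"
    using exp_lower_Taylor_quadratic[of "3 / 4"] by (simp add: power2_eq_square)
  hence "ln 2 \<le> ln (exp (3 / 4 :: real))" by (subst ln_le_cancel_iff) auto
  thus "ln (2::real) \<le> 3 / 4" by simp
qed

definition chebyshev_psi :: "nat \<Rightarrow> real" where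
  "chebyshev_psi n = (\<Sum>d\<in>{1..n}. mangoldt d)"

text \<open>
  Legendre's formula, with a summation bound \<open>N\<close> that may exceed \<open>n\<close> so that \<open>ln (fact m)\<close> and
  \<open>ln (fact (2 * m))\<close> can be compared term by term.
\<close>

lemma ln_fact_eq_sum_mangoldt:
  assumes "n \<le> N"
  shows "ln (fact n :: real) = (\<Sum>d\<in>{1..N}. mangoldt d * real (n div d))"
proof -
  have "ln (fact n :: real) = (\<Sum>m\<in>{1..n}. ln (real m))"
    unfolding fact_prod of_nat_prod by (subst ln_prod) auto
  also have "\<dots> = (\<Sum>m\<in>{1..n}. \<Sum>d | d dvd m. mangoldt d)"
  proof (rule sum.cong[OF refl])
    fix m assume "m \<in> {1..n}"
    thus "ln (real m) = (\<Sum>d | d dvd m. mangoldt d)"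
      using mangoldt_sum[of m, where ?'a = real] by simp
  qed
  also have "\<dots> = (\<Sum>m\<in>{1..n}. \<Sum>d\<in>{1..N}. if d dvd m then mangoldt d else 0)"
  proof (rule sum.cong[OF refl])
    fix m assume m: "m \<in> {1..n}"
    hence "{d. d dvd m} = {d \<in> {1..N}. d dvd m}"
      using assms by (auto dest: dvd_imp_le intro: Nat.gr0I)
    thus "(\<Sum>d | d dvd m. mangoldt d) = (\<Sum>d\<in>{1..N}. if d dvd m then mangoldt d else (0::real))"
      by (simp only:) (rule sum.inter_filter, simp)
  qed
  also have "\<dots> = (\<Sum>d\<in>{1..N}. \<Sum>m\<in>{1..n}. if d dvd m then mangoldt d else 0)"
    by (rule sum.swap)
  also have "\<dots> = (\<Sum>d\<in>{1..N}. mangoldt d * real (n div d))"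
  proof (rule sum.cong[OF refl])
    fix d assume d: "d \<in> {1..N}"
    have "(\<Sum>m\<in>{1..n}. if d dvd m then mangoldt d else (0::real)) =
        real (card {m \<in> {1..n}. d dvd m}) * mangoldt d"
      by (subst sum.inter_filter [symmetric]) auto
    also have "{m \<in> {1..n}. d dvd m} = (\<lambda>k. d * k) ` {1..n div d}"
    proof (intro equalityI subsetI)
      fix m assume "m \<in> {m \<in> {1..n}. d dvd m}"
      then obtain k where k: "m = d * k" "1 \<le> m" "m \<le> n" by auto
      hence "1 \<le> k" "k \<le> n div d" using d
        by (auto simp: less_eq_div_iff_mult_less_eq mult.commute intro: Suc_leI Nat.gr0I)
      thus "m \<in> (\<lambda>k. d * k) ` {1..n div d}" using k by auto
    next
      fix m assume "m \<in> (\<lambda>k. d * k) ` {1..n div d}"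
      thus "m \<in> {m \<in> {1..n}. d dvd m}"
        using d by (auto simp: less_eq_div_iff_mult_less_eq mult.commute)
    qed
    also have "card \<dots> = n div d" using d by (subst card_image) (auto simp: inj_on_def)
    finally show "(\<Sum>m\<in>{1..n}. if d dvd m then mangoldt d else (0::real)) =
        mangoldt d * real (n div d)" by simp
  qed
  finally show ?thesis .
qed

lemma ln_fact_ge: "ln (fact n) \<ge> real n * ln (real n) - real n"
proof (induction n)
  case (Suc n)
  show ?case
  proof (cases "n = 0")
    case False
    have "ln (1 + 1 / real n) \<le> 1 / real n" using False by (intro ln_add_one_self_le_self) auto
    also have "ln (1 + 1 / real n) = ln (real (Suc n)) - ln (real n)"
      proof -
      have "1 + 1 / real n = real (Suc n) / real n" using False by (simp add: field_simps)
      thus ?thesis using False by (simp add: ln_div)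
    qed
    finally have "real n * (ln (real (Suc n)) - ln (real n)) \<le> 1"
      using False by (simp add: field_simps)
    moreover have "ln (fact (Suc n) :: real) = ln (real (Suc n)) + ln (fact n)"
      by (simp add: ln_mult)
    ultimately show ?thesis using Suc by (simp add: algebra_simps)
  qed simp
qed simp

lemma ln_fact_le: "ln (fact n) \<le> real n * ln (real n)"
proof (cases "n = 0")
  case False
  have "(fact n :: real) \<le> real n ^ n"
    using fact_le_power[of n, where ?'a = real] by simp
  hence "ln (fact n :: real) \<le> ln (real n ^ n)" using False by (subst ln_le_cancel_iff) auto
  also have "\<dots> = real n * ln (real n)" using False by (simp add: ln_realpow)
  finally show ?thesis .
qed simp

text \<open>
  Chebyshev's device: the weights on the right are \<open>0\<close> or \<open>1\<close>, and equal to \<open>1\<close> for \<open>m < d \<le> 2 * m\<close>. The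
  logarithm of the central binomial coefficient thus lies between \<open>\<psi>(2m) - \<psi>(m)\<close> and \<open>\<psi>(2m)\<close>.
\<close>

lemma ln_central_binomial_eq:
  "ln (real (2 * m choose m)) =
     (\<Sum>d\<in>{1..2*m}. mangoldt d * (real (2 * m div d) - 2 * real (m div d)))"
proof -
  have "real (2 * m choose m) = fact (2 * m) / (fact m * fact m)"
    using binomial_fact[of m "2 * m", where ?'a = real] by simp
  hence "ln (real (2 * m choose m)) = ln (fact (2 * m)) - 2 * ln (fact m :: real)"
    by (simp add: ln_div ln_mult)
  also have "\<dots> = (\<Sum>d\<in>{1..2*m}. mangoldt d * real (2 * m div d)) -
      2 * (\<Sum>d\<in>{1..2*m}. mangoldt d * real (m div d))"
    by (subst ln_fact_eq_sum_mangoldt[of "2*m" "2*m"], simp,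
        subst ln_fact_eq_sum_mangoldt[of m "2*m"], simp_all)
  finally show ?thesis by (simp add: sum_subtractf sum_distrib_left algebra_simps)
qed

lemma double_div_bounds:
  fixes m d :: nat
  assumes "d > 0"
  shows "2 * (m div d) \<le> 2 * m div d" "2 * m div d \<le> 2 * (m div d) + 1"
proof -
  show "2 * (m div d) \<le> 2 * m div d"
    using assms by (simp add: less_eq_div_iff_mult_less_eq)
  have "m < d * (m div d) + d" using assms
    using dividend_less_div_times[of d m] by (simp add: mult.commute)
  hence "2 * m < (2 * (m div d) + 2) * d" by (simp add: algebra_simps)
  hence "2 * m div d < 2 * (m div d) + 2" using assms by (simp add: less_mult_imp_div_less)
  thus "2 * m div d \<le> 2 * (m div d) + 1" by simp
qed

lemma chebyshev_psi_lower_nat: "real m * ln 2 \<le> chebyshev_psi (2 * m)"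
proof -
  have "(2::real) ^ m \<le> real (2 * m choose m)"
    using binomial_ge_n_over_k_pow_k[of m "2 * m", where ?'a = real] by (cases "m = 0") auto
  hence "ln (2 ^ m) \<le> ln (real (2 * m choose m))" by (subst ln_le_cancel_iff) auto
  also have "\<dots> \<le> (\<Sum>d\<in>{1..2*m}. mangoldt d * 1)"
    unfolding ln_central_binomial_eq
  proof (intro sum_mono mult_left_mono mangoldt_nonneg)
    fix d assume "d \<in> {1..2*m}"
    hence "2 * m div d \<le> 2 * (m div d) + 1" by (intro double_div_bounds) auto
    thus "real (2 * m div d) - 2 * real (m div d) \<le> 1" by linarith
  qed
  finally show ?thesis by (simp add: chebyshev_psi_def ln_realpow)
qed

lemma chebyshev_psi_mono: "m \<le> n \<Longrightarrow> chebyshev_psi m \<le> chebyshev_psi n"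
  unfolding chebyshev_psi_def by (intro sum_mono2) (auto simp: mangoldt_nonneg)

lemma chebyshev_psi_double_le: "chebyshev_psi (2 * m) \<le> chebyshev_psi m + real m * ln 4"
proof -
  have "chebyshev_psi (2 * m) - chebyshev_psi m = (\<Sum>d\<in>{m<..2*m}. mangoldt d * 1)"
    unfolding chebyshev_psi_def
    by (subst sum_diff [symmetric]) (auto intro!: sum.cong)
  also have "\<dots> \<le> (\<Sum>d\<in>{m<..2*m}. mangoldt d * (real (2 * m div d) - 2 * real (m div d)))"
  proof (intro sum_mono mult_left_mono mangoldt_nonneg)
    fix d assume d: "d \<in> {m<..2*m}"
    hence "m div d = 0" "2 * m div d \<ge> 1"
      using less_eq_div_iff_mult_less_eq[of d 1 "2 * m"] by auto
    thus "1 \<le> real (2 * m div d) - 2 * real (m div d)" by simp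
  qed
  also have "\<dots> \<le> (\<Sum>d\<in>{1..2*m}. mangoldt d * (real (2 * m div d) - 2 * real (m div d)))"
  proof (intro sum_mono2 mult_nonneg_nonneg mangoldt_nonneg)
    fix d assume "d \<in> {1..2*m} - {m<..2*m}"
    hence "2 * (m div d) \<le> 2 * m div d" by (intro double_div_bounds) auto
    thus "0 \<le> real (2 * m div d) - 2 * real (m div d)" by linarith
  qed auto
  also have "\<dots> = ln (real (2 * m choose m))" by (rule ln_central_binomial_eq [symmetric])
  also have "\<dots> \<le> ln (4 ^ m)"
  proof (subst ln_le_cancel_iff)
    have "real (2 * m choose m) \<le> real (2 ^ (2 * m))"
      by (intro of_nat_mono binomial_le_pow2)
    thus "real (2 * m choose m) \<le> 4 ^ m" by (simp add: power_mult)
  qed auto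
  finally show ?thesis by (simp add: ln_realpow)
qed

lemma chebyshev_psi_upper: "chebyshev_psi n \<le> 4 * real n"
proof (induction n rule: less_induct)
  case (less n)
  have ln4: "ln (4::real) \<le> 3 / 2" 
    using ln_2_bounds(2) ln_realpow[of 2 2] by simp
  show ?case
  proof (cases "n < 2")
    case True
    hence "n = 0 \<or> n = 1" by auto
    thus ?thesis by (auto simp: chebyshev_psi_def)
  next
    case False
    define m where "m = n div 2"
    have m: "m < n" "m \<ge> 1" using False by (auto simp: m_def)
    have "chebyshev_psi (2 * m) \<le> 4 * real m + real m * (3 / 2)"
      using chebyshev_psi_double_le[of m] less.IH[OF m(1)]
        mult_left_mono[OF ln4, of "real m"] by simp
    moreover have "chebyshev_psi n \<le> chebyshev_psi (2 * m) + ln (real n)"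
    proof (cases "even n")
      case True
      thus ?thesis using False by (simp add: m_def)
    next
      case odd: False
      hence "n = Suc (2 * m)" by (simp add: m_def)
      thus ?thesis using mangoldt_le[of n] by (simp add: chebyshev_psi_def)
    qed
    moreover have "ln (real n) \<le> real n - 1" using False by (intro ln_le_minus_one) auto
    moreover have "real n \<le> 2 * real m + 1" "2 * real m \<le> real n" by (auto simp: m_def)
    ultimately show ?thesis using m(2) by linarith
  qed
qed

lemma chebyshev_psi_lower:
  assumes "x \<ge> 2"
  shows "chebyshev_psi (nat \<lfloor>x\<rfloor>) \<ge> x / 6"
proof -
  define m where "m = nat \<lfloor>x\<rfloor> div 2"
  have "x / 6 \<le> real m * (2/3)"
  proof -
    have "2 * m + 2 > nat \<lfloor>x\<rfloor>" "m \<ge> 1" using assms by (auto simp: m_def) linarith+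
    hence "x < 2 * real m + 2" "m \<ge> 1" by linarith+
    thus ?thesis by linarith
  qed
  also have "\<dots> \<le> real m * ln 2" using ln_2_bounds(1) by (intro mult_left_mono) auto
  also have "\<dots> \<le> chebyshev_psi (2 * m)" by (rule chebyshev_psi_lower_nat)
  also have "\<dots> \<le> chebyshev_psi (nat \<lfloor>x\<rfloor>)" by (intro chebyshev_psi_mono) (simp add: m_def)
  finally show ?thesis .
qed

text \<open>
  Both of Mertens' bounds compare \<open>ln (fact n) = n * ln n + O(n)\<close> with Legendre's formula. Dropping the
  rounding in \<open>n div d\<close> can only increase the sum, and it does so by at most \<open>\<psi>(n) = O(n)\<close>.
\<close>

lemma mertens_lower_nat:
  assumes "n > 0"
  shows "ln (real n) - 1 \<le> (\<Sum>d\<in>{1..n}. mangoldt d / real d)"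
proof -
  have "real n * (ln (real n) - 1) \<le> ln (fact n)" using ln_fact_ge[of n] by (simp add: algebra_simps)
  also have "\<dots> = (\<Sum>d\<in>{1..n}. mangoldt d * real (n div d))" by (rule ln_fact_eq_sum_mangoldt) simp
  also have "\<dots> \<le> (\<Sum>d\<in>{1..n}. mangoldt d * (real n / real d))"
    by (intro sum_mono mult_left_mono mangoldt_nonneg of_nat_div_le_of_nat)
  also have "\<dots> = real n * (\<Sum>d\<in>{1..n}. mangoldt d / real d)"
    by (simp add: sum_distrib_left algebra_simps)
  finally show ?thesis using assms by simp
qed

lemma mertens_upper_nat:
  assumes "n > 0"
  shows "(\<Sum>d\<in>{1..n}. mangoldt d / real d) \<le> ln (real n) + 4"
proof -
  have "real n * (\<Sum>d\<in>{1..n}. mangoldt d / real d) - chebyshev_psi n =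
      (\<Sum>d\<in>{1..n}. mangoldt d * (real n / real d - 1))"
    by (simp add: sum_distrib_left sum_subtractf chebyshev_psi_def algebra_simps)
  also have "\<dots> \<le> (\<Sum>d\<in>{1..n}. mangoldt d * real (n div d))"
  proof (intro sum_mono mult_left_mono mangoldt_nonneg)
    fix d assume "d \<in> {1..n}"
    show "real n / real d - 1 \<le> real (n div d)"
      using floor_divide_of_nat_eq[of n d, where ?'a = real] by linarith
  qed
  also have "\<dots> = ln (fact n)" by (rule ln_fact_eq_sum_mangoldt [symmetric]) simp
  also have "\<dots> \<le> real n * ln (real n)" by (rule ln_fact_le)
  finally have "real n * (\<Sum>d\<in>{1..n}. mangoldt d / real d) \<le> real n * (ln (real n) + 4)"
    using chebyshev_psi_upper[of n] by (simp add: algebra_simps)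
  thus ?thesis using assms by simp
qed

lemma mertens_lower:
  assumes "x \<ge> 1"
  shows "ln x - 2 \<le> (\<Sum>d\<in>{1..nat \<lfloor>x\<rfloor>}. mangoldt d / real d)"
proof -
  define k where "k = nat \<lfloor>x\<rfloor>"
  have "\<lfloor>x\<rfloor> \<ge> 1" using assms by (simp add: le_floor_iff)
  hence k: "k > 0" "x \<le> 2 * real k" using assms unfolding k_def by linarith+
  have "ln x \<le> ln (2 * real k)" using assms k by (intro ln_mono) auto
  also have "\<dots> = ln 2 + ln (real k)" using k by (simp add: ln_mult)
  also have "ln (2::real) \<le> 1" using ln_2_less_1 by simp
  finally show ?thesis using mertens_lower_nat[OF k(1)] by (simp add: k_def)
qed

lemma mertens_upper:
  assumes "x \<ge> 1"
  shows "(\<Sum>d\<in>{1..nat \<lfloor>x\<rfloor>}. mangoldt d / real d) \<le> ln x + 4"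
proof -
  have "\<lfloor>x\<rfloor> \<ge> 1" using assms by (simp add: le_floor_iff)
  hence pos: "nat \<lfloor>x\<rfloor> > 0" by simp
  moreover have "real (nat \<lfloor>x\<rfloor>) \<le> x" using assms by simp
  ultimately have "ln (real (nat \<lfloor>x\<rfloor>)) \<le> ln x" using assms by simp
  thus ?thesis using mertens_upper_nat[OF pos] by linarith
qed

section \<open>Counting smooth numbers\<close>

lemma smooth_upto_iff:
  assumes "y \<ge> 1"
  shows "n \<in> smooth_upto x y \<longleftrightarrow>
           0 < n \<and> real n \<le> x \<and> (\<forall>p. prime p \<longrightarrow> p dvd n \<longrightarrow> real p \<le> y)"
proof (cases "n \<le> 1")
  case True
  hence "n = 0 \<or> n = 1" by auto
  thus ?thesis using assms by (auto simp: smooth_upto_def largest_prime_factor_def)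
next
  case False
  hence "prime_factors n \<noteq> {}" by (auto simp: prime_factorization_empty_iff)
  hence "real (Max (prime_factors n)) \<le> y \<longleftrightarrow> (\<forall>p\<in>prime_factors n. real p \<le> y)"
    by (metis (no_types, lifting) Max_ge Max_in finite_set_mset of_nat_le_iff order_trans)
  thus ?thesis using False
    by (auto simp: smooth_upto_def largest_prime_factor_def in_prime_factors_iff)
qed

lemma smooth_upto_subset: "smooth_upto x y \<subseteq> {1..nat \<lfloor>x\<rfloor>}"
  by (auto simp: smooth_upto_def le_nat_floor)

lemma finite_smooth_upto [simp]: "finite (smooth_upto x y)"
  using smooth_upto_subset finite_subset by blast

lemma smooth_upto_less_1: "x < 1 \<Longrightarrow> smooth_upto x y = {}"
  by (auto simp: smooth_upto_def)

lemma Psi_less_1: "x < 1 \<Longrightarrow> Psi x y = 0"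
  by (simp add: Psi_def smooth_upto_less_1)

lemma Psi_mono: "x \<le> x' \<Longrightarrow> Psi x y \<le> Psi x' y"
  unfolding Psi_def by (intro card_mono finite_smooth_upto) (auto simp: smooth_upto_def)

lemma Psi_le: "x \<ge> 0 \<Longrightarrow> real (Psi x y) \<le> x"
proof -
  assume "x \<ge> 0"
  have "card (smooth_upto x y) \<le> nat \<lfloor>x\<rfloor>"
    using card_mono[OF _ smooth_upto_subset, of x y] by simp
  thus ?thesis using \<open>x \<ge> 0\<close> unfolding Psi_def by linarith
qed

text \<open>
  Dividing the multiples of a smooth \<open>d\<close> by \<open>d\<close> is what turns divisibility conditions into values of
  \<open>Psi\<close> at smaller arguments.
\<close>

lemma smooth_upto_multiples:
  assumes "y \<ge> 1" "d > 0" "\<forall>p. prime p \<longrightarrow> p dvd d \<longrightarrow> real p \<le> y"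
  shows "{n \<in> smooth_upto x y. d dvd n} = (\<lambda>m. d * m) ` smooth_upto (x / real d) y"
proof (intro equalityI subsetI)
  fix n assume "n \<in> {n \<in> smooth_upto x y. d dvd n}"
  then obtain m where "n = d * m" "d * m \<in> smooth_upto x y" by auto
  thus "n \<in> (\<lambda>m. d * m) ` smooth_upto (x / real d) y"
    using assms by (auto simp: smooth_upto_iff field_simps intro!: imageI)
next
  fix n assume "n \<in> (\<lambda>m. d * m) ` smooth_upto (x / real d) y"
  thus "n \<in> {n \<in> smooth_upto x y. d dvd n}"
    using assms by (auto simp: smooth_upto_iff field_simps prime_dvd_mult_iff)
qed

lemma card_smooth_upto_multiples:
  assumes "y \<ge> 1" "d > 0" "\<forall>p. prime p \<longrightarrow> p dvd d \<longrightarrow> real p \<le> y"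
  shows "card {n \<in> smooth_upto x y. d dvd n} = Psi (x / real d) y"
  unfolding smooth_upto_multiples[OF assms] Psi_def using assms
  by (intro card_image) (auto simp: inj_on_def)

text \<open>
  The sum of \<open>ln n\<close> over the smooth \<open>n \<le> x\<close>, evaluated by means of \<open>ln n = \<Sum>d dvd n. mangoldt d\<close> and
  keeping only \<open>d \<le> y\<close>, for which a prime power \<open>d\<close> is smooth. All later comparisons of values of \<open>Psi\<close>
  are consequences of this inequality.
\<close>

lemma sum_mangoldt_Psi_le:
  assumes "y \<ge> 1"
  shows "(\<Sum>d\<in>{1..nat \<lfloor>y\<rfloor>}. mangoldt d * real (Psi (x / real d) y)) \<le> ln x * real (Psi x y)"
proof (cases "x < 1")
  case True
  have "x / real d < 1" if "d \<ge> 1" for d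
    using that True by (cases "x \<le> 0") (auto simp: field_simps intro: le_less_trans)
  thus ?thesis using True by (simp add: Psi_less_1)
next
  case False
  let ?D = "{1..nat \<lfloor>y\<rfloor>}"
  have "(\<Sum>d\<in>?D. mangoldt d * real (Psi (x / real d) y)) =
      (\<Sum>d\<in>?D. \<Sum>n\<in>smooth_upto x y. if d dvd n then mangoldt d else 0)"
  proof (rule sum.cong[OF refl])
    fix d assume d: "d \<in> ?D"
    show "mangoldt d * real (Psi (x / real d) y) =
        (\<Sum>n\<in>smooth_upto x y. if d dvd n then mangoldt d else 0)"
    proof (cases "primepow d")
      case True
      have "\<forall>p. prime p \<longrightarrow> p dvd d \<longrightarrow> real p \<le> y"
      proof (intro allI impI)
        fix p :: nat assume "p dvd d"
        hence "p \<le> d" using d by (auto dest: dvd_imp_le)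
        moreover have "real d \<le> y" using d assms by (auto simp: le_nat_iff le_floor_iff)
        ultimately show "real p \<le> y" by linarith
      qed
      hence "card {n \<in> smooth_upto x y. d dvd n} = Psi (x / real d) y"
        using d assms by (intro card_smooth_upto_multiples) auto
      thus ?thesis by (subst sum.inter_filter [symmetric]) (auto simp: mult.commute)
    next
      case False
      hence "mangoldt d = (0::real)" by (simp add: mangoldt_def)
      thus ?thesis by (simp add: if_distrib cong: if_cong)
    qed
  qed
  also have "\<dots> = (\<Sum>n\<in>smooth_upto x y. \<Sum>d\<in>?D. if d dvd n then mangoldt d else 0)"
    by (rule sum.swap)
  also have "\<dots> \<le> (\<Sum>n\<in>smooth_upto x y. ln x)"
  proof (rule sum_mono)
    fix n assume n: "n \<in> smooth_upto x y"
    have "(\<Sum>d\<in>?D. if d dvd n then mangoldt d else (0::real)) = (\<Sum>d\<in>{d\<in>?D. d dvd n}. mangoldt d)"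
      by (rule sum.inter_filter [symmetric]) simp
    also have "\<dots> \<le> (\<Sum>d | d dvd n. mangoldt d)"
      using n by (intro sum_mono2) (auto simp: mangoldt_nonneg smooth_upto_def)
    also have "\<dots> = ln (real n)" using n mangoldt_sum[of n, where ?'a = real]
      by (simp add: smooth_upto_def)
    also have "\<dots> \<le> ln x" using n by (simp add: smooth_upto_def)
    finally show "(\<Sum>d\<in>?D. if d dvd n then mangoldt d else (0::real)) \<le> ln x" .
  qed
  finally show ?thesis by (simp add: Psi_def mult.commute)
qed

text \<open>
  In the preceding inequality the terms with \<open>d \<le> D\<close> have \<open>Psi (X / d) y \<ge> Psi (X / D) y\<close>, and their
  weights add up to \<open>\<psi>(D) \<ge> D / 6\<close>.
\<close>

lemma Psi_divide_le:
  assumes "1 \<le> D" "D \<le> y" "X \<le> x" "ln x \<ge> 1"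
  shows "D * real (Psi (X / D) y) \<le> 6 * ln x * real (Psi X y)"
proof (cases "X < 1")
  case True
  hence "X / D < 1" using assms by (simp add: field_simps)
  thus ?thesis using True by (simp add: Psi_less_1)
next
  case X: False
  show ?thesis
  proof (cases "D < 2")
    case True
    have "real (Psi (X / D) y) \<le> real (Psi X y)"
      using assms X by (intro of_nat_mono Psi_mono) (auto simp: field_simps mult_le_cancel_left1)
    hence "D * real (Psi (X / D) y) \<le> (6 * ln x) * real (Psi X y)"
      using True assms by (intro mult_mono) auto
    thus ?thesis .
  next
    case False
    have "D / 6 * real (Psi (X / D) y) \<le> chebyshev_psi (nat \<lfloor>D\<rfloor>) * real (Psi (X / D) y)"
      using False by (intro mult_right_mono chebyshev_psi_lower) auto
    also have "\<dots> = (\<Sum>d\<in>{1..nat \<lfloor>D\<rfloor>}. mangoldt d * real (Psi (X / D) y))"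
      by (simp add: chebyshev_psi_def sum_distrib_right)
    also have "\<dots> \<le> (\<Sum>d\<in>{1..nat \<lfloor>D\<rfloor>}. mangoldt d * real (Psi (X / real d) y))"
    proof (intro sum_mono mult_left_mono mangoldt_nonneg of_nat_mono Psi_mono)
      fix d assume "d \<in> {1..nat \<lfloor>D\<rfloor>}"
      hence "1 \<le> d" "real d \<le> D" using assms by (auto simp: le_nat_iff le_floor_iff)
      thus "X / D \<le> X / real d" using X by (intro divide_left_mono) auto
    qed
    also have "\<dots> \<le> (\<Sum>d\<in>{1..nat \<lfloor>y\<rfloor>}. mangoldt d * real (Psi (X / real d) y))"
      using assms by (intro sum_mono2) (auto simp: mangoldt_nonneg intro!: mult_nonneg_nonneg nat_mono floor_mono order.trans[of _ "nat \<lfloor>D\<rfloor>" "nat \<lfloor>y\<rfloor>"])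
    also have "\<dots> \<le> ln X * real (Psi X y)" using assms by (intro sum_mangoldt_Psi_le) auto
    also have "\<dots> \<le> ln x * real (Psi X y)" using assms X by (intro mult_right_mono) auto
    finally show ?thesis by simp
  qed
qed

text \<open>
  The exponent \<open>\<beta>\<close> is chosen such that the bound reproduces itself. If
  \<open>Psi (X / d) y \<ge> (D / d) powr \<beta> * Psi (X / D) y / (6 * ln x)\<close> for all \<open>d\<close>, then summing with the
  weights \<open>mangoldt d\<close> returns the same inequality for \<open>D\<close>, because the weighted sum of \<open>d powr - \<beta>\<close> is
  at least \<open>ln x\<close>. The induction starts from the range \<open>D \<le> y\<close>, and the factor \<open>6 * ln x\<close> is what the
  start loses.
\<close>

lemma Psi_divide_powr_le:
  assumes "y \<ge> 1" "\<beta> \<le> 1" "ln x \<ge> 1"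
    and sum_ge: "(\<Sum>d\<in>{1..nat \<lfloor>y\<rfloor>}. mangoldt d * real d powr - \<beta>) \<ge> ln x"
    and "X \<le> x" "D \<ge> 1"
  shows "D powr \<beta> * real (Psi (X / D) y) \<le> 6 * ln x * real (Psi X y)"
proof -
  obtain n :: nat where "D < 2 ^ n" using real_arch_pow[of 2 D] by auto
  thus ?thesis using \<open>X \<le> x\<close> \<open>D \<ge> 1\<close>
  proof (induction n arbitrary: D X)
    case 0
    thus ?case by simp
  next
    case (Suc n)
    show ?case
    proof (cases "D \<le> y")
      case True
      have "D powr \<beta> \<le> D powr 1" using assms Suc.prems by (intro powr_mono) auto
      hence "D powr \<beta> * real (Psi (X / D) y) \<le> D * real (Psi (X / D) y)"
        using Suc.prems by (intro mult_right_mono) auto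
      also have "\<dots> \<le> 6 * ln x * real (Psi X y)"
        using Suc.prems True assms by (intro Psi_divide_le) auto
      finally show ?thesis .
    next
      case Dy: False
      show ?thesis
      proof (cases "X < 1")
        case True
        hence "X / D < 1" using Suc.prems by (simp add: field_simps)
        thus ?thesis using True by (simp add: Psi_less_1)
      next
        case X: False
        let ?P = "real (Psi (X / D) y)"
        have "ln x * (D powr \<beta> * ?P)
            \<le> (\<Sum>d\<in>{1..nat \<lfloor>y\<rfloor>}. mangoldt d * real d powr - \<beta>) * (D powr \<beta> * ?P)"
          using sum_ge by (intro mult_right_mono) auto
        also have "\<dots> = (\<Sum>d\<in>{1..nat \<lfloor>y\<rfloor>}. mangoldt d * ((D / real d) powr \<beta> * ?P))"
          unfolding sum_distrib_right using Suc.prems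
          by (intro sum.cong refl) (auto simp: powr_divide powr_minus field_simps)
        also have "\<dots> \<le> (\<Sum>d\<in>{1..nat \<lfloor>y\<rfloor>}. mangoldt d * (6 * ln x * real (Psi (X / real d) y)))"
        proof (rule sum_mono)
          fix d assume d: "d \<in> {1..nat \<lfloor>y\<rfloor>}"
          have dy: "real d \<le> y" using d assms by (auto simp: le_nat_iff le_floor_iff)
          show "mangoldt d * ((D / real d) powr \<beta> * ?P)
              \<le> mangoldt d * (6 * ln x * real (Psi (X / real d) y))"
          proof (cases "d = 1")
            case False
            hence d2: "d \<ge> 2" using d by auto
            have "(D / real d) powr \<beta> * real (Psi ((X / real d) / (D / real d)) y)
                \<le> 6 * ln x * real (Psi (X / real d) y)"
            proof (rule Suc.IH)
              have "D / real d \<le> D / 2" using d2 Suc.prems by (intro divide_left_mono) auto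
              also have "D / 2 < 2 ^ n" using Suc.prems by simp
              finally show "D / real d < 2 ^ n" .
              have "X / real d \<le> X / 1" using X d2 by (intro divide_left_mono) auto
              thus "X / real d \<le> x" using Suc.prems by simp
              show "1 \<le> D / real d" using d2 dy Dy by (simp add: field_simps)
            qed
            also have "(X / real d) / (D / real d) = X / D" using d2 by simp
            finally show ?thesis by (intro mult_left_mono mangoldt_nonneg)
          qed simp
        qed
        also have "\<dots> = 6 * ln x * (\<Sum>d\<in>{1..nat \<lfloor>y\<rfloor>}. mangoldt d * real (Psi (X / real d) y))"
          by (simp add: sum_distrib_left mult_ac)
        also have "\<dots> \<le> 6 * ln x * (ln X * real (Psi X y))"
          using assms by (intro mult_left_mono sum_mangoldt_Psi_le) auto
        also have "\<dots> \<le> 6 * ln x * (ln x * real (Psi X y))"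
          using assms X Suc.prems by (intro mult_left_mono mult_right_mono) auto
        finally show ?thesis using assms(3) by simp
      qed
    qed
  qed
qed

lemma card_real_interval_le:
  assumes "0 \<le> a" "a \<le> b"
  shows "real (card {p::nat. a < real p \<and> real p \<le> b}) \<le> b - a + 1"
proof -
  have "{p::nat. a < real p \<and> real p \<le> b} \<subseteq> {nat \<lfloor>a\<rfloor><..nat \<lfloor>b\<rfloor>}"
    using assms by (auto simp: le_nat_floor nat_less_iff floor_less_iff)
  hence "card {p::nat. a < real p \<and> real p \<le> b} \<le> nat \<lfloor>b\<rfloor> - nat \<lfloor>a\<rfloor>"
    using card_mono[of "{nat \<lfloor>a\<rfloor><..nat \<lfloor>b\<rfloor>}"] by simp
  moreover have "real (nat \<lfloor>b\<rfloor> - nat \<lfloor>a\<rfloor>) \<le> b - a + 1"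
    using assms by linarith
  ultimately show ?thesis by linarith
qed

text \<open>
  Such an \<open>n\<close> is \<open>m * p\<close> with \<open>p\<close> in an interval of the form \<open>(U * exp (- h), U]\<close>, where
  \<open>U = min (x / m) y\<close> exceeds \<open>sqrt y\<close>. As \<open>h * sqrt y \<ge> 1\<close>, this interval contains at most \<open>2 * h * U\<close>
  integers, and \<open>U \<le> 6 * \<psi>(U)\<close>. The sum of \<open>\<psi>(U)\<close> over \<open>m\<close> counts pairs \<open>(m, d)\<close> with \<open>m * d \<le> x\<close> and
  the weight \<open>mangoldt d\<close>, so that it is at most \<open>ln x * Psi x y\<close>.
\<close>

lemma card_smooth_short_interval_le:
  assumes "y \<ge> 4" "h \<ge> 1 / sqrt y" "x > 0" "ln x \<ge> 1"
  shows "real (card {n \<in> smooth_upto x y. real n > x * exp (- h) \<and>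
            (\<exists>p. prime p \<and> p dvd n \<and> sqrt y < real p)}) \<le> 12 * h * ln x * real (Psi x y)"
    (is "real (card ?E) \<le> _")
proof -
  have x: "x > 1" using assms(3,4) ln_gt_zero_iff[of x] by linarith
  define z where "z = sqrt y"
  have z: "z \<ge> 2" "z \<le> y"
    using assms(1) mult_left_mono[of 1 y y]
    by (auto simp: z_def real_le_rsqrt power2_eq_square intro!: real_le_lsqrt)
  have h: "h > 0" "h * z \<ge> 1"
  proof -
    have "1 / z > 0" using z by simp
    thus "h > 0" using assms(2) unfolding z_def by linarith
    show "h * z \<ge> 1" using assms(2) z(1) unfolding z_def [symmetric] by (simp add: field_simps)
  qed
  define M where "M = {m \<in> smooth_upto x y. x / real m > z}"
  define U where "U = (\<lambda>m. min (x / real m) y)"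
  define I where "I = (\<lambda>m. {p::nat. U m * exp (- h) < real p \<and> real p \<le> U m})"
  have U: "U m \<ge> z" if "m \<in> M" for m using that z by (auto simp: M_def U_def)
  have finM: "finite M" by (simp add: M_def)
  have finI: "finite (I m)" for m
    by (rule finite_subset[of _ "{..nat \<lfloor>U m\<rfloor>}"]) (auto simp: I_def le_nat_floor)
  have cardI: "real (card (I m)) \<le> 2 * h * U m" if m: "m \<in> M" for m
  proof -
    have U0: "U m > 0" using U[OF m] z by simp
    have "real (card (I m)) \<le> U m - U m * exp (- h) + 1"
      unfolding I_def using U0 h by (intro card_real_interval_le) (auto simp: mult_le_cancel_left2)
    also have "U m * (1 - h) \<le> U m * exp (- h)"
      using U0 exp_ge_add_one_self[of "- h"] by (intro mult_left_mono) auto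
    hence "U m - U m * exp (- h) + 1 \<le> h * U m + 1" by (simp add: algebra_simps)
    also have "1 \<le> h * U m" using h U[OF m] mult_left_mono[of z "U m" h] by linarith
    finally show ?thesis by simp
  qed
  have "?E \<subseteq> (\<lambda>(m,p). m * p) ` (SIGMA m:M. I m)"
  proof
    fix n assume n: "n \<in> ?E"
    then obtain p where p: "prime p" "p dvd n" "z < real p" by (auto simp: z_def)
    then obtain m where m: "n = m * p" by (auto simp: mult.commute)
    have m0: "m > 0" "p > 0" using n m by (auto simp: smooth_upto_def)
    have mpx: "real m * real p \<le> x" "x * exp (- h) < real m * real p"
      and py: "real p \<le> y"
      using n m p assms(1) by (auto simp: smooth_upto_iff)
    have "real m * 1 \<le> real m * real p" using m0 by (intro mult_left_mono) auto
    hence "real m \<le> x" using mpx by simp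
    hence "m \<in> smooth_upto x y" using n m mpx assms(1) by (auto simp: smooth_upto_iff)
    moreover have "real p \<le> x / real m" using mpx m0 by (simp add: field_simps)
    moreover have "U m * exp (- h) < real p"
    proof -
      have "U m * exp (- h) \<le> x / real m * exp (- h)"
        by (intro mult_right_mono) (auto simp: U_def)
      also have "\<dots> < real p" using mpx m0 by (simp add: field_simps)
      finally show ?thesis .
    qed
    ultimately have "(m, p) \<in> (SIGMA m:M. I m)" using p py by (auto simp: M_def I_def U_def)
    thus "n \<in> (\<lambda>(m,p). m * p) ` (SIGMA m:M. I m)" using m by force
  qed
  hence "card ?E \<le> card ((\<lambda>(m,p). m * p) ` (SIGMA m:M. I m))"
    using finM finI by (intro card_mono finite_imageI finite_SigmaI) auto
  also have "\<dots> \<le> card (SIGMA m:M. I m)"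
    using finM finI by (intro card_image_le finite_SigmaI) auto
  also have "\<dots> = (\<Sum>m\<in>M. card (I m))" using finM finI by (simp add: card_SigmaI)
  finally have "real (card ?E) \<le> (\<Sum>m\<in>M. real (card (I m)))"
    unfolding of_nat_sum [symmetric] by (rule of_nat_mono)
  also have "\<dots> \<le> (\<Sum>m\<in>M. 12 * h * chebyshev_psi (nat \<lfloor>U m\<rfloor>))"
  proof (rule sum_mono)
    fix m assume m: "m \<in> M"
    have "U m \<le> 6 * chebyshev_psi (nat \<lfloor>U m\<rfloor>)"
      using chebyshev_psi_lower[of "U m"] U[OF m] z by simp
    hence "2 * h * U m \<le> 2 * h * (6 * chebyshev_psi (nat \<lfloor>U m\<rfloor>))"
      using h by (intro mult_left_mono) auto
    thus "real (card (I m)) \<le> 12 * h * chebyshev_psi (nat \<lfloor>U m\<rfloor>)"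
      using cardI[OF m] by simp
  qed
  also have "\<dots> = 12 * h * (\<Sum>m\<in>M. chebyshev_psi (nat \<lfloor>U m\<rfloor>))"
    by (simp add: sum_distrib_left)
  also have "\<dots> \<le> 12 * h * (\<Sum>m\<in>smooth_upto x y. \<Sum>d\<in>{1..nat \<lfloor>y\<rfloor>}. if real d \<le> x / real m then mangoldt d else 0)"
  proof (intro mult_left_mono)
    have "(\<Sum>m\<in>M. chebyshev_psi (nat \<lfloor>U m\<rfloor>)) \<le>
        (\<Sum>m\<in>M. \<Sum>d\<in>{1..nat \<lfloor>y\<rfloor>}. if real d \<le> x / real m then mangoldt d else 0)"
    proof (rule sum_mono)
      fix m assume m: "m \<in> M"
      have "{1..nat \<lfloor>U m\<rfloor>} = {d \<in> {1..nat \<lfloor>y\<rfloor>}. real d \<le> x / real m}"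
        using U[OF m] z by (auto simp: U_def le_nat_iff le_floor_iff min_def)
      hence "chebyshev_psi (nat \<lfloor>U m\<rfloor>) = (\<Sum>d\<in>{d \<in> {1..nat \<lfloor>y\<rfloor>}. real d \<le> x / real m}. mangoldt d)"
        by (simp only: chebyshev_psi_def)
      also have "\<dots> = (\<Sum>d\<in>{1..nat \<lfloor>y\<rfloor>}. if real d \<le> x / real m then mangoldt d else 0)"
        by (rule sum.inter_filter) simp
      finally show "chebyshev_psi (nat \<lfloor>U m\<rfloor>) \<le>
          (\<Sum>d\<in>{1..nat \<lfloor>y\<rfloor>}. if real d \<le> x / real m then mangoldt d else 0)" by simp
    qed
    also have "\<dots> \<le> (\<Sum>m\<in>smooth_upto x y. \<Sum>d\<in>{1..nat \<lfloor>y\<rfloor>}.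
        if real d \<le> x / real m then mangoldt d else 0)"
      by (intro sum_mono2 sum_nonneg) (auto simp: M_def mangoldt_nonneg)
    finally show "(\<Sum>m\<in>M. chebyshev_psi (nat \<lfloor>U m\<rfloor>)) \<le> \<dots>" .
  qed (use h in auto)
  also have "(\<Sum>m\<in>smooth_upto x y. \<Sum>d\<in>{1..nat \<lfloor>y\<rfloor>}. if real d \<le> x / real m then mangoldt d else 0) =
      (\<Sum>d\<in>{1..nat \<lfloor>y\<rfloor>}. mangoldt d * real (Psi (x / real d) y))"
  proof (subst sum.swap, rule sum.cong[OF refl])
    fix d assume d: "d \<in> {1..nat \<lfloor>y\<rfloor>}"
    have le: "real m \<le> x" if "real m * real d \<le> x" for m
    proof -
      have "real m * 1 \<le> real m * real d" using d by (intro mult_left_mono) auto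
      thus ?thesis using that by simp
    qed
    have "{m \<in> smooth_upto x y. real d \<le> x / real m} = smooth_upto (x / real d) y"
      using d by (auto simp: smooth_upto_def field_simps intro: le)
    thus "(\<Sum>m\<in>smooth_upto x y. if real d \<le> x / real m then mangoldt d else 0) =
        mangoldt d * real (Psi (x / real d) y)"
      by (subst sum.inter_filter [symmetric]) (auto simp: Psi_def mult.commute)
  qed
  also have "12 * h * \<dots> \<le> 12 * h * (ln x * real (Psi x y))"
    using h assms by (intro mult_left_mono sum_mangoldt_Psi_le) auto
  finally show ?thesis by simp
qed

lemma sum_inverse_squares_le:
  assumes "0 < k"
  shows "(\<Sum>p\<in>{k<..N}. 1 / (real p)\<^sup>2) \<le> 1 / real k"
proof (cases "k \<le> N")
  case True
  hence "(\<Sum>p\<in>{k<..N}. 1 / (real p)\<^sup>2) \<le> 1 / real k - 1 / real N"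
  proof (induction N rule: dec_induct)
    case (step n)
    have n: "n > 0" using step assms by simp
    have "1 / (real (Suc n))\<^sup>2 \<le> 1 / real n - 1 / real (Suc n)"
    proof -
      have "1 / (real (Suc n))\<^sup>2 \<le> 1 / (real n * real (Suc n))"
        using n unfolding power2_eq_square by (intro divide_left_mono mult_right_mono mult_pos_pos) auto
      also have "\<dots> = 1 / real n - 1 / real (Suc n)" using n by (simp add: field_simps)
      finally show ?thesis .
    qed
    moreover have "{k<..Suc n} = insert (Suc n) {k<..n}" using step by auto
    ultimately show ?case using step by simp
  qed simp
  also have "\<dots> \<le> 1 / real k" by simp
  finally show ?thesis .
qed simp

text \<open>
  Two applications of \<open>Psi_divide_le\<close> show that the proportion of smooth numbers divisible by \<open>p\<^sup>2\<close> is
  \<open>O((ln x / p)\<^sup>2)\<close>, and \<open>1 / p\<^sup>2\<close> summed over \<open>p > sqrt y\<close> is \<open>O(1 / sqrt y)\<close>.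
\<close>

lemma card_smooth_large_square_le:
  assumes "y \<ge> 4" "x > 0" "ln x \<ge> 1"
  shows "real (card {n \<in> smooth_upto x y. \<exists>p. prime p \<and> sqrt y < real p \<and> p\<^sup>2 dvd n})
           \<le> 72 * (ln x)\<^sup>2 / sqrt y * real (Psi x y)"
    (is "real (card ?E) \<le> _")
proof -
  let ?D = "\<lambda>p::nat. {n \<in> smooth_upto x y. p\<^sup>2 dvd n}"
  define z where "z = sqrt y"
  have z: "z \<ge> 2"
    using assms(1) by (auto simp: z_def real_le_rsqrt)
  define k where "k = nat \<lfloor>z\<rfloor>"
  have k: "k > 0" "z \<le> 2 * real k" using z unfolding k_def by linarith+
  let ?P = "{k<..nat \<lfloor>y\<rfloor>}"
  have "?E \<subseteq> (\<Union>p\<in>{p\<in>?P. prime p}. ?D p)"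
  proof
    fix n assume n: "n \<in> ?E"
    then obtain p where p: "prime p" "z < real p" "p\<^sup>2 dvd n" by (auto simp: z_def)
    have "p dvd n" using p(3) by (metis dvd_mult_left power2_eq_square)
    hence "real p \<le> y" using n p assms(1) by (auto simp: smooth_upto_iff)
    moreover have "k < p" using p(2) z unfolding k_def by (simp add: nat_less_iff floor_less_iff)
    ultimately show "n \<in> (\<Union>p\<in>{p\<in>?P. prime p}. ?D p)"
      using n p by (auto simp: le_nat_floor)
  qed
  hence "card ?E \<le> card (\<Union>p\<in>{p\<in>?P. prime p}. ?D p)"
    by (intro card_mono) auto
  also have "\<dots> \<le> (\<Sum>p\<in>{p\<in>?P. prime p}. card (?D p))"
    by (intro card_UN_le) auto
  finally have "real (card ?E) \<le> (\<Sum>p\<in>{p\<in>?P. prime p}. real (card (?D p)))"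
    unfolding of_nat_sum [symmetric] by (rule of_nat_mono)
  also have "\<dots> \<le> (\<Sum>p\<in>{p\<in>?P. prime p}. 36 * (ln x)\<^sup>2 * real (Psi x y) * (1 / (real p)\<^sup>2))"
  proof (rule sum_mono)
    fix p assume p: "p \<in> {p\<in>?P. prime p}"
    hence py: "real p \<le> y" "real p \<ge> 1" using assms by (auto simp: le_nat_iff le_floor_iff)
    have x1: "x \<ge> 1" using assms(2,3) ln_ge_zero_iff[of x] by linarith
    hence xp: "x / real p \<le> x" using py by (simp add: field_simps mult_le_cancel_left1)
    have q: "\<forall>r. prime r \<longrightarrow> r dvd p\<^sup>2 \<longrightarrow> real r \<le> y"
    proof (intro allI impI)
      fix r :: nat assume "prime r" "r dvd p\<^sup>2"
      hence "r dvd p" by (rule prime_dvd_power)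
      hence "r = p" using p \<open>prime r\<close> by (intro primes_dvd_imp_eq) auto
      thus "real r \<le> y" using py by simp
    qed
    have "card (?D p) = Psi (x / real (p\<^sup>2)) y"
      using assms p q by (intro card_smooth_upto_multiples) auto
    also have "x / real (p\<^sup>2) = x / real p / real p" by (simp add: power2_eq_square)
    finally have "(real p)\<^sup>2 * real (card (?D p)) =
        real p * (real p * real (Psi (x / real p / real p) y))" by (simp add: power2_eq_square)
    also have "\<dots> \<le> real p * (6 * ln x * real (Psi (x / real p) y))"
      using py assms xp by (intro mult_left_mono Psi_divide_le) auto
    also have "\<dots> = 6 * ln x * (real p * real (Psi (x / real p) y))" by simp
    also have "\<dots> \<le> 6 * ln x * (6 * ln x * real (Psi x y))"
      using py assms x1 by (intro mult_left_mono Psi_divide_le) auto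
    finally show "real (card (?D p)) \<le>
        36 * (ln x)\<^sup>2 * real (Psi x y) * (1 / (real p)\<^sup>2)"
      using py by (simp add: field_simps power2_eq_square)
  qed
  also have "\<dots> \<le> (\<Sum>p\<in>?P. 36 * (ln x)\<^sup>2 * real (Psi x y) * (1 / (real p)\<^sup>2))"
    by (intro sum_mono2) auto
  also have "\<dots> = 36 * (ln x)\<^sup>2 * real (Psi x y) * (\<Sum>p\<in>?P. 1 / (real p)\<^sup>2)"
    by (simp add: sum_distrib_left)
  also have "\<dots> \<le> 36 * (ln x)\<^sup>2 * real (Psi x y) * (2 / z)"
  proof (intro mult_left_mono)
    have "(\<Sum>p\<in>?P. 1 / (real p)\<^sup>2) \<le> 1 / real k" by (rule sum_inverse_squares_le[OF k(1)])
    also have "\<dots> \<le> 2 / z" using k z by (simp add: field_simps)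
    finally show "(\<Sum>p\<in>?P. 1 / (real p)\<^sup>2) \<le> 2 / z" .
  qed auto
  finally show ?thesis by (simp add: z_def)
qed

section \<open>Sums over primes and an Euler product\<close>

text \<open>
  One direction of the Euler product, for finite sets of numbers composed of the primes of a finite
  set \<open>P\<close>. The induction splits off the power of one prime.
\<close>

lemma sum_powr_le_euler_product:
  assumes "finite P" "\<And>p. p \<in> P \<Longrightarrow> prime p" "s > 0" "finite M"
    and M: "\<And>m. m \<in> M \<Longrightarrow> m > 0 \<and> prime_factors m \<subseteq> P"
  shows "(\<Sum>m\<in>M. real m powr - s) \<le> (\<Prod>p\<in>P. 1 / (1 - real p powr - s))"
  using assms(1,2,4) M
proof (induction P arbitrary: M rule: finite_induct)
  case empty
  have "m = 1" if "m \<in> M" for m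
    using empty.prems(3)[OF that] by (auto simp: prime_factorization_empty_iff)
  hence "M \<subseteq> {1}" by blast
  hence "(\<Sum>m\<in>M. real m powr - s) \<le> (\<Sum>m\<in>{1::nat}. real m powr - s)"
    by (intro sum_mono2) auto
  thus ?case by simp
next
  case (insert p P)
  have p: "prime p" using insert.prems by auto
  hence p2: "real p \<ge> 2" using prime_ge_2_nat[of p] by simp
  define v where "v = real p powr - s"
  have v: "0 < v" "v < 1" using p2 assms(3) powr_less_one[of "real p" "- s"] by (auto simp: v_def)
  let ?f = "\<lambda>m. (multiplicity p m, m div p ^ multiplicity p m)"
  let ?g = "\<lambda>(k, m). p ^ k * m"
  define A where "A = multiplicity p ` M"
  define B where "B = (\<lambda>m. m div p ^ multiplicity p m) ` M"
  have fin: "finite A" "finite B" using insert.prems by (auto simp: A_def B_def)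
  have fact: "p ^ multiplicity p m * (m div p ^ multiplicity p m) = m" for m
    by (simp add: multiplicity_dvd)
  have "M \<subseteq> ?g ` (A \<times> B)"
  proof
    fix m assume "m \<in> M"
    hence "?f m \<in> A \<times> B" by (auto simp: A_def B_def)
    moreover have "m = ?g (?f m)" using fact[of m] by simp
    ultimately show "m \<in> ?g ` (A \<times> B)" by (rule rev_image_eqI)
  qed
  hence "(\<Sum>m\<in>M. real m powr - s) \<le> (\<Sum>m\<in>?g ` (A \<times> B). real m powr - s)"
    using fin by (intro sum_mono2) auto
  also have "\<dots> \<le> (\<Sum>km\<in>A \<times> B. real (?g km) powr - s)"
    using fin sum_image_le[of "A \<times> B" "\<lambda>m. real m powr - s" ?g] by (simp add: o_def)
  also have "\<dots> = (\<Sum>(k,m)\<in>A \<times> B. v ^ k * real m powr - s)"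
  proof (rule sum.cong[OF refl])
    fix km assume "km \<in> A \<times> B"
    obtain k m where km: "km = (k, m)" by force
    have "real (p ^ k * m) powr - s = (real p ^ k) powr - s * real m powr - s"
      by (simp add: powr_mult)
    also have "(real p ^ k) powr - s = v ^ k"
      using p2 by (simp add: v_def powr_powr powr_realpow [symmetric] mult.commute)
    finally show "real (?g km) powr - s = (case km of (k, m) \<Rightarrow> v ^ k * real m powr - s)"
      using km by simp
  qed
  also have "\<dots> = (\<Sum>k\<in>A. v ^ k) * (\<Sum>m\<in>B. real m powr - s)"
    by (simp add: sum_product sum.cartesian_product)
  also have "\<dots> \<le> (1 / (1 - v)) * (\<Prod>p\<in>P. 1 / (1 - real p powr - s))"
  proof (intro mult_mono)
    have sm: "summable (\<lambda>k. v ^ k)" using v by (intro summable_geometric) auto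
    have "(\<Sum>k\<in>A. v ^ k) \<le> (\<Sum>k. v ^ k)" using v fin by (intro sum_le_suminf sm) auto
    thus "(\<Sum>k\<in>A. v ^ k) \<le> 1 / (1 - v)" using v by (simp add: suminf_geometric)
    show "(\<Sum>m\<in>B. real m powr - s) \<le> (\<Prod>p\<in>P. 1 / (1 - real p powr - s))"
    proof (rule insert.IH)
      fix b assume "b \<in> B"
      then obtain m where m: "m \<in> M" "b = m div p ^ multiplicity p m" by (auto simp: B_def)
      have m0: "m > 0" using insert.prems(3)[OF m(1)] by simp
      have eq: "m = p ^ multiplicity p m * b" using fact[of m] m by simp
      hence b0: "b > 0" using m0 by (metis mult_0_right not_gr_zero)
      have "\<not> p dvd b" using m0 m(2) p
        by (metis multiplicity_decompose not_prime_unit not_gr_zero)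
      moreover have "prime_factors b \<subseteq> prime_factors m"
      proof (rule dvd_prime_factors)
        show "b dvd m" by (subst eq) simp
      qed (use m0 in simp)
      ultimately have "prime_factors b \<subseteq> P"
        using insert.prems(3)[OF m(1)] by (auto simp: in_prime_factors_iff)
      thus "b > 0 \<and> prime_factors b \<subseteq> P" using b0 by simp
    qed (use insert.prems fin in auto)
    show "0 \<le> (\<Sum>m\<in>B. real m powr - s)" by (intro sum_nonneg) auto
  qed (use v in auto)
  also have "\<dots> = (\<Prod>p\<in>insert p P. 1 / (1 - real p powr - s))"
    using insert.hyps by (simp add: v_def)
  finally show ?case .
qed

lemma inverse_one_minus_le_exp:
  fixes v c :: real
  assumes "0 \<le> v" "v \<le> c" "c < 1"
  shows "1 / (1 - v) \<le> exp (v / (1 - c))"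
proof -
  have "1 / (1 - v) = 1 + v / (1 - v)" using assms by (simp add: field_simps)
  also have "v / (1 - v) \<le> v / (1 - c)" using assms by (intro divide_left_mono) auto
  also have "1 + v / (1 - c) \<le> exp (v / (1 - c))" by (rule exp_ge_add_one_self)
  finally show ?thesis by simp
qed

lemma sum_primes_le_sum_mangoldt:
  assumes "\<And>d. f d \<ge> 0"
  shows "(\<Sum>p | prime p \<and> a < real p \<and> real p \<le> b. ln (real p) * f p)
           \<le> (\<Sum>d\<in>{d\<in>{1..nat \<lfloor>b\<rfloor>}. a < real d}. mangoldt d * (f d :: real))"
proof -
  have "(\<Sum>p | prime p \<and> a < real p \<and> real p \<le> b. ln (real p) * f p) =
      (\<Sum>p | prime p \<and> a < real p \<and> real p \<le> b. mangoldt p * f p)"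
    by (intro sum.cong refl) auto
  also have "\<dots> \<le> (\<Sum>d\<in>{d\<in>{1..nat \<lfloor>b\<rfloor>}. a < real d}. mangoldt d * f d)"
    using assms by (intro sum_mono2)
      (auto simp: mangoldt_nonneg le_nat_floor Suc_le_eq prime_gt_0_nat)
  finally show ?thesis .
qed

lemma sum_mangoldt_split:
  assumes "1 \<le> a" "a \<le> b"
  shows "(\<Sum>d\<in>{d\<in>{1..nat \<lfloor>b\<rfloor>}. a < real d}. mangoldt d / real d) =
           (\<Sum>d\<in>{1..nat \<lfloor>b\<rfloor>}. mangoldt d / real d) - (\<Sum>d\<in>{1..nat \<lfloor>a\<rfloor>}. mangoldt d / real d :: real)"
proof -
  have "nat \<lfloor>a\<rfloor> \<le> nat \<lfloor>b\<rfloor>" using assms by (intro nat_mono floor_mono)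
  hence "{d\<in>{1..nat \<lfloor>b\<rfloor>}. a < real d} = {1..nat \<lfloor>b\<rfloor>} - {1..nat \<lfloor>a\<rfloor>}"
    using assms by (auto simp: le_nat_iff le_floor_iff not_le)
  thus ?thesis using \<open>nat \<lfloor>a\<rfloor> \<le> nat \<lfloor>b\<rfloor>\<close> by (simp add: sum_diff)
qed

lemma sum_ln_primes_divide_le:
  assumes "x \<ge> 1"
  shows "(\<Sum>p | prime p \<and> real p \<le> x. ln (real p) * (1 / real p)) \<le> ln x + 4"
proof -
  have "(\<Sum>p | prime p \<and> real p \<le> x. ln (real p) * (1 / real p)) =
      (\<Sum>p | prime p \<and> 0 < real p \<and> real p \<le> x. ln (real p) * (1 / real p))"
    by (intro sum.cong) (auto simp: prime_gt_0_nat)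
  also have "\<dots> \<le> (\<Sum>d\<in>{d\<in>{1..nat \<lfloor>x\<rfloor>}. 0 < real d}. mangoldt d * (1 / real d))"
    by (intro sum_primes_le_sum_mangoldt) auto
  also have "{d\<in>{1..nat \<lfloor>x\<rfloor>}. 0 < real d} = {1..nat \<lfloor>x\<rfloor>}" by auto
  also have "(\<Sum>d\<in>{1..nat \<lfloor>x\<rfloor>}. mangoldt d * (1 / real d)) \<le> ln x + 4"
    using mertens_upper[OF assms] by simp
  finally show ?thesis .
qed

lemma finite_primes_le [simp]: "finite {p. prime p \<and> real p \<le> b}"
  "finite {p. prime p \<and> a < real p \<and> real p \<le> b}"
  by (rule finite_subset[of _ "{..nat \<lfloor>b\<rfloor>}"], auto simp: le_nat_floor)+

text \<open>
  A weak form of Mertens' second theorem. The primes between \<open>sqrt x\<close> and \<open>x\<close> contribute at most \<open>2\<close>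
  once \<open>x \<ge> exp 12\<close>, while replacing \<open>x\<close> by \<open>sqrt x\<close> lowers \<open>3 * ln (ln x)\<close> by \<open>3 * ln 2 \<ge> 2\<close>. The constant \<open>3\<close> has to be
  small enough for the numerical balance in \<open>card_smooth_many_small_primes_le\<close>.
\<close>

lemma sum_inverse_primes_le:
  obtains B where "\<And>x. x \<ge> exp 1 \<Longrightarrow> (\<Sum>p | prime p \<and> real p \<le> x. 1 / real p) \<le> 3 * ln (ln x) + B"
proof -
  define f where "f = (\<lambda>x. \<Sum>p | prime p \<and> real p \<le> x. 1 / real p)"
  define B where "B = f (exp 24)"
  have f_mono: "f x \<le> f x'" if "x \<le> x'" for x x'
    unfolding f_def using that by (intro sum_mono2) auto
  have block: "f x \<le> f (sqrt x) + 2" if x: "x \<ge> exp 12" for x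
  proof -
    have x1: "x \<ge> 1" using x one_le_exp_iff[of 12] by linarith
    have lx: "ln x \<ge> 12" using x x1 by (subst ln_ge_iff) auto
    have sx: "1 \<le> sqrt x" "sqrt x \<le> x" using x1 mult_left_mono[of 1 x x]
      by (auto simp: power2_eq_square intro!: real_le_lsqrt)
    have lns: "ln (sqrt x) = ln x / 2" using x1 by (simp add: ln_sqrt)
    have "f x = f (sqrt x) + (\<Sum>p | prime p \<and> sqrt x < real p \<and> real p \<le> x. 1 / real p)"
      unfolding f_def using sx by (subst sum.union_disjoint [symmetric]) (auto intro!: sum.cong)
    also have "(\<Sum>p | prime p \<and> sqrt x < real p \<and> real p \<le> x. 1 / real p)
        \<le> (\<Sum>p | prime p \<and> sqrt x < real p \<and> real p \<le> x. (2 / ln x) * (ln (real p) * (1 / real p)))"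
    proof (rule sum_mono)
      fix p assume p: "p \<in> {p. prime p \<and> sqrt x < real p \<and> real p \<le> x}"
      have "ln x / 2 \<le> ln (real p)" using p sx unfolding lns [symmetric] by (intro ln_mono) auto
      hence "1 \<le> (2 / ln x) * ln (real p)" using lx by (simp add: field_simps)
      hence "1 * (1 / real p) \<le> (2 / ln x) * ln (real p) * (1 / real p)" by (intro mult_right_mono) auto
      thus "1 / real p \<le> (2 / ln x) * (ln (real p) * (1 / real p))" by (simp add: mult.assoc)
    qed
    also have "\<dots> = (2 / ln x) * (\<Sum>p | prime p \<and> sqrt x < real p \<and> real p \<le> x. ln (real p) * (1 / real p))"
      by (simp add: sum_distrib_left)
    also have "\<dots> \<le> (2 / ln x) * (ln x / 2 + 6)"
    proof (intro mult_left_mono)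
      have "(\<Sum>p | prime p \<and> sqrt x < real p \<and> real p \<le> x. ln (real p) * (1 / real p))
          \<le> (\<Sum>d\<in>{d\<in>{1..nat \<lfloor>x\<rfloor>}. sqrt x < real d}. mangoldt d * (1 / real d))"
        by (intro sum_primes_le_sum_mangoldt) auto
      also have "\<dots> \<le> (ln x + 4) - (ln x / 2 - 2)"
        using sum_mangoldt_split[OF sx] mertens_upper[OF x1] mertens_lower[OF sx(1)] lns by simp
      finally show "(\<Sum>p | prime p \<and> sqrt x < real p \<and> real p \<le> x. ln (real p) * (1 / real p)) \<le> ln x / 2 + 6"
        by simp
    qed (use lx in auto)
    also have "\<dots> \<le> 2" using lx by (simp add: field_simps)
    finally show ?thesis by simp
  qed
  have main: "f x \<le> 3 * ln (ln x) + B" if "x \<ge> exp 1" "ln x \<le> 2 ^ n" for x n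
    using that
  proof (induction n arbitrary: x)
    case 0
    have "x > 0" using 0 exp_gt_zero[of 1] by linarith
    have "ln x \<ge> 1" using 0 \<open>x > 0\<close> by (subst ln_ge_iff) auto
    moreover have "x \<le> exp 24" using 0 \<open>x > 0\<close> by (metis exp_le_cancel_iff exp_ln one_le_numeral order_trans power_0)
    ultimately show ?case using f_mono[of x "exp 24"] by (simp add: B_def add_increasing)
  next
    case (Suc n)
    have x0: "x > 0" using Suc.prems exp_gt_zero[of 1] by linarith
    show ?case
    proof (cases "x \<ge> exp 24")
      case False
      have "ln x \<ge> 1" using Suc.prems x0 by (subst ln_ge_iff) auto
      thus ?thesis using f_mono[of x "exp 24"] False by (simp add: B_def add_increasing)
    next
      case True
      hence lx: "ln x \<ge> 24" using x0 by (subst ln_ge_iff) auto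
      have lns: "ln (sqrt x) = ln x / 2" using x0 by (simp add: ln_sqrt)
      have "exp (24::real) \<ge> exp 12" by simp
      hence "f x \<le> f (sqrt x) + 2" using True by (intro block) linarith
      also have "f (sqrt x) \<le> 3 * ln (ln (sqrt x)) + B"
      proof (rule Suc.IH)
        show "exp 1 \<le> sqrt x" using x0 lns lx by (subst ln_ge_iff [symmetric]) auto
        show "ln (sqrt x) \<le> 2 ^ n" using Suc.prems lns by simp
      qed
      also have "ln (ln (sqrt x)) = ln (ln x) - ln 2" unfolding lns using lx by (simp add: ln_div)
      finally show ?thesis using ln_2_bounds(1) by simp
    qed
  qed
  show ?thesis
  proof (rule that)
    fix x :: real assume "x \<ge> exp 1"
    obtain n :: nat where "ln x < 2 ^ n" using real_arch_pow[of 2 "ln x"] by auto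
    thus "(\<Sum>p | prime p \<and> real p \<le> x. 1 / real p) \<le> 3 * ln (ln x) + B"
      using main[OF \<open>x \<ge> exp 1\<close>, of n] by (simp add: f_def)
  qed
qed

section \<open>Smooth numbers with few large prime factors\<close>

text \<open>
  An explicit exponent for \<open>Psi_divide_powr_le\<close>, characterised by
  \<open>y powr (1 - tilt x y) = (8 * u) powr (4 / 3)\<close>. The primes between \<open>y powr (3 / 4)\<close> and \<open>y\<close> alone then
  make the weighted sum reach \<open>ln x\<close>, whereas those up to \<open>sqrt y\<close> contribute only the proportion
  \<open>O(u powr - (1 / 3))\<close> of that. This contrast is the reason why typical smooth numbers
  have many large prime factors.
\<close>

definition tilt :: "real \<Rightarrow> real \<Rightarrow> real" where
  "tilt x y = 1 - 4 / 3 * ln (8 * u_param x y) / ln y"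

lemma powr_one_minus_tilt:
  assumes "t > 0"
  shows "t powr (1 - tilt x y) = exp (4 / 3 * ln (8 * u_param x y) * (ln t / ln y))"
  using assms by (simp add: tilt_def powr_def)

lemma u_param_mult_ln: "ln y > 0 \<Longrightarrow> u_param x y * ln y = ln x"
  by (simp add: u_param_def)

lemma u_param_le_ln:
  assumes "u_param x y \<ge> 1" "ln y \<ge> 1"
  shows "u_param x y \<le> ln x" "ln y \<le> ln x"
  using mult_left_mono[of 1 "ln y" "u_param x y"] mult_right_mono[of 1 "u_param x y" "ln y"]
    u_param_mult_ln[of y x] assms by auto

lemma tilt_le_1:
  assumes "u_param x y \<ge> 1" "ln y > 0"
  shows "tilt x y \<le> 1"
  using assms by (simp add: tilt_def)

text \<open>
  From \<open>u \<le> ln x \<le> y powr (1 / 6)\<close> one has \<open>4 / 3 * ln (8 * u) \<le> 2 / 9 * ln y + O(1)\<close>. The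
  threshold \<open>72\<close> for \<open>ln y\<close> absorbs the constant.
\<close>

lemma tilt_ge:
  assumes "u_param x y \<ge> 1" "y > 0" "ln y \<ge> 72" "ln x ^ 6 \<le> y"
  shows "tilt x y - 2 / ln y \<ge> 7 / 10"
proof -
  have lx: "ln x > 0"
    using u_param_le_ln[of x y] assms by linarith
  have "u_param x y \<le> ln x" using assms by (intro u_param_le_ln) auto
  hence "ln (8 * u_param x y) \<le> ln (8 * ln x)" using assms by (intro ln_mono) auto
  also have "\<dots> = ln (2 ^ 3) + ln (ln x)" using lx by (simp add: ln_mult)
  also have "ln (2 ^ 3 :: real) = 3 * ln 2" by (subst ln_realpow) simp
  also have "ln (2::real) \<le> 3 / 4" by (rule ln_2_bounds)
  also have "ln (ln x) \<le> ln y / 6"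
  proof -
    have "ln (ln x ^ 6) \<le> ln y" using assms lx by (intro ln_mono) auto
    thus ?thesis by (simp add: ln_realpow)
  qed
  finally have "4 / 3 * ln (8 * u_param x y) + 2 \<le> 3 / 10 * ln y" using assms(3) by simp
  hence "(4 / 3 * ln (8 * u_param x y) + 2) / ln y \<le> 3 / 10"
    using assms(3) by (simp add: pos_divide_le_eq)
  thus ?thesis by (simp add: tilt_def add_divide_distrib)
qed

lemma sum_mangoldt_tilt_ge:
  assumes "u_param x y \<ge> 1" "y > 0" "ln y \<ge> 72"
  shows "(\<Sum>d\<in>{1..nat \<lfloor>y\<rfloor>}. mangoldt d * real d powr - tilt x y) \<ge> ln x"
proof -
  define w where "w = y powr (3 / 4)"
  define u where "u = u_param x y"
  have y1: "y > 1" using assms ln_gt_zero_iff[of y] by linarith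
  have w: "1 \<le> w" "w \<le> y" using y1 by (auto simp: w_def ge_one_powr_ge_zero powr_le_one_le intro: order_trans[OF powr_mono[of "3/4" 1 y]])
  have lnw: "ln w = 3 / 4 * ln y" using y1 by (simp add: w_def ln_powr)
  have "ln x = 8 * u * (ln y / 8)" using y1 u_param_mult_ln[of y x] by (simp add: u_def)
  also have "\<dots> \<le> 8 * u * ((ln y - 2) - (ln w + 4))"
    using assms unfolding lnw by (intro mult_left_mono) (auto simp: u_def)
  also have "\<dots> \<le> 8 * u * (\<Sum>d\<in>{d\<in>{1..nat \<lfloor>y\<rfloor>}. w < real d}. mangoldt d / real d)"
    using sum_mangoldt_split[OF w] mertens_lower[of y] mertens_upper[OF w(1)] y1 assms(1)
    by (intro mult_left_mono) (auto simp: u_def)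
  also have "\<dots> = (\<Sum>d\<in>{d\<in>{1..nat \<lfloor>y\<rfloor>}. w < real d}. mangoldt d * (8 * u / real d))"
    by (simp add: sum_distrib_left mult_ac)
  also have "\<dots> \<le> (\<Sum>d\<in>{d\<in>{1..nat \<lfloor>y\<rfloor>}. w < real d}. mangoldt d * real d powr - tilt x y)"
  proof (intro sum_mono mult_left_mono mangoldt_nonneg)
    fix d assume d: "d \<in> {d\<in>{1..nat \<lfloor>y\<rfloor>}. w < real d}"
    have "ln w \<le> ln (real d)" using d w by (intro ln_mono) auto
    hence "3 / 4 \<le> ln (real d) / ln y" using assms(3) lnw by (simp add: field_simps)
    hence "4 / 3 * ln (8 * u) * (3 / 4) \<le> 4 / 3 * ln (8 * u) * (ln (real d) / ln y)"
      using assms(1) by (intro mult_left_mono) (auto simp: u_def)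
    hence "exp (ln (8 * u)) \<le> real d powr (1 - tilt x y)"
      using d by (subst powr_one_minus_tilt) (auto simp: u_def)
    hence "8 * u \<le> real d powr (1 - tilt x y)" using assms(1) by (simp add: u_def)
    also have "\<dots> = real d * real d powr - tilt x y"
      using d by (simp add: powr_diff powr_minus field_simps)
    finally show "8 * u / real d \<le> real d powr - tilt x y" using d by (simp add: field_simps)
  qed
  also have "\<dots> \<le> (\<Sum>d\<in>{1..nat \<lfloor>y\<rfloor>}. mangoldt d * real d powr - tilt x y)"
    by (intro sum_mono2) (auto simp: mangoldt_nonneg)
  finally show ?thesis .
qed

lemma Psi_divide_tilt_le:
  assumes "u_param x y \<ge> 1" "y > 0" "ln y \<ge> 72" "x > 0" "D \<ge> 1"
  shows "real (Psi (x / D) y) \<le> 6 * ln x * real (Psi x y) * D powr - tilt x y"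
proof -
  have y1: "y > 1" using assms ln_gt_zero_iff[of y] by linarith
  moreover have "ln y \<le> ln x" using assms by (intro u_param_le_ln) auto
  hence "ln x \<ge> 1" using assms(3) by linarith
  ultimately have "D powr tilt x y * real (Psi (x / D) y) \<le> 6 * ln x * real (Psi x y)"
    using assms y1 sum_mangoldt_tilt_ge[OF assms(1-3)] tilt_le_1[OF assms(1)]
    by (intro Psi_divide_powr_le) auto
  thus ?thesis using assms(5) by (simp add: powr_minus field_simps)
qed

lemma Psi_small_argument_le:
  assumes "u_param x y \<ge> 1" "y > 0" "ln y \<ge> 72" "x > 0" "ln x ^ 6 \<le> y"
  shows "real (Psi (x powr (9/10)) y) \<le> 6 * ln x * exp (- u_param x y / 16) * real (Psi x y)"
proof -
  have ly: "ln y \<ge> 1" using assms(3) by linarith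
  note lx = u_param_le_ln(2)[OF assms(1) ly] and u = u_param_le_ln(1)[OF assms(1) ly]
  have x1: "x \<ge> 1" using assms lx ln_ge_zero_iff[of x] by linarith
  have "x powr (9/10) = x / x powr (1/10)"
    using assms(4) powr_diff[of x 1 "1/10"] by simp
  hence "real (Psi (x powr (9/10)) y) \<le> 6 * ln x * real (Psi x y) * (x powr (1/10)) powr - tilt x y"
    using Psi_divide_tilt_le[OF assms(1-4), of "x powr (1/10)"] x1 by (simp add: ge_one_powr_ge_zero)
  also have "\<dots> \<le> 6 * ln x * real (Psi x y) * exp (- u_param x y / 16)"
  proof (intro mult_left_mono)
    have t: "tilt x y \<ge> 7/10"
      using tilt_ge[OF assms(1-3,5)] assms(3) by (smt (verit) divide_nonneg_nonneg)
    have "u_param x y / 16 \<le> ln x * (7/100)" using u assms(1) by linarith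
    also have "\<dots> \<le> ln x * (tilt x y / 10)" using t x1 by (intro mult_left_mono) auto
    finally show "(x powr (1/10)) powr - tilt x y \<le> exp (- u_param x y / 16)"
      unfolding powr_powr using assms(4) by (simp add: powr_def mult_ac)
  qed (use x1 in auto)
  finally show ?thesis by (simp add: mult_ac)
qed

text \<open>
  If the part \<open>m\<close> of \<open>n\<close> composed of primes up to \<open>sqrt y\<close> is large, bound the number of \<open>n\<close> by the sum
  of \<open>Psi (x / m) y\<close>, hence by \<open>6 * ln x * Psi x y\<close> times the sum of \<open>m powr - \<beta>\<close>. By Rankin's trick
  with the exponent \<open>\<tau> = 2 / ln y\<close>, the condition \<open>m \<ge> x powr (65 / 100)\<close> gains \<open>exp (- 13 / 10 * u)\<close>. The
  Euler product of the shifted exponent loses at most \<open>exp (15 / 2 * \<Sigma>)\<close>, where \<open>\<Sigma>\<close> is the sum of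
  \<open>p powr - \<beta>\<close> over \<open>p \<le> sqrt y\<close>, and \<open>\<Sigma> \<le> 3 * ln (ln x) + o(u) \<le> 3 / 32 * u + o(u)\<close>. The balance
  \<open>13 / 10 - 45 / 64 > 1 / 16\<close> is what decides.
\<close>

lemma card_smooth_many_small_primes_le:
  obtains C U where "C > 0"
    "\<And>x y. \<lbrakk>u_param x y \<ge> U; y > 0; ln y \<ge> 72; x > 0; ln x ^ 6 \<le> y; 32 * ln (ln x) \<le> u_param x y\<rbrakk> \<Longrightarrow>
       real (card {n \<in> smooth_upto x y. \<exists>m\<in>smooth_upto x (sqrt y). m dvd n \<and> x powr (65/100) \<le> real m})
         \<le> C * ln x * exp (- u_param x y / 16) * real (Psi x y)"
proof -
  obtain B0 where B0: "\<And>x. x \<ge> exp 1 \<Longrightarrow> (\<Sum>p | prime p \<and> real p \<le> x. 1 / real p) \<le> 3 * ln (ln x) + B0"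
    using sum_inverse_primes_le by metis
  define B where "B = max B0 0"
  have B: "(\<Sum>p | prime p \<and> real p \<le> x. 1 / real p) \<le> 3 * ln (ln x) + B" if "x \<ge> exp 1" for x
    using B0[OF that] by (simp add: B_def)
  define \<xi> where "\<xi> = (\<lambda>u::real. 4 / 3 * ln (8 * u))"
  have "eventually (\<lambda>u. 15 / 2 * (\<xi> u * exp (\<xi> u / 2)) \<le> u / 2) at_top"
    unfolding \<xi>_def by real_asymp
  then obtain U0 where U0: "\<And>u. u \<ge> U0 \<Longrightarrow> 15 / 2 * (\<xi> u * exp (\<xi> u / 2)) \<le> u / 2"
    by (auto simp: eventually_at_top_linorder)
  define U where "U = max U0 1"
  define C where "C = 6 * exp (15 / 2 * B)"
  show ?thesis
  proof (rule that[of C U])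
    show "C > 0" by (simp add: C_def)
    fix x y :: real
    assume asm: "u_param x y \<ge> U" "y > 0" "ln y \<ge> 72" "x > 0" "ln x ^ 6 \<le> y"
      "32 * ln (ln x) \<le> u_param x y"
    define u where "u = u_param x y"
    have u: "u \<ge> U0" "u \<ge> 1" using asm by (auto simp: u_def U_def)
    define \<beta> where "\<beta> = tilt x y"
    define \<tau> where "\<tau> = 2 / ln y"
    define z where "z = sqrt y"
    have \<beta>: "\<beta> - \<tau> \<ge> 7/10" using tilt_ge[of x y] asm u by (simp add: \<beta>_def \<tau>_def u_def)
    have y1: "y \<ge> 1" using asm ln_ge_zero_iff[of y] by linarith
    have y2: "y > 1" using asm ln_gt_zero_iff[of y] by linarith
    have lx: "ln y \<le> ln x" using asm u by (intro u_param_le_ln) (auto simp: u_def)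
    have x1: "x \<ge> 1" using asm lx ln_ge_zero_iff[of x] by linarith
    have lnz: "ln z = ln y / 2" using asm by (simp add: z_def ln_sqrt)
    have z1: "z \<ge> 1" using y1 by (simp add: z_def)
    have ze: "z \<ge> exp 1" using asm z1 lnz by (subst ln_ge_iff [symmetric]) auto
    define M where "M = {m \<in> smooth_upto x z. x powr (65/100) \<le> real m}"
    have finM: "finite M" by (simp add: M_def)
    have M: "m > 0" "real m \<le> x" "x powr (65/100) \<le> real m"
      "prime p \<Longrightarrow> p dvd m \<Longrightarrow> real p \<le> z" if "m \<in> M" for m p
      using that z1 by (auto simp: M_def smooth_upto_iff)
    define P where "P = {p::nat. prime p \<and> real p \<le> z}"
    have finP: "finite P" by (simp add: P_def)
    have zy: "z \<le> y" using y1 mult_left_mono[of 1 y y]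
      by (auto simp: z_def power2_eq_square intro!: real_le_lsqrt)
    \<comment> \<open>The shift by \<open>\<tau>\<close> costs a factor of at most \<open>exp 1\<close> for each prime up to \<open>sqrt y\<close>.\<close>
    have p_tau: "real p powr \<tau> \<le> exp 1" if "p \<in> P" for p
    proof -
      have p0: "p > 0" using that by (auto simp: P_def prime_gt_0_nat)
      hence "ln (real p) \<le> ln y / 2" using that unfolding lnz [symmetric]
        by (intro ln_mono) (auto simp: P_def)
      hence "\<tau> * ln (real p) \<le> 1" using y2 by (simp add: \<tau>_def pos_divide_le_eq)
      thus ?thesis using p0 by (simp add: powr_def)
    qed
    \<comment> \<open>Writing \<open>p powr - \<beta>\<close> as \<open>exp t / p\<close> and using \<open>exp t \<le> 1 + t * exp t\<close> separates the sum of
      \<open>1 / p\<close>, of size \<open>ln (ln x)\<close>, from a sum of \<open>ln p / p\<close>, of size \<open>ln y\<close>.\<close>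
    have sum_beta: "(\<Sum>p\<in>P. real p powr - \<beta>) \<le> 3 * ln (ln x) + B + \<xi> u * exp (\<xi> u / 2)"
    proof -
      have "(\<Sum>p\<in>P. real p powr - \<beta>) \<le>
          (\<Sum>p\<in>P. 1 / real p + \<xi> u / ln y * exp (\<xi> u / 2) * (ln (real p) * (1 / real p)))"
      proof (rule sum_mono)
        fix p assume p: "p \<in> P"
        hence p0: "real p \<ge> 1" using prime_ge_1_nat[of p] by (auto simp: P_def)
        hence lp: "ln (real p) \<le> ln y / 2" using p unfolding lnz [symmetric]
          by (intro ln_mono) (auto simp: P_def)
        define t where "t = \<xi> u * (ln (real p) / ln y)"
        have xi0: "\<xi> u \<ge> 0" using u by (simp add: \<xi>_def)
        have t: "t \<ge> 0" using p0 y2 xi0 by (auto simp: t_def)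
        have "t \<le> \<xi> u * (1 / 2)" unfolding t_def using lp y2 xi0
          by (intro mult_left_mono) (auto simp: pos_divide_le_eq)
        have "real p powr - \<beta> = 1 / real p * real p powr (1 - \<beta>)"
          using p0 by (simp add: powr_diff powr_minus field_simps)
        also have "real p powr (1 - \<beta>) = exp t"
          using p0 by (simp add: \<beta>_def powr_one_minus_tilt t_def \<xi>_def u_def)
        also have "exp t \<le> 1 + t * exp t"
        proof -
          have "exp t * (1 - t) \<le> exp t * exp (- t)"
            using exp_ge_add_one_self[of "- t"] by (intro mult_left_mono) auto
          thus ?thesis by (simp add: exp_minus algebra_simps)
        qed
        also have "t * exp t \<le> t * exp (\<xi> u / 2)"
          using t \<open>t \<le> \<xi> u * (1 / 2)\<close> by (intro mult_left_mono) auto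
        finally show "real p powr - \<beta> \<le>
            1 / real p + \<xi> u / ln y * exp (\<xi> u / 2) * (ln (real p) * (1 / real p))"
          using p0 by (simp add: t_def field_simps)
      qed
      also have "\<dots> = (\<Sum>p\<in>P. 1 / real p) +
          \<xi> u / ln y * exp (\<xi> u / 2) * (\<Sum>p\<in>P. ln (real p) * (1 / real p))"
        by (simp add: sum.distrib sum_distrib_left)
      also have "(\<Sum>p\<in>P. 1 / real p) \<le> 3 * ln (ln x) + B"
      proof -
        have "(\<Sum>p\<in>P. 1 / real p) \<le> 3 * ln (ln z) + B" unfolding P_def by (rule B[OF ze])
        moreover have "ln (ln z) \<le> ln (ln x)" using y2 lx lnz asm(3) by (subst ln_le_cancel_iff) linarith+
        ultimately show ?thesis by simp
      qed
      also have "\<xi> u / ln y * exp (\<xi> u / 2) * (\<Sum>p\<in>P. ln (real p) * (1 / real p)) \<le>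
          \<xi> u / ln y * exp (\<xi> u / 2) * ln y"
      proof (intro mult_left_mono)
        have "(\<Sum>p\<in>P. ln (real p) * (1 / real p)) \<le> ln z + 4"
          unfolding P_def by (rule sum_ln_primes_divide_le[OF z1])
        also have "\<dots> \<le> ln y" using lnz asm by simp
        finally show "(\<Sum>p\<in>P. ln (real p) * (1 / real p)) \<le> ln y" .
      qed (use u y2 in \<open>auto simp: \<xi>_def intro!: mult_nonneg_nonneg divide_nonneg_nonneg\<close>)
      also have "\<xi> u / ln y * exp (\<xi> u / 2) * ln y = \<xi> u * exp (\<xi> u / 2)" using y2 by simp
      finally show ?thesis by simp
    qed
    \<comment> \<open>The factor at \<open>2\<close> is the worst one in the Euler product. The constant \<open>15 / 2\<close> below bounds
      \<open>exp 1 / (1 - 5 / 8)\<close>.\<close>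
    have two: "(2::real) powr - (7/10) \<le> 5/8"
    proof -
      have "(8/5::real) ^ 10 \<le> 2 ^ 7" by (simp add: power_divide)
      hence "ln ((8/5::real) ^ 10) \<le> ln (2 ^ 7)" by (subst ln_le_cancel_iff) auto
      hence "ln (8/5::real) \<le> 7/10 * ln 2" by (simp only: ln_realpow)
      hence "exp (ln (8/5::real)) \<le> exp (7/10 * ln 2)" by (subst exp_le_cancel_iff)
      hence "8/5 \<le> (2::real) powr (7/10)" by (simp add: powr_def)
      thus ?thesis by (simp add: powr_minus field_simps)
    qed
    have prod_le: "(\<Prod>p\<in>P. 1 / (1 - real p powr - (\<beta> - \<tau>))) \<le> exp (15/2 * (\<Sum>p\<in>P. real p powr - \<beta>))"
    proof -
      have "(\<Prod>p\<in>P. 1 / (1 - real p powr - (\<beta> - \<tau>))) \<le> (\<Prod>p\<in>P. exp (15/2 * real p powr - \<beta>))"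
      proof (intro prod_mono conjI)
        fix p assume p: "p \<in> P"
        hence p2: "real p \<ge> 2" using prime_ge_2_nat[of p] by (auto simp: P_def)
        define v where "v = real p powr - (\<beta> - \<tau>)"
        have "v \<le> real p powr - (7/10)" using p2 \<beta> by (auto simp: v_def intro!: powr_mono)
        also have "\<dots> \<le> 2 powr - (7/10)" using p2 by (intro powr_mono2') auto
        also note two
        finally have v: "v \<le> 5/8" .
        have v0: "v \<ge> 0" by (simp add: v_def)
        show "0 \<le> 1 / (1 - real p powr - (\<beta> - \<tau>))" using v by (simp add: v_def)
        have "1 / (1 - v) \<le> exp (v / (1 - 5/8))"
          using v v0 by (intro inverse_one_minus_le_exp) auto
        also have "v / (1 - 5/8) \<le> 15/2 * real p powr - \<beta>"
        proof -
          have "v = real p powr - \<beta> * real p powr \<tau>"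
            using p2 by (simp add: v_def powr_add [symmetric])
          also have "\<dots> \<le> real p powr - \<beta> * (14 / 5)"
            using p_tau[OF p] exp_1_le by (intro mult_left_mono) auto
          finally have "v * (8/3) \<le> real p powr - \<beta> * (14 / 5) * (8/3)" by simp
          also have "\<dots> \<le> 15/2 * real p powr - \<beta>" by simp
          finally show ?thesis by simp
        qed
        finally show "1 / (1 - real p powr - (\<beta> - \<tau>)) \<le> exp (15/2 * real p powr - \<beta>)"
          by (simp add: v_def)
      qed
      also have "\<dots> = exp (15/2 * (\<Sum>p\<in>P. real p powr - \<beta>))"
        using finP by (simp add: exp_sum sum_distrib_left)
      finally show ?thesis .
    qed
    have sumM: "(\<Sum>m\<in>M. real m powr - \<beta>) \<le> exp (15 / 2 * B) * exp (- u / 16)"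
    proof -
      have "(\<Sum>m\<in>M. real m powr - \<beta>) \<le> (\<Sum>m\<in>M. exp (- (13/10) * u) * real m powr - (\<beta> - \<tau>))"
      proof (rule sum_mono)
        fix m assume m: "m \<in> M"
        have "ln (x powr (65/100)) \<le> ln (real m)" using M[OF m] asm by (intro ln_mono) auto
        hence "65/100 * ln x \<le> ln (real m)" using asm by (simp add: ln_powr)
        hence "\<tau> * (65/100 * ln x) \<le> \<tau> * ln (real m)"
          using y2 by (intro mult_left_mono) (auto simp: \<tau>_def)
        hence "13/10 * u \<le> \<tau> * ln (real m)" by (simp add: \<tau>_def u_def u_param_def)
        hence "real m powr - \<tau> \<le> exp (- (13/10) * u)" using M[OF m] by (simp add: powr_def)
        hence "real m powr - \<tau> * real m powr - (\<beta> - \<tau>) \<le> exp (- (13/10) * u) * real m powr - (\<beta> - \<tau>)"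
          by (intro mult_right_mono) auto
        thus "real m powr - \<beta> \<le> exp (- (13/10) * u) * real m powr - (\<beta> - \<tau>)"
          using M[OF m] by (simp add: powr_add [symmetric])
      qed
      also have "\<dots> = exp (- (13/10) * u) * (\<Sum>m\<in>M. real m powr - (\<beta> - \<tau>))"
        by (simp add: sum_distrib_left)
      also have "(\<Sum>m\<in>M. real m powr - (\<beta> - \<tau>)) \<le> (\<Prod>p\<in>P. 1 / (1 - real p powr - (\<beta> - \<tau>)))"
        using finP finM \<beta> M
        by (intro sum_powr_le_euler_product) (auto simp: P_def in_prime_factors_iff)
      also note prod_le
      also have "exp (15/2 * (\<Sum>p\<in>P. real p powr - \<beta>)) \<le>
          exp (15/2 * (3 * ln (ln x) + B + \<xi> u * exp (\<xi> u / 2)))"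
        using sum_beta by simp
      also have "exp (- (13/10) * u) * \<dots> =
          exp (- (13/10) * u + 15/2 * (3 * ln (ln x) + B + \<xi> u * exp (\<xi> u / 2)))"
        by (rule exp_add [symmetric])
      also have "\<dots> \<le> exp (15/2 * B + - u / 16)"
      proof -
        define e where "e = \<xi> u * exp (\<xi> u / 2)"
        have e: "15 / 2 * e \<le> u / 2" using U0[OF u(1)] by (simp only: e_def)
        have "32 * ln (ln x) \<le> u" using asm(6) by (simp only: u_def)
        hence "- (13/10) * u + 15/2 * (3 * ln (ln x) + B + e) \<le> 15/2 * B + - u / 16"
          using e u(2) by (simp add: field_simps)
        hence "- (13/10) * u + 15/2 * (3 * ln (ln x) + B + \<xi> u * exp (\<xi> u / 2)) \<le> 15/2 * B + - u / 16"
          by (simp only: e_def)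
        thus ?thesis by (subst exp_le_cancel_iff)
      qed
      also have "\<dots> = exp (15/2 * B) * exp (- u / 16)" by (rule exp_add)
      finally show ?thesis by simp
    qed
    let ?D = "\<lambda>m. {n \<in> smooth_upto x y. m dvd n}"
    have "{n \<in> smooth_upto x y. \<exists>m\<in>smooth_upto x (sqrt y). m dvd n \<and> x powr (65/100) \<le> real m} \<subseteq>
        (\<Union>m\<in>M. ?D m)" (is "?E \<subseteq> _") by (auto simp: M_def z_def)
    hence "card ?E \<le> card (\<Union>m\<in>M. ?D m)"
      using finM by (intro card_mono) auto
    also have "\<dots> \<le> (\<Sum>m\<in>M. card (?D m))"
      using finM by (rule card_UN_le)
    also have "\<dots> = (\<Sum>m\<in>M. Psi (x / real m) y)"
    proof (rule sum.cong[OF refl])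
      fix m assume m: "m \<in> M"
      show "card (?D m) = Psi (x / real m) y"
      proof (rule card_smooth_upto_multiples[OF y1 M(1)[OF m]], intro allI impI)
        fix p :: nat assume "prime p" "p dvd m"
        from M(4)[OF m this] show "real p \<le> y" using zy by linarith
      qed
    qed
    finally have "real (card ?E) \<le> (\<Sum>m\<in>M. real (Psi (x / real m) y))"
      unfolding of_nat_sum [symmetric] by (rule of_nat_mono)
    also have "\<dots> \<le> (\<Sum>m\<in>M. 6 * ln x * real (Psi x y) * real m powr - \<beta>)"
    proof (rule sum_mono)
      fix m assume "m \<in> M"
      thus "real (Psi (x / real m) y) \<le> 6 * ln x * real (Psi x y) * real m powr - \<beta>"
        unfolding \<beta>_def using M[of m] asm u by (intro Psi_divide_tilt_le) (auto simp: u_def)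
    qed
    also have "\<dots> = 6 * ln x * real (Psi x y) * (\<Sum>m\<in>M. real m powr - \<beta>)"
      by (simp add: sum_distrib_left)
    also have "\<dots> \<le> 6 * ln x * real (Psi x y) * (exp (15 / 2 * B) * exp (- u / 16))"
      using sumM x1 by (intro mult_left_mono) auto
    finally show "real (card ?E) \<le> C * ln x * exp (- u_param x y / 16) * real (Psi x y)"
      by (simp add: C_def u_def mult_ac)
  qed
qed

section \<open>Splitting smooth numbers into two factors\<close>

definition large_primes :: "real \<Rightarrow> nat \<Rightarrow> nat set" where
  "large_primes z n = {p \<in> prime_factors n. z < real p}"

definition large_Omega :: "real \<Rightarrow> nat \<Rightarrow> nat" where
  "large_Omega z n = (\<Sum>p\<in>large_primes z n. multiplicity p n)"

lemma finite_large_primes [simp]: "finite (large_primes z n)"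
  by (simp add: large_primes_def)

lemma large_Omega_mult:
  assumes "m > 0" "n > 0"
  shows "large_Omega z (m * n) = large_Omega z m + large_Omega z n"
proof -
  let ?P = "large_primes z (m * n)"
  have P: "?P = large_primes z m \<union> large_primes z n"
    using assms by (auto simp: large_primes_def prime_factors_product)
  have restrict: "large_Omega z k = (\<Sum>p\<in>?P. multiplicity p k)" if "k \<in> {m, n}" for k
    unfolding large_Omega_def
  proof (rule sum.mono_neutral_left)
    show "large_primes z k \<subseteq> ?P" using that P by auto
    show "\<forall>p\<in>?P - large_primes z k. multiplicity p k = 0"
      using that assms
      by (auto simp: large_primes_def in_prime_factors_iff intro!: not_dvd_imp_multiplicity_0)
  qed simp
  have "large_Omega z (m * n) = (\<Sum>p\<in>?P. multiplicity p m + multiplicity p n)"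
    unfolding large_Omega_def using assms
    by (intro sum.cong refl prime_elem_multiplicity_mult_distrib)
       (auto simp: large_primes_def in_prime_factors_iff)
  thus ?thesis using restrict[of m] restrict[of n] by (simp add: sum.distrib)
qed

lemma card_large_primes_le: "card (large_primes z n) \<le> large_Omega z n"
proof -
  have "card (large_primes z n) = (\<Sum>p\<in>large_primes z n. 1)" by simp
  also have "\<dots> \<le> large_Omega z n"
    unfolding large_Omega_def
    by (intro sum_mono) (auto simp: large_primes_def prime_factors_multiplicity Suc_le_eq)
  finally show ?thesis .
qed

lemma prime_factors_prod_primes:
  assumes "finite A" "\<And>p. p \<in> A \<Longrightarrow> prime (p::nat)"
  shows "prime_factors (\<Prod>A) = A"
proof -
  have "prime_factors (\<Prod>A) = \<Union> (prime_factors ` A)"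
    using assms by (subst prime_factors_prod) (auto simp: image_iff dest: assms(2))
  thus ?thesis using assms by (auto simp: prime_prime_factors)
qed

lemma multiplicity_prod_primes:
  assumes "finite A" "\<And>p. p \<in> A \<Longrightarrow> prime (p::nat)" "q \<in> A"
  shows "multiplicity q (\<Prod>A) = 1"
proof -
  have "multiplicity q (\<Prod>A) = (\<Sum>p\<in>A. multiplicity q p)"
    using assms by (subst prime_elem_multiplicity_prod_distrib) (auto dest: assms(2))
  also have "\<dots> = (\<Sum>p\<in>A. if p = q then 1 else 0)"
    using assms by (intro sum.cong refl) (auto simp: prime_multiplicity_other)
  finally show ?thesis using assms by simp
qed

definition large_products :: "real \<Rightarrow> real \<Rightarrow> nat \<Rightarrow> nat set" where
  "large_products z y j =
     (\<lambda>A. \<Prod>A) ` {A. finite A \<and> card A = j \<and> (\<forall>p\<in>A. prime p \<and> z < real p \<and> real p \<le> y)}"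

lemma large_productsE:
  assumes "a \<in> large_products z y j"
  obtains "a > 0" "card (large_primes z a) = j" "large_Omega z a = j"
    "\<Prod>(large_primes z a) = a" "\<forall>p. prime p \<longrightarrow> p dvd a \<longrightarrow> real p \<le> y"
proof -
  from assms obtain A where A: "finite A" "card A = j" "a = \<Prod>A"
    "\<And>p. p \<in> A \<Longrightarrow> prime p" "\<And>p. p \<in> A \<Longrightarrow> z < real p \<and> real p \<le> y"
    by (auto simp: large_products_def)
  have pf: "prime_factors a = A" using A by (simp add: prime_factors_prod_primes)
  have "a > 0" using A by (auto intro!: prod_pos dest: prime_gt_0_nat)
  have lp: "large_primes z a = A" using pf A by (auto simp: large_primes_def)
  have "large_Omega z a = (\<Sum>p\<in>A. 1)"
    unfolding large_Omega_def lp using A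
    by (intro sum.cong refl) (simp add: multiplicity_prod_primes)
  hence "large_Omega z a = j" using A by simp
  moreover have "\<forall>p. prime p \<longrightarrow> p dvd a \<longrightarrow> real p \<le> y"
    using pf A \<open>a > 0\<close> by (auto simp: set_eq_iff in_prime_factors_iff)
  ultimately show ?thesis using that \<open>a > 0\<close> lp A by simp
qed

text \<open>
  The factor \<open>a\<close> lies in the bin \<open>i = nat \<lfloor>ln a / h\<rfloor>\<close>, that is \<open>exp (i * h) \<le> a < exp ((i + 1) * h)\<close>, and the
  bound on \<open>b\<close> depends on \<open>a\<close> through \<open>i\<close> only. It guarantees \<open>a * b \<le> x\<close> and is implied by
  \<open>a * b \<le> x * exp (- h)\<close>.
\<close>

definition split_pairs :: "real \<Rightarrow> real \<Rightarrow> real \<Rightarrow> nat \<Rightarrow> (nat \<times> nat) set" where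
  "split_pairs x y h k = {(a, b).
     a \<in> large_products (sqrt y) y (k div 2) \<and> real a \<le> x \<and>
     b \<in> smooth_upto (x * exp (- ((real (nat \<lfloor>ln (real a) / h\<rfloor>) + 1) * h))) y \<and>
     large_Omega (sqrt y) b = k - k div 2}"

definition split_count :: "real \<Rightarrow> real \<Rightarrow> real \<Rightarrow> nat \<Rightarrow> nat \<Rightarrow> nat" where
  "split_count x y h k n = card {ab \<in> split_pairs x y h k. fst ab * snd ab = n}"

lemma bin_bounds:
  assumes "h > 0" "a > (0::nat)"
  defines "i \<equiv> nat \<lfloor>ln (real a) / h\<rfloor>"
  shows "exp (real i * h) \<le> real a" "real a < exp ((real i + 1) * h)"
proof -
  have ge0: "ln (real a) / h \<ge> 0" using assms by simp
  hence "real i \<le> ln (real a) / h" "ln (real a) / h < real i + 1"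
    unfolding i_def by linarith+
  hence *: "real i * h \<le> ln (real a)" "ln (real a) < (real i + 1) * h"
    using assms(1) by (auto simp: field_simps)
  have a: "real a = exp (ln (real a))" using assms by simp
  show "exp (real i * h) \<le> real a" using *(1) by (subst a) (simp only: exp_le_cancel_iff)
  show "real a < exp ((real i + 1) * h)" using *(2) by (subst a) (simp only: exp_less_cancel_iff)
qed

lemma split_pairs_product:
  assumes "y \<ge> 1" "h > 0" "(a, b) \<in> split_pairs x y h k"
  shows "a * b \<in> smooth_upto x y" "large_Omega (sqrt y) (a * b) = k"
proof -
  let ?i = "nat \<lfloor>ln (real a) / h\<rfloor>"
  have a: "a \<in> large_products (sqrt y) y (k div 2)"
    and b: "b \<in> smooth_upto (x * exp (- ((real ?i + 1) * h))) y" "large_Omega (sqrt y) b = k - k div 2"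
    using assms(3) by (auto simp: split_pairs_def)
  from a obtain a': "a > 0" "large_Omega (sqrt y) a = k div 2" "\<forall>p. prime p \<longrightarrow> p dvd a \<longrightarrow> real p \<le> y"
    by (rule large_productsE)
  have b0: "b > 0" "real b \<le> x * exp (- ((real ?i + 1) * h))" "\<forall>p. prime p \<longrightarrow> p dvd b \<longrightarrow> real p \<le> y"
    using b(1) assms(1) by (auto simp: smooth_upto_iff)
  have "real a * real b \<le> exp ((real ?i + 1) * h) * (x * exp (- ((real ?i + 1) * h)))"
    using bin_bounds[OF assms(2) a'(1)] b0 by (intro mult_mono) auto
  also have "\<dots> = x" by (simp add: exp_minus)
  finally show "a * b \<in> smooth_upto x y"
    using a' b0 assms(1) by (auto simp: smooth_upto_iff prime_dvd_mult_iff)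
  show "large_Omega (sqrt y) (a * b) = k"
    using a' b0 b(2) by (simp add: large_Omega_mult)
qed

lemma finite_split_pairs [simp]:
  assumes "y \<ge> 1" "h > 0"
  shows "finite (split_pairs x y h k)"
proof (rule finite_subset)
  show "split_pairs x y h k \<subseteq> {..nat \<lfloor>x\<rfloor>} \<times> {..nat \<lfloor>x\<rfloor>}"
  proof
    fix ab assume "ab \<in> split_pairs x y h k"
    moreover obtain a b where [simp]: "ab = (a, b)" by force
    ultimately have ab: "(a, b) \<in> split_pairs x y h k" by simp
    hence "a * b \<in> smooth_upto x y" by (rule split_pairs_product(1)[OF assms])
    hence "a * b \<le> nat \<lfloor>x\<rfloor>" "0 < a * b" by (auto simp: smooth_upto_def le_nat_floor)
    moreover from this have "a \<le> a * b" "b \<le> a * b" by auto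
    ultimately have "a \<le> nat \<lfloor>x\<rfloor> \<and> b \<le> nat \<lfloor>x\<rfloor>" by linarith
    thus "ab \<in> {..nat \<lfloor>x\<rfloor>} \<times> {..nat \<lfloor>x\<rfloor>}" by simp
  qed
qed simp

text \<open>
  A splitting of \<open>n\<close> is determined by the set of primes of \<open>a\<close>, which is a subset of size \<open>k div 2\<close> of the
  at most \<open>k\<close> large primes of \<open>n\<close>.
\<close>

lemma split_count_le:
  assumes "y \<ge> 1" "h > 0"
  shows "split_count x y h k n \<le> k choose (k div 2)"
proof (cases "split_count x y h k n = 0")
  case False
  let ?S = "{ab \<in> split_pairs x y h k. fst ab * snd ab = n}"
  let ?L = "large_primes (sqrt y)"
  obtain ab where ab: "ab \<in> ?S" using False by (auto simp: split_count_def card_eq_0_iff)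
  have n: "n > 0" "large_Omega (sqrt y) n = k"
    using ab split_pairs_product[OF assms, of "fst ab" "snd ab" x k] by (auto simp: smooth_upto_def)
  have "card ?S \<le> card {A. A \<subseteq> ?L n \<and> card A = k div 2}"
  proof (rule card_inj_on_le)
    show "inj_on (\<lambda>ab. ?L (fst ab)) ?S"
    proof (rule inj_onI, clarify)
      fix a b a' b'
      assume *: "(a, b) \<in> split_pairs x y h k" "(a', b') \<in> split_pairs x y h k"
        "fst (a', b') * snd (a', b') = fst (a, b) * snd (a, b)"
        "?L (fst (a, b)) = ?L (fst (a', b'))"
      have "a \<in> large_products (sqrt y) y (k div 2)" "a' \<in> large_products (sqrt y) y (k div 2)"
        using * by (auto simp: split_pairs_def)
      hence "a = \<Prod>(?L a)" "a' = \<Prod>(?L a')" "a > 0"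
        by (auto elim!: large_productsE)
      thus "a = a' \<and> b = b'" using * by simp
    qed
    show "(\<lambda>ab. ?L (fst ab)) ` ?S \<subseteq> {A. A \<subseteq> ?L n \<and> card A = k div 2}"
    proof clarify
      fix a b assume *: "(a, b) \<in> split_pairs x y h k" "n = fst (a, b) * snd (a, b)"
      have "a \<in> large_products (sqrt y) y (k div 2)" using * by (auto simp: split_pairs_def)
      hence "card (?L a) = k div 2" by (rule large_productsE)
      moreover have "?L a \<subseteq> ?L n"
        using * n by (auto simp: large_primes_def in_prime_factors_iff)
      ultimately show "?L (fst (a, b)) \<subseteq> ?L (fst (a, b) * snd (a, b)) \<and> card (?L (fst (a, b))) = k div 2"
        using * by simp
    qed
  qed simp
  also have "\<dots> = card (?L n) choose (k div 2)" by (rule n_subsets) simp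
  also have "\<dots> \<le> k choose (k div 2)"
    using card_large_primes_le[of "sqrt y" n] n by (intro binomial_right_mono) simp
  finally show ?thesis by (simp add: split_count_def)
qed simp

text \<open>
  If no large prime divides \<open>n\<close> twice, then \<open>n\<close> has \<open>k\<close> distinct large primes, and every subset of size
  \<open>k div 2\<close> provides a splitting. The bound \<open>x * exp (- h)\<close> leaves room for the rounding to bins.
\<close>

lemma split_count_ge:
  assumes y: "y \<ge> 1" and h: "h > 0"
    and n: "n \<in> smooth_upto x y" "real n \<le> x * exp (- h)"
    and sqfree: "\<And>p. prime p \<Longrightarrow> sqrt y < real p \<Longrightarrow> \<not> p\<^sup>2 dvd n"
    and k: "k = large_Omega (sqrt y) n"
  shows "split_count x y h k n \<ge> k choose (k div 2)"
proof -
  let ?S = "{ab \<in> split_pairs x y h k. fst ab * snd ab = n}"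
  let ?L = "large_primes (sqrt y) n"
  have n0: "n > 0" "real n \<le> x" "\<And>p. prime p \<Longrightarrow> p dvd n \<Longrightarrow> real p \<le> y"
    using n y by (auto simp: smooth_upto_iff)
  have "multiplicity p n = 1" if p: "p \<in> ?L" for p
  proof -
    have "multiplicity p n < 2"
      using sqfree[of p] p n0 prime_gt_1_nat[of p]
      by (intro multiplicity_lessI) (auto simp: large_primes_def in_prime_factors_iff)
    moreover have "multiplicity p n > 0" using p by (auto simp: large_primes_def prime_factors_multiplicity)
    ultimately show ?thesis by simp
  qed
  hence "k = card ?L" by (simp add: k large_Omega_def)
  hence "k choose (k div 2) = card {A. A \<subseteq> ?L \<and> card A = k div 2}" by (simp add: n_subsets)
  also have "\<dots> \<le> card ?S"
  proof (rule card_inj_on_le)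
    show "finite ?S" using y h by simp
    have prime: "prime p" "sqrt y < real p" "p dvd n" if "A \<subseteq> ?L" "p \<in> A" for A p
      using that by (auto simp: large_primes_def)
    have fin: "finite A" if "A \<subseteq> ?L" for A by (rule finite_subset[OF that finite_large_primes])
    show "inj_on (\<lambda>A. (\<Prod>A, n div \<Prod>A)) {A. A \<subseteq> ?L \<and> card A = k div 2}"
    proof (rule inj_onI)
      fix A B assume "A \<in> {A. A \<subseteq> ?L \<and> card A = k div 2}" "B \<in> {A. A \<subseteq> ?L \<and> card A = k div 2}"
        "(\<Prod>A, n div \<Prod>A) = (\<Prod>B, n div \<Prod>B)"
      hence *: "A \<subseteq> ?L" "B \<subseteq> ?L" "\<Prod>A = \<Prod>B" by auto
      have "A = prime_factors (\<Prod>A)" using prime * fin by (intro prime_factors_prod_primes [symmetric]) auto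
      also have "\<dots> = B" unfolding *(3) using prime * fin by (intro prime_factors_prod_primes) auto
      finally show "A = B" .
    qed
    show "(\<lambda>A. (\<Prod>A, n div \<Prod>A)) ` {A. A \<subseteq> ?L \<and> card A = k div 2} \<subseteq> ?S"
    proof (rule image_subsetI)
      fix A assume "A \<in> {A. A \<subseteq> ?L \<and> card A = k div 2}"
      hence A: "A \<subseteq> ?L" "card A = k div 2" by auto
      define a where "a = \<Prod>A"
      define i where "i = nat \<lfloor>ln (real a) / h\<rfloor>"
      have aP: "a \<in> large_products (sqrt y) y (k div 2)"
      proof -
        have "\<forall>p\<in>A. prime p \<and> sqrt y < real p \<and> real p \<le> y"
        proof
          fix p assume "p \<in> A"
          note prime[OF A(1) this]
          thus "prime p \<and> sqrt y < real p \<and> real p \<le> y" using n0(3)[of p] by simp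
        qed
        thus ?thesis using fin[OF A(1)] A(2) unfolding large_products_def a_def by auto
      qed
      from aP obtain a': "a > 0" "large_Omega (sqrt y) a = k div 2" by (rule large_productsE)
      have "a dvd n"
        unfolding a_def
      proof (rule multiplicity_le_imp_dvd)
        show "\<Prod>A \<noteq> 0" using a'(1) by (simp add: a_def)
        fix p :: nat assume p: "prime p"
        show "multiplicity p (\<Prod>A) \<le> multiplicity p n"
        proof (cases "p \<in> A")
          case True
          hence "multiplicity p (\<Prod>A) = 1" using A fin prime by (intro multiplicity_prod_primes) auto
          moreover have "multiplicity p n > 0"
            using True A by (auto simp: large_primes_def prime_factors_multiplicity)
          ultimately show ?thesis by simp
        next
          case False
          hence "\<not> p dvd \<Prod>A"
            using A fin prime p a'(1) prime_factors_prod_primes[of A]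
            by (auto simp: a_def in_prime_factors_iff set_eq_iff)
          thus ?thesis by (simp add: not_dvd_imp_multiplicity_0)
        qed
      qed
      then obtain b where b: "n = a * b" by blast
      have b0: "b > 0" using n0 b by (auto intro: Nat.gr0I)
      have "real a * 1 \<le> real a * real b" using b0 by (intro mult_left_mono) auto
      hence "real a \<le> real n" using b by simp
      hence ax: "real a \<le> x" using n0(2) by linarith
      have "real b \<le> x * exp (- ((real i + 1) * h))"
      proof -
        have "real b * exp (real i * h) \<le> real b * real a"
          using bin_bounds(1)[OF h a'(1)] by (intro mult_left_mono) (auto simp: i_def)
        also have "\<dots> \<le> x * exp (- h)" using n(2) b by (simp add: mult.commute)
        finally have "real b \<le> x * exp (- h) / exp (real i * h)" by (simp add: field_simps)
        also have "\<dots> = x * exp (- ((real i + 1) * h))"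
        proof -
          have "exp (- ((real i + 1) * h)) = exp (- h) / exp (real i * h)"
            by (simp add: exp_diff [symmetric] algebra_simps)
          thus ?thesis by simp
        qed
        finally show ?thesis .
      qed
      hence "b \<in> smooth_upto (x * exp (- ((real i + 1) * h))) y"
        using b b0 n0(3) y by (auto simp: smooth_upto_iff)
      moreover have "large_Omega (sqrt y) b = k - k div 2"
        using k b a' b0 by (simp add: large_Omega_mult)
      ultimately have "(a, b) \<in> split_pairs x y h k"
        using aP ax by (auto simp: split_pairs_def i_def)
      thus "(\<Prod>A, n div \<Prod>A) \<in> ?S"
        using b a' unfolding a_def [symmetric] by simp
    qed
  qed
  finally show ?thesis by (simp add: split_count_def)
qed

lemma sum_split_pairs:
  fixes f :: "nat \<Rightarrow> 'a :: comm_ring_1"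
  assumes "y \<ge> 1" "h > 0"
  shows "(\<Sum>ab\<in>split_pairs x y h k. f (fst ab * snd ab)) =
           (\<Sum>n\<in>{n \<in> smooth_upto x y. large_Omega (sqrt y) n = k}. of_nat (split_count x y h k n) * f n)"
proof -
  let ?N = "{n \<in> smooth_upto x y. large_Omega (sqrt y) n = k}"
  have "(\<Sum>ab\<in>split_pairs x y h k. f (fst ab * snd ab)) =
      (\<Sum>n\<in>?N. \<Sum>ab\<in>{ab \<in> split_pairs x y h k. fst ab * snd ab = n}. f (fst ab * snd ab))"
    using assms split_pairs_product[OF assms]
    by (intro sum.group [symmetric]) auto
  also have "\<dots> = (\<Sum>n\<in>?N. of_nat (split_count x y h k n) * f n)"
    by (intro sum.cong refl) (simp add: split_count_def)
  finally show ?thesis .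
qed

lemma card_split_pairs_le:
  assumes "y \<ge> 1" "h > 0"
  shows "real (card (split_pairs x y h k)) \<le> real (k choose (k div 2)) * real (Psi x y)"
proof -
  let ?N = "{n \<in> smooth_upto x y. large_Omega (sqrt y) n = k}"
  have "real (card (split_pairs x y h k)) = (\<Sum>ab\<in>split_pairs x y h k. (\<lambda>_. 1) (fst ab * snd ab))" by simp
  also have "\<dots> = (\<Sum>n\<in>?N. real (split_count x y h k n))"
    by (subst sum_split_pairs[OF assms]) simp
  also have "\<dots> \<le> (\<Sum>n\<in>?N. real (k choose (k div 2)))"
    by (intro sum_mono of_nat_mono split_count_le assms)
  also have "\<dots> \<le> (\<Sum>n\<in>smooth_upto x y. real (k choose (k div 2)))"
    by (intro sum_mono2) auto
  finally show ?thesis by (simp add: Psi_def mult.commute)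
qed

text \<open>
  For each bin the double sum factors, so that its mean is at most the square root of the number of
  pairs in the bin. Summing over the at most \<open>ln x / h + 1\<close> bins by the Cauchy-Schwarz inequality leaves
  the total number of pairs, which is at most \<open>k choose (k div 2)\<close> times \<open>Psi x y\<close>.
\<close>

lemma character_mean_split_pairs_le:
  assumes q: "q > 0" "1 \<le> x" "x \<le> real q" and y: "y \<ge> 1" and h: "h > 0"
  shows "character_mean q (\<lambda>\<chi>. cmod (\<Sum>ab\<in>split_pairs x y h k. \<chi> (fst ab * snd ab)))
           \<le> sqrt ((ln x / h + 1) * (real (k choose (k div 2)) * real (Psi x y)))"
proof -
  let ?T = "\<lambda>\<chi>. \<Sum>ab\<in>split_pairs x y h k. \<chi> (fst ab * snd ab) :: complex"
  define R where "R = nat \<lfloor>ln x / h\<rfloor>"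
  define A where "A = (\<lambda>i. {a \<in> large_products (sqrt y) y (k div 2). real a \<le> x \<and> nat \<lfloor>ln (real a) / h\<rfloor> = i})"
  define B where "B = (\<lambda>i::nat. {b \<in> smooth_upto (x * exp (- ((real i + 1) * h))) y. large_Omega (sqrt y) b = k - k div 2})"
  have apos: "a > 0" if "a \<in> A i" for a i using that by (auto simp: A_def elim: large_productsE)
  have floor_q: "real n \<le> x \<Longrightarrow> n \<le> q" for n using q by linarith
  have A_sub: "A i \<subseteq> {0<..q}" for i using apos floor_q by (fastforce simp: A_def)
  have B_sub: "B i \<subseteq> {0<..q}" for i
  proof
    fix b assume "b \<in> B i"
    hence b: "b > 0" "real b \<le> x * exp (- ((real i + 1) * h))" by (auto simp: B_def smooth_upto_def)
    have "x * exp (- ((real i + 1) * h)) \<le> x * 1" using q h by (intro mult_left_mono) auto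
    thus "b \<in> {0<..q}" using b floor_q[of b] by simp
  qed
  have fin: "finite (A i)" "finite (B i)" for i
    using finite_subset[OF A_sub] finite_subset[OF B_sub] by auto
  have S: "split_pairs x y h k = (\<Union>i\<in>{..R}. A i \<times> B i)"
  proof (intro equalityI subsetI)
    fix ab assume ab: "ab \<in> split_pairs x y h k"
    obtain a b where [simp]: "ab = (a, b)" by force
    have a: "a \<in> large_products (sqrt y) y (k div 2)" "real a \<le> x" using ab by (auto simp: split_pairs_def)
    from a(1) have "a > 0" by (rule large_productsE)
    hence "ln (real a) / h \<le> ln x / h" using a h by (intro divide_right_mono ln_mono) auto
    hence "nat \<lfloor>ln (real a) / h\<rfloor> \<le> R" unfolding R_def by (intro nat_mono floor_mono)
    thus "ab \<in> (\<Union>i\<in>{..R}. A i \<times> B i)" using ab by (auto simp: A_def B_def split_pairs_def)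
  next
    fix ab assume "ab \<in> (\<Union>i\<in>{..R}. A i \<times> B i)"
    thus "ab \<in> split_pairs x y h k" by (auto simp: A_def B_def split_pairs_def)
  qed
  have disj: "(A i \<times> B i) \<inter> (A j \<times> B j) = {}" if "i \<noteq> j" for i j
    using that by (auto simp: A_def)
  have cards: "(\<Sum>i\<le>R. real (card (A i) * card (B i))) = real (card (split_pairs x y h k))"
    unfolding S using fin disj
    by (subst card_UN_disjoint) (auto simp: card_cartesian_product)
  have "character_mean q (\<lambda>\<chi>. cmod (?T \<chi>)) \<le>
      character_mean q (\<lambda>\<chi>. \<Sum>i\<le>R. cmod (\<Sum>a\<in>A i. \<chi> a) * cmod (\<Sum>b\<in>B i. \<chi> b))"
  proof (rule character_mean_mono)
    fix \<chi> assume \<chi>: "\<chi> \<in> dirichlet_characters q"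
    have "?T \<chi> =
        (\<Sum>i\<le>R. \<Sum>ab\<in>A i \<times> B i. \<chi> (fst ab * snd ab))"
      unfolding S using fin disj by (intro sum.UNION_disjoint) auto
    also have "\<dots> = (\<Sum>i\<le>R. (\<Sum>a\<in>A i. \<chi> a) * (\<Sum>b\<in>B i. \<chi> b))"
      by (simp add: sum_product sum.cartesian_product dirichlet_character_mult[OF \<chi>] case_prod_unfold)
    finally have "?T \<chi> =
        (\<Sum>i\<le>R. (\<Sum>a\<in>A i. \<chi> a) * (\<Sum>b\<in>B i. \<chi> b))" .
    thus "cmod (?T \<chi>) \<le>
        (\<Sum>i\<le>R. cmod (\<Sum>a\<in>A i. \<chi> a) * cmod (\<Sum>b\<in>B i. \<chi> b))"
      by (simp add: norm_mult [symmetric] norm_sum)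
  qed
  also have "\<dots> = (\<Sum>i\<le>R. character_mean q (\<lambda>\<chi>. cmod (\<Sum>a\<in>A i. \<chi> a) * cmod (\<Sum>b\<in>B i. \<chi> b)))"
    by (rule character_mean_sum)
  also have "\<dots> \<le> (\<Sum>i\<le>R. 1 * sqrt (real (card (A i) * card (B i))))"
    using character_mean_product_le[OF q(1) A_sub B_sub] by (intro sum_mono) (simp only: mult_1_left)
  also have "\<dots> \<le> sqrt ((\<Sum>i\<le>R. 1\<^sup>2) * (\<Sum>i\<le>R. (sqrt (real (card (A i) * card (B i))))\<^sup>2))"
    by (intro real_le_rsqrt Cauchy_Schwarz_ineq_sum)
  also have "\<dots> = sqrt ((real R + 1) * real (card (split_pairs x y h k)))"
    using cards by simp
  also have "\<dots> \<le> sqrt ((ln x / h + 1) * (real (k choose (k div 2)) * real (Psi x y)))"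
  proof (intro real_sqrt_le_mono mult_mono card_split_pairs_le y h)
    have "ln x / h \<ge> 0" using q h by simp
    thus "real R + 1 \<le> ln x / h + 1" unfolding R_def by linarith
    thus "0 \<le> ln x / h + 1" by linarith
  qed auto
  finally show ?thesis .
qed

definition exceptional :: "real \<Rightarrow> real \<Rightarrow> real \<Rightarrow> nat \<Rightarrow> nat set" where
  "exceptional x y h k0 = {n \<in> smooth_upto x y. large_Omega (sqrt y) n < k0 \<or>
     x * exp (- h) < real n \<or> (\<exists>p. prime p \<and> sqrt y < real p \<and> p\<^sup>2 dvd n)}"

text \<open>
  Averaging over splittings represents a smooth number \<open>n\<close> with \<open>k\<close> large prime factors with the weight
  \<open>split_count x y h k n / (k choose (k div 2))\<close>. This lies between \<open>0\<close> and \<open>1\<close>, and it is \<open>1\<close> unless \<open>n\<close> is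
  exceptional. The defect is a sum over the exceptional set with coefficients at most \<open>1\<close>, to which
  Bessel's inequality applies directly.
\<close>

lemma character_mean_smooth_sum_le:
  assumes q: "q > 0" "1 \<le> x" "x \<le> real q" and y: "y \<ge> 1" and h: "h > 0"
    and K: "\<And>n. n \<in> smooth_upto x y \<Longrightarrow> large_Omega (sqrt y) n \<le> K"
  shows "character_mean q (\<lambda>\<chi>. cmod (\<Sum>n\<in>smooth_upto x y. \<chi> n)) \<le>
           sqrt (real (card (exceptional x y h k0))) +
           (\<Sum>k\<in>{k0..K}. sqrt ((ln x / h + 1) * real (Psi x y) / real (k choose (k div 2))))"
proof -
  let ?N = "smooth_upto x y" and ?L = "large_Omega (sqrt y)"
  define b where "b = (\<lambda>k::nat. k choose (k div 2))"
  have bpos: "b k > 0" for k by (simp add: b_def)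
  define \<rho> where "\<rho> = (\<lambda>k n. split_count x y h k n)"
  \<comment> \<open>\<open>c n\<close> is the part of \<open>n\<close> that the splittings do not represent.\<close>
  define c where "c = (\<lambda>n. if ?L n < k0 then 1 else 1 - real (\<rho> (?L n) n) / real (b (?L n)))"
  have c: "0 \<le> c n" "c n \<le> 1" for n
    using split_count_le[OF y h, of x "?L n" n] bpos[of "?L n"]
    by (auto simp: c_def b_def \<rho>_def divide_simps)
  have c0: "c n = 0" if "n \<in> ?N" "n \<notin> exceptional x y h k0" for n
  proof -
    have "\<rho> (?L n) n = b (?L n)"
      unfolding \<rho>_def b_def using that y h
      by (intro antisym split_count_le split_count_ge) (auto simp: exceptional_def)
    thus ?thesis using that bpos[of "?L n"] by (auto simp: c_def exceptional_def)
  qed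
  define T where "T = (\<lambda>k \<chi>. \<Sum>ab\<in>split_pairs x y h k. \<chi> (fst ab * snd ab) :: complex)"
  define E where "E = exceptional x y h k0"
  have E_sub: "E \<subseteq> ?N" by (auto simp: E_def exceptional_def)
  have decomp: "(\<Sum>n\<in>?N. \<chi> n) = (\<Sum>n\<in>E. of_real (c n) * \<chi> n) + (\<Sum>k\<in>{k0..K}. T k \<chi> / of_nat (b k))"
    for \<chi> :: "nat \<Rightarrow> complex"
  proof -
    have "(\<Sum>k\<in>{k0..K}. T k \<chi> / of_nat (b k)) =
        (\<Sum>k\<in>{k0..K}. \<Sum>n\<in>{n\<in>?N. ?L n = k}. of_nat (\<rho> k n) / of_nat (b k) * \<chi> n)"
      unfolding T_def sum_split_pairs[OF y h] by (simp add: sum_divide_distrib \<rho>_def)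
    also have "\<dots> = (\<Sum>k\<in>{k0..K}. \<Sum>n\<in>{n\<in>{n\<in>?N. k0 \<le> ?L n}. ?L n = k}. of_nat (\<rho> (?L n) n) / of_nat (b (?L n)) * \<chi> n)"
      by (intro sum.cong) auto
    also have "\<dots> = (\<Sum>n\<in>{n\<in>?N. k0 \<le> ?L n}. of_nat (\<rho> (?L n) n) / of_nat (b (?L n)) * \<chi> n)"
      using K by (intro sum.group) auto
    also have "\<dots> = (\<Sum>n\<in>?N. if k0 \<le> ?L n then of_nat (\<rho> (?L n) n) / of_nat (b (?L n)) * \<chi> n else 0)"
      by (rule sum.inter_filter) simp
    also have "\<dots> = (\<Sum>n\<in>?N. (1 - of_real (c n)) * \<chi> n)"
      by (intro sum.cong refl) (auto simp: c_def)
    also have "\<dots> = (\<Sum>n\<in>?N. \<chi> n) - (\<Sum>n\<in>?N. of_real (c n) * \<chi> n)"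
      by (simp add: algebra_simps sum_subtractf)
    also have "(\<Sum>n\<in>?N. of_real (c n) * \<chi> n) = (\<Sum>n\<in>E. of_real (c n) * \<chi> n)"
      using E_sub c0 by (intro sum.mono_neutral_right) (auto simp: E_def)
    finally show ?thesis by simp
  qed
  have "character_mean q (\<lambda>\<chi>. cmod (\<Sum>n\<in>?N. \<chi> n)) \<le>
      character_mean q (\<lambda>\<chi>. cmod (\<Sum>n\<in>E. of_real (c n) * \<chi> n) +
        (\<Sum>k\<in>{k0..K}. 1 / real (b k) * cmod (T k \<chi>)))"
  proof (rule character_mean_mono)
    fix \<chi> :: "nat \<Rightarrow> complex"
    have "cmod (\<Sum>n\<in>?N. \<chi> n) \<le> cmod (\<Sum>n\<in>E. of_real (c n) * \<chi> n) +
        cmod (\<Sum>k\<in>{k0..K}. T k \<chi> / of_nat (b k))"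
      unfolding decomp by (rule norm_triangle_ineq)
    also have "cmod (\<Sum>k\<in>{k0..K}. T k \<chi> / of_nat (b k)) \<le>
        (\<Sum>k\<in>{k0..K}. 1 / real (b k) * cmod (T k \<chi>))"
      by (rule order_trans[OF norm_sum]) (simp add: norm_divide)
    finally show "cmod (\<Sum>n\<in>?N. \<chi> n) \<le> cmod (\<Sum>n\<in>E. of_real (c n) * \<chi> n) +
        (\<Sum>k\<in>{k0..K}. 1 / real (b k) * cmod (T k \<chi>))" by simp
  qed
  also have "\<dots> = character_mean q (\<lambda>\<chi>. cmod (\<Sum>n\<in>E. of_real (c n) * \<chi> n)) +
      (\<Sum>k\<in>{k0..K}. 1 / real (b k) * character_mean q (\<lambda>\<chi>. cmod (T k \<chi>)))"
    by (simp only: character_mean_add character_mean_sum character_mean_mult_left)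
  also have "\<dots> \<le> sqrt (real (card E)) +
      (\<Sum>k\<in>{k0..K}. 1 / real (b k) * sqrt ((ln x / h + 1) * (real (b k) * real (Psi x y))))"
  proof (intro add_mono sum_mono mult_left_mono)
    show "character_mean q (\<lambda>\<chi>. cmod (\<Sum>n\<in>E. of_real (c n) * \<chi> n)) \<le> sqrt (real (card E))"
    proof (rule character_mean_norm_sum_le[OF q(1)])
      show "E \<subseteq> {0<..q}"
      proof
        fix n assume "n \<in> E"
        hence "n > 0" "real n \<le> x" using E_sub by (auto simp: smooth_upto_def)
        thus "n \<in> {0<..q}" using q by auto
      qed
    qed (use c in \<open>simp add: abs_le_iff\<close>)
    fix k
    show "character_mean q (\<lambda>\<chi>. cmod (T k \<chi>)) \<le> sqrt ((ln x / h + 1) * (real (b k) * real (Psi x y)))"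
      unfolding T_def b_def by (intro character_mean_split_pairs_le q y h)
  qed auto
  also have "(\<Sum>k\<in>{k0..K}. 1 / real (b k) * sqrt ((ln x / h + 1) * (real (b k) * real (Psi x y)))) =
      (\<Sum>k\<in>{k0..K}. sqrt ((ln x / h + 1) * real (Psi x y) / real (b k)))"
  proof (rule sum.cong[OF refl])
    fix k
    have "1 / real (b k) = sqrt (1 / (real (b k))\<^sup>2)" using bpos[of k] by (simp add: real_sqrt_divide)
    hence "1 / real (b k) * sqrt ((ln x / h + 1) * (real (b k) * real (Psi x y))) =
        sqrt (1 / (real (b k))\<^sup>2 * ((ln x / h + 1) * (real (b k) * real (Psi x y))))"
      by (simp only: real_sqrt_mult [symmetric])
    also have "1 / (real (b k))\<^sup>2 * ((ln x / h + 1) * (real (b k) * real (Psi x y))) =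
        (ln x / h + 1) * real (Psi x y) / real (b k)"
      using bpos[of k] by (simp add: power2_eq_square)
    finally show "1 / real (b k) * sqrt ((ln x / h + 1) * (real (b k) * real (Psi x y))) =
        sqrt ((ln x / h + 1) * real (Psi x y) / real (b k))" .
  qed
  finally show ?thesis by (simp add: E_def b_def)
qed

section \<open>The saddle point\<close>

definition saddle_sum :: "real \<Rightarrow> real \<Rightarrow> real" where
  "saddle_sum y \<alpha> = (\<Sum>p | prime p \<and> real p \<le> y. ln (real p) / (real p powr \<alpha> - 1))"

lemma saddle_sum_strict_antimono:
  assumes "y \<ge> 2" "0 < a" "a < b"
  shows "saddle_sum y b < saddle_sum y a"
  unfolding saddle_sum_def
proof (rule sum_strict_mono)
  show "{p. prime p \<and> real p \<le> y} \<noteq> {}" using assms(1) two_is_prime_nat by fastforce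
  fix p :: nat assume "p \<in> {p. prime p \<and> real p \<le> y}"
  hence p: "real p \<ge> 2" using prime_ge_2_nat[of p] by auto
  have "real p powr 0 < real p powr a" using p assms by (intro powr_less_mono) auto
  hence a: "real p powr a - 1 > 0" using p by simp
  have "real p powr a < real p powr b" using p assms by (intro powr_less_mono) auto
  hence "real p powr a - 1 < real p powr b - 1" by linarith
  thus "ln (real p) / (real p powr b - 1) < ln (real p) / (real p powr a - 1)"
    using a p by (intro divide_strict_left_mono mult_pos_pos) (linarith | simp)+
qed simp

lemma saddle_point_exists:
  assumes "y \<ge> 2" "x > 1"
  shows "\<exists>\<alpha>>0. saddle_sum y \<alpha> = ln x"
proof -
  define P where "P = {p::nat. prime p \<and> real p \<le> y}"
  define G where "G = (\<Sum>p\<in>P. ln (real p))"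
  define a where "a = log 2 (1 + ln 2 / ln x)"
  define b where "b = log 2 (1 + G / ln x)"
  have finP: "finite P" by (simp add: P_def)
  have P2: "2 \<in> P" using assms by (simp add: P_def)
  have p2: "real p \<ge> 2" if "p \<in> P" for p using that prime_ge_2_nat[of p] by (auto simp: P_def)
  have lx: "ln x > 0" using assms by simp
  have G2: "ln 2 \<le> G"
    unfolding G_def using P2 finP p2 by (intro member_le_sum[of 2 P "\<lambda>p. ln (real p)", simplified]) fastforce+
  hence G0: "G > 0" using ln_2_bounds by linarith
  have "1 + ln 2 / ln x > 1" using lx ln_2_bounds(1) by (simp del: ln_gt_zero_iff)
  hence a0: "a > 0" unfolding a_def by (subst zero_less_log_cancel_iff) linarith+
  have ab: "a \<le> b" unfolding a_def b_def using lx G2 G0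
    by (intro log_mono add_mono divide_right_mono) (auto intro!: add_pos_pos divide_pos_pos)
  \<comment> \<open>At \<open>a\<close> the term of the prime \<open>2\<close> alone equals \<open>ln x\<close>. At \<open>b\<close> even the denominator
    \<open>2 powr b - 1\<close> in all terms would give \<open>ln x\<close>.\<close>
  have pa: "2 powr a = 1 + ln 2 / ln x"
    unfolding a_def using lx by (intro powr_log_cancel) (auto intro!: add_pos_pos divide_pos_pos)
  have pb: "2 powr b = 1 + G / ln x"
    unfolding b_def using lx G0 by (intro powr_log_cancel) (auto intro!: add_pos_pos divide_pos_pos)
  have gt1: "real p powr t > 1" if "p \<in> P" "t > 0" for p t
    using p2[OF that(1)] that(2) powr_less_mono[of 0 t "real p"] by simp
  have ge_a: "saddle_sum y a \<ge> ln x"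
  proof -
    have "ln x = ln (real 2) / (real 2 powr a - 1)" using pa lx by simp
    also have "\<dots> \<le> (\<Sum>p\<in>P. ln (real p) / (real p powr a - 1))"
    proof (rule member_le_sum[OF P2 _ finP])
      fix p assume "p \<in> P - {2}"
      hence p: "real p powr a > 1" "real p \<ge> 2" using gt1[OF _ a0, of p] p2[of p] by auto
      have "real p powr a - 1 \<ge> 0" using p(1) by linarith
      thus "0 \<le> ln (real p) / (real p powr a - 1)"
        using p(2) by (intro divide_nonneg_nonneg) auto
    qed
    finally show ?thesis by (simp add: saddle_sum_def P_def)
  qed
  have le_b: "saddle_sum y b \<le> ln x"
  proof -
    have "saddle_sum y b \<le> (\<Sum>p\<in>P. ln (real p) / (G / ln x))"
      unfolding saddle_sum_def P_def [symmetric]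
    proof (rule sum_mono)
      fix p assume p: "p \<in> P"
      have "2 powr b \<le> real p powr b" using p2[OF p] a0 ab by (intro powr_mono2) auto
      hence le: "G / ln x \<le> real p powr b - 1" using pb by simp
      have pos: "0 < G / ln x" using lx G0 by (intro divide_pos_pos)
      hence "0 < (real p powr b - 1) * (G / ln x)" using le by (intro mult_pos_pos) linarith+
      with le show "ln (real p) / (real p powr b - 1) \<le> ln (real p) / (G / ln x)"
        using p2[OF p] by (intro divide_left_mono) auto
    qed
    also have "\<dots> = G / (G / ln x)" by (simp only: G_def sum_divide_distrib)
    also have "\<dots> = ln x" using G0 lx by simp
    finally show ?thesis .
  qed
  have cont: "continuous_on {a..b} (saddle_sum y)"
    unfolding saddle_sum_def P_def [symmetric]
  proof (intro continuous_on_sum continuous_on_divide continuous_intros ballI)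
    fix p t assume pt: "p \<in> P" "t \<in> {a..b}"
    show "real p \<noteq> 0" using p2[OF pt(1)] by auto
    show "real p powr t - 1 \<noteq> 0" using gt1[OF pt(1), of t] pt a0 by auto
  qed
  obtain \<alpha> where "a \<le> \<alpha>" "saddle_sum y \<alpha> = ln x"
    using IVT2'[OF le_b ge_a ab cont] by auto
  thus ?thesis using a0 by (intro exI[of _ \<alpha>]) auto
qed

lemma saddle_point_properties:
  assumes "y \<ge> 2" "x > 1"
  shows "saddle_point x y > 0" "saddle_sum y (saddle_point x y) = ln x"
proof -
  have "\<exists>!\<alpha>. \<alpha> > 0 \<and> saddle_sum y \<alpha> = ln x"
    using saddle_point_exists[OF assms] saddle_sum_strict_antimono[OF assms(1)]
    by (metis less_irrefl not_less_iff_gr_or_eq)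
  from theI'[OF this] show "saddle_point x y > 0" "saddle_sum y (saddle_point x y) = ln x"
    by (simp_all add: saddle_point_def saddle_sum_def)
qed

text \<open>
  In the defining equation of the saddle point \<open>\<alpha> \<ge> 1 / 2\<close> the term of \<open>p\<close> is at most
  \<open>4 * y powr (1 - \<alpha>) * ln p / p\<close>, so that Mertens' bound gives \<open>ln x \<le> 8 * y powr (1 - \<alpha>) * ln y\<close>. The
  alternatives \<open>\<alpha> > 1\<close> and \<open>\<alpha> < 1 / 2\<close> are settled by \<open>u > 8\<close> and by \<open>u \<le> sqrt y\<close>.
\<close>

lemma saddle_powr_ge:
  assumes "y > 0" "ln y \<ge> 4" "u_param x y > 8" "ln x ^ 6 \<le> y" "x > 0"
  shows "y powr (1 / 2 - saddle_point x y) \<ge> u_param x y / 8 / sqrt y"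
proof -
  define \<alpha> where "\<alpha> = saddle_point x y"
  define u where "u = u_param x y"
  have ulx: "u * ln y = ln x" using assms(2) by (simp add: u_def u_param_def)
  have y4: "y \<ge> 4" using assms(1,2) ln_le_minus_one[of y] by linarith
  have lx: "ln x \<ge> u" "ln x > 0"
  proof -
    have "u * 1 \<le> u * ln y" using assms by (intro mult_left_mono) (auto simp: u_def)
    thus "ln x \<ge> u" using ulx by simp
    thus "ln x > 0" using assms(3) unfolding u_def by linarith
  qed
  have x1: "x > 1" using lx(2) ln_gt_zero_iff[OF assms(5)] by blast
  have eq: "saddle_sum y \<alpha> = ln x" and a0: "\<alpha> > 0"
    using saddle_point_properties[of y x] y4 x1 by (auto simp: \<alpha>_def)
  have half: "y powr (1 / 2) = sqrt y" using assms(1) by (simp add: powr_half_sqrt)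
  show ?thesis
  proof (cases "\<alpha> < 1 / 2")
    case True
    have "u / 8 / sqrt y \<le> 1"
    proof -
      have "ln x ^ 3 \<le> sqrt y" using assms(4) lx by (intro real_le_rsqrt) (simp add: power_mult [symmetric])
      moreover have "u ^ 1 \<le> u ^ 3" using assms by (intro power_increasing) (auto simp: u_def)
      moreover have "u ^ 3 \<le> ln x ^ 3" using lx assms by (intro power_mono) (auto simp: u_def)
      moreover have "0 < sqrt y" using y4 by simp
      ultimately have "u \<le> 8 * sqrt y" "0 < sqrt y"
        unfolding power_one_right by linarith+
      thus ?thesis by (simp add: divide_le_eq)
    qed
    also have "1 \<le> y powr (1 / 2 - \<alpha>)" using True y4 by (intro ge_one_powr_ge_zero) auto
    finally show ?thesis by (simp add: u_def \<alpha>_def)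
  next
    case False
    \<comment> \<open>Truncating the exponent at \<open>0\<close> covers \<open>\<alpha> > 1\<close>, which \<open>u > 8\<close> rules out afterwards.\<close>
    define \<gamma> where "\<gamma> = max 0 (1 - \<alpha>)"
    define P where "P = {p::nat. prime p \<and> real p \<le> y}"
    have p2: "real p \<ge> 2" "real p \<le> y" if "p \<in> P" for p
      using that prime_ge_2_nat[of p] by (auto simp: P_def)
    have two: "(2::real) powr - (1/2) \<le> 3/4"
    proof -
      have "(4/3::real) \<le> sqrt 2" by (intro real_le_rsqrt) (simp add: power2_eq_square)
      also have "sqrt 2 = (2::real) powr (1/2)" by (simp add: powr_half_sqrt)
      finally show ?thesis by (simp add: powr_minus field_simps)
    qed
    have "ln x = (\<Sum>p\<in>P. ln (real p) / (real p powr \<alpha> - 1))"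
      using eq by (simp add: saddle_sum_def P_def)
    also have "\<dots> \<le> (\<Sum>p\<in>P. 4 * y powr \<gamma> * (ln (real p) * (1 / real p)))"
    proof (rule sum_mono)
      fix p assume p: "p \<in> P"
      note pp = p2[OF p]
      define w where "w = real p powr \<alpha>"
      have w0: "w > 0" using pp by (simp add: w_def)
      have "inverse w \<le> real p powr - (1/2)"
        using pp False by (simp add: w_def powr_minus [symmetric])
      also have "\<dots> \<le> 2 powr - (1/2)" using pp by (intro powr_mono2') auto
      also note two
      finally have "4 \<le> 3 * w" using w0 by (simp add: field_simps)
      hence "w / 4 \<le> w - 1" by simp
      hence "ln (real p) / (w - 1) \<le> ln (real p) / (w / 4)"
        using w0 pp by (intro divide_left_mono) auto
      also have "\<dots> = 4 * ln (real p) * inverse w" by (simp add: field_simps)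
      also have "inverse w = real p powr (1 - \<alpha>) * (1 / real p)"
        using pp by (simp add: w_def powr_diff field_simps)
      also have "4 * ln (real p) * (real p powr (1 - \<alpha>) * (1 / real p)) \<le>
          4 * ln (real p) * (y powr \<gamma> * (1 / real p))"
      proof (intro mult_left_mono mult_right_mono)
        have "real p powr (1 - \<alpha>) \<le> real p powr \<gamma>" using pp by (intro powr_mono) (auto simp: \<gamma>_def)
        also have "\<dots> \<le> y powr \<gamma>" using pp by (intro powr_mono2) (auto simp: \<gamma>_def)
        finally show "real p powr (1 - \<alpha>) \<le> y powr \<gamma>" .
      qed (use pp in auto)
      finally show "ln (real p) / (real p powr \<alpha> - 1) \<le> 4 * y powr \<gamma> * (ln (real p) * (1 / real p))"
        by (simp add: w_def mult_ac)
    qed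
    also have "\<dots> = 4 * y powr \<gamma> * (\<Sum>p\<in>P. ln (real p) * (1 / real p))"
      by (simp add: sum_distrib_left)
    also have "\<dots> \<le> 4 * y powr \<gamma> * (2 * ln y)"
      using sum_ln_primes_divide_le[of y] y4 assms(2)
      by (intro mult_left_mono) (auto simp: P_def)
    finally have "u * ln y \<le> 8 * y powr \<gamma> * ln y" using ulx by simp
    hence le: "u \<le> 8 * y powr \<gamma>" using assms(2) by (simp add: mult_le_cancel_right)
    have "\<gamma> = 1 - \<alpha>"
    proof (rule ccontr)
      assume "\<gamma> \<noteq> 1 - \<alpha>"
      hence "\<gamma> = 0" by (auto simp: \<gamma>_def max_def split: if_splits)
      thus False using le assms y4 by (simp add: u_def)
    qed
    hence "u / 8 \<le> y powr (1 - \<alpha>)" using le by simp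
    also have "\<dots> = y powr (1 / 2 - \<alpha>) * sqrt y" unfolding half [symmetric]
      by (simp add: powr_add [symmetric])
    finally show ?thesis using y4 by (simp add: u_def \<alpha>_def field_simps)
  qed
qed

lemma chebyshev_psi_eq_sum_primes:
  "chebyshev_psi N = (\<Sum>p | prime p \<and> p \<le> N. ln (real p) * real (card {k. 0 < k \<and> p ^ k \<le> N}))"
proof -
  define P where "P = {p. prime p \<and> p \<le> N}"
  define K where "K = (\<lambda>p::nat. {k. 0 < k \<and> p ^ k \<le> N})"
  have finP: "finite P" by (simp add: P_def)
  have finK: "finite (K p)" if "p \<in> P" for p
  proof (rule finite_subset)
    show "K p \<subseteq> {..N}"
    proof
      fix k assume "k \<in> K p"
      moreover have "k < p ^ k" using that prime_gt_1_nat[of p] by (intro power_gt_expt) (auto simp: P_def)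
      ultimately show "k \<in> {..N}" by (auto simp: K_def)
    qed
  qed simp
  have "chebyshev_psi N = (\<Sum>d\<in>(\<lambda>(p,k). p ^ k) ` (SIGMA p:P. K p). mangoldt d)"
    unfolding chebyshev_psi_def
  proof (rule sum.mono_neutral_right)
    show "(\<lambda>(p,k). p ^ k) ` (SIGMA p:P. K p) \<subseteq> {1..N}"
      by (auto simp: P_def K_def Suc_le_eq prime_gt_0_nat)
    show "\<forall>d\<in>{1..N} - (\<lambda>(p,k). p ^ k) ` (SIGMA p:P. K p). mangoldt d = (0::real)"
    proof
      fix d assume d: "d \<in> {1..N} - (\<lambda>(p,k). p ^ k) ` (SIGMA p:P. K p)"
      have "\<not> primepow d"
      proof
        assume "primepow d"
        then obtain p k where pk: "prime p" "0 < k" "d = p ^ k" by (auto simp: primepow_def)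
        have "p ^ 1 \<le> p ^ k" using pk by (intro power_increasing) (auto simp: prime_ge_Suc_0_nat)
        hence "(p, k) \<in> (SIGMA p:P. K p)" using pk d by (auto simp: P_def K_def)
        thus False using d pk by force
      qed
      thus "mangoldt d = (0::real)" by (simp add: mangoldt_def)
    qed
  qed simp
  also have "\<dots> = (\<Sum>pk\<in>(SIGMA p:P. K p). mangoldt (fst pk ^ snd pk))"
    by (subst sum.reindex)
       (auto simp: inj_on_def P_def K_def prime_power_inj'' case_prod_unfold)
  also have "\<dots> = (\<Sum>p\<in>P. \<Sum>k\<in>K p. ln (real p))"
    using finP finK by (subst sum.Sigma) (auto simp: P_def K_def intro!: sum.cong)
  finally show ?thesis by (simp add: P_def K_def mult.commute)
qed

text \<open>
  Expanding \<open>1 / (p powr \<alpha> - 1)\<close> into a geometric series over the powers of \<open>p\<close>, each power up to \<open>y\<close>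
  contributes at least \<open>y powr - \<alpha>\<close>. The saddle point equation therefore gives \<open>y powr - \<alpha> * \<psi>(y) \<le> ln x\<close>.
\<close>

lemma saddle_powr_le:
  assumes "y \<ge> 2" "x > 1"
  shows "y powr (1 / 2 - saddle_point x y) \<le> 6 * ln x / sqrt y"
proof -
  define \<alpha> where "\<alpha> = saddle_point x y"
  have eq: "saddle_sum y \<alpha> = ln x" and a0: "\<alpha> > 0"
    using saddle_point_properties[OF assms] by (auto simp: \<alpha>_def)
  define N where "N = nat \<lfloor>y\<rfloor>"
  have N: "n \<le> N \<longleftrightarrow> real n \<le> y" for n using assms by (simp add: N_def le_nat_iff le_floor_iff)
  have "y / 6 * y powr - \<alpha> \<le> chebyshev_psi N * y powr - \<alpha>"
    unfolding N_def using assms by (intro mult_right_mono chebyshev_psi_lower) auto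
  also have "\<dots> = (\<Sum>p | prime p \<and> p \<le> N. ln (real p) * (real (card {k. 0 < k \<and> p ^ k \<le> N}) * y powr - \<alpha>))"
    unfolding chebyshev_psi_eq_sum_primes by (simp add: sum_distrib_right mult.assoc)
  also have "\<dots> \<le> (\<Sum>p | prime p \<and> p \<le> N. ln (real p) * (1 / (real p powr \<alpha> - 1)))"
  proof (intro sum_mono mult_left_mono)
    fix p assume p: "p \<in> {p. prime p \<and> p \<le> N}"
    hence p2: "real p \<ge> 2" using prime_ge_2_nat[of p] by auto
    define v where "v = real p powr - \<alpha>"
    have v: "0 < v" "v < 1" using p2 a0 powr_less_one[of "real p" "- \<alpha>"] by (auto simp: v_def)
    define K where "K = {k. 0 < k \<and> p ^ k \<le> N}"
    show "real (card {k. 0 < k \<and> p ^ k \<le> N}) * y powr - \<alpha> \<le> 1 / (real p powr \<alpha> - 1)"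
    proof (cases "finite K")
      case True
      have "real (card K) * y powr - \<alpha> = (\<Sum>k\<in>K. y powr - \<alpha>)" by simp
      also have "\<dots> \<le> (\<Sum>k\<in>K. v ^ k)"
      proof (rule sum_mono)
        fix k assume "k \<in> K"
        hence "real p ^ k \<le> y" using N[of "p ^ k"] by (simp add: K_def)
        hence "y powr - \<alpha> \<le> (real p ^ k) powr - \<alpha>" using p2 a0 by (intro powr_mono2') auto
        also have "\<dots> = v ^ k" using p2 by (simp add: v_def powr_powr powr_realpow [symmetric] mult.commute)
        finally show "y powr - \<alpha> \<le> v ^ k" .
      qed
      also have "\<dots> = (\<Sum>k\<in>insert 0 K. v ^ k) - 1" using True by (simp add: K_def)
      also have "(\<Sum>k\<in>insert 0 K. v ^ k) \<le> (\<Sum>k. v ^ k)"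
        using v True by (intro sum_le_suminf summable_geometric) auto
      also have "(\<Sum>k. v ^ k) = 1 / (1 - v)" using v by (simp add: suminf_geometric)
      also have "1 / (1 - v) - 1 = 1 / (real p powr \<alpha> - 1)"
      proof -
        have v1: "v = 1 / real p powr \<alpha>" using p2 by (simp add: v_def powr_minus field_simps)
        have "real p powr \<alpha> > 1" using v unfolding v1 by (simp add: divide_less_eq_1)
        hence ne: "real p powr \<alpha> - 1 \<noteq> 0" "real p powr \<alpha> \<noteq> 0" by linarith+
        have "1 / (1 - v) = real p powr \<alpha> / (real p powr \<alpha> - 1)"
          unfolding v1 using ne by (simp add: field_simps)
        also have "\<dots> = (real p powr \<alpha> - 1 + 1) / (real p powr \<alpha> - 1)" by simp
        also have "\<dots> = 1 + 1 / (real p powr \<alpha> - 1)"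
          unfolding add_divide_distrib using ne by simp
        finally show ?thesis by simp
      qed
      finally show ?thesis by (simp add: K_def)
    next
      case False
      have "1 \<le> real p powr \<alpha>" using p2 a0 by (intro ge_one_powr_ge_zero) auto
      thus ?thesis using False by (simp add: K_def)
    qed
  next
    fix p assume "p \<in> {p. prime p \<and> p \<le> N}"
    thus "0 \<le> ln (real p)" using prime_ge_1_nat[of p] by auto
  qed
  also have "\<dots> = saddle_sum y \<alpha>" by (simp add: saddle_sum_def N)
  finally have "y * y powr - \<alpha> \<le> 6 * ln x" using eq by simp
  also have "y * y powr - \<alpha> = y powr (1 / 2 - \<alpha>) * sqrt y"
    using assms by (simp add: powr_half_sqrt [symmetric] powr_add [symmetric] powr_mult_base)
  finally show ?thesis using assms by (simp add: \<alpha>_def pos_le_divide_eq)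
qed

section \<open>The mean value of smooth character sums\<close>

text \<open>
  Here \<open>l\<close> collects the large primes of \<open>n\<close>, each of which lies between \<open>sqrt y\<close> and \<open>y\<close>.
\<close>

lemma large_part_decomposition:
  assumes y: "y \<ge> 1" and n: "n \<in> smooth_upto x y"
  obtains m l where "n = m * l" "m \<in> smooth_upto x (sqrt y)"
    "sqrt y ^ large_Omega (sqrt y) n \<le> real l" "real l \<le> y ^ large_Omega (sqrt y) n"
proof -
  define z where "z = sqrt y"
  define L where "L = large_primes z n"
  define l where "l = (\<Prod>p\<in>L. p ^ multiplicity p n)"
  define m where "m = (\<Prod>p\<in>prime_factors n - L. p ^ multiplicity p n)"
  have n0: "n > 0" "real n \<le> x" "\<And>p. prime p \<Longrightarrow> p dvd n \<Longrightarrow> real p \<le> y"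
    using n y by (auto simp: smooth_upto_iff)
  have z1: "z \<ge> 1" using y by (simp add: z_def)
  have L: "L \<subseteq> prime_factors n" by (auto simp: L_def large_primes_def)
  have "n = (\<Prod>p\<in>prime_factors n. p ^ multiplicity p n)"
    using n0 by (intro prime_factorization_nat) simp
  also have "\<dots> = m * l"
    unfolding m_def l_def using L by (intro prod.subset_diff) auto
  finally have eq: "n = m * l" .
  have ml: "m > 0" "l > 0" using eq n0 by auto
  have pm: "real p \<le> z" if "prime p" "p dvd m" for p
  proof -
    have "\<exists>r\<in>prime_factors n - L. p dvd r ^ multiplicity r n"
      using that prime_dvd_prod_iff[of "prime_factors n - L" p "\<lambda>r. r ^ multiplicity r n"]
      unfolding m_def by simp
    then obtain r where r: "r \<in> prime_factors n - L" "p dvd r ^ multiplicity r n" by blast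
    hence "p dvd r" using that prime_dvd_power by blast
    hence "p = r" using r that by (intro primes_dvd_imp_eq) auto
    thus ?thesis using r by (auto simp: L_def large_primes_def)
  qed
  have "real m * 1 \<le> real m * real l" using ml by (intro mult_left_mono) auto
  hence mx: "real m \<le> x" using eq n0(2) by simp
  have m: "m \<in> smooth_upto x z" using ml mx pm z1 by (auto simp: smooth_upto_iff)
  have rl: "real l = (\<Prod>p\<in>L. real p ^ multiplicity p n)" by (simp add: l_def)
  have zl: "z ^ large_Omega z n \<le> real l"
  proof -
    have "z ^ large_Omega z n = (\<Prod>p\<in>L. z ^ multiplicity p n)"
      by (simp add: large_Omega_def L_def power_sum)
    also have "\<dots> \<le> real l" unfolding rl
      using z1 by (intro prod_mono) (auto simp: L_def large_primes_def intro!: power_mono)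
    finally show ?thesis .
  qed
  have ly: "real l \<le> y ^ large_Omega z n"
  proof -
    have "real l \<le> (\<Prod>p\<in>L. y ^ multiplicity p n)" unfolding rl
      using L n0(3) by (intro prod_mono) (auto simp: in_prime_factors_iff intro!: power_mono)
    also have "\<dots> = y ^ large_Omega z n" by (simp add: large_Omega_def L_def power_sum)
    finally show ?thesis .
  qed
  show ?thesis using that[OF eq] m zl ly by (simp add: z_def)
qed

lemma large_Omega_le:
  assumes "y > 1" "x \<ge> 1" "n \<in> smooth_upto x y"
  shows "real (large_Omega (sqrt y) n) \<le> 2 * u_param x y"
proof -
  have y1: "y \<ge> 1" using assms by simp
  obtain m l where ml: "n = m * l" "m \<in> smooth_upto x (sqrt y)"
    "sqrt y ^ large_Omega (sqrt y) n \<le> real l"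
    using large_part_decomposition[OF y1 assms(3)] by metis
  have m0: "m > 0" "real n \<le> x" using ml assms by (auto simp: smooth_upto_def)
  have "1 * real l \<le> real m * real l" using m0 by (intro mult_right_mono) auto
  hence "real l \<le> x" using ml m0 by simp
  hence "sqrt y ^ large_Omega (sqrt y) n \<le> x" using ml by linarith
  moreover have "sqrt y ^ large_Omega (sqrt y) n > 0" using assms(1) by simp
  ultimately have "ln (sqrt y ^ large_Omega (sqrt y) n) \<le> ln x" using assms(2) by (subst ln_le_cancel_iff) auto
  hence "real (large_Omega (sqrt y) n) * (ln y / 2) \<le> ln x"
    using assms(1) by (simp only: ln_realpow) (simp add: ln_sqrt)
  thus ?thesis using assms(1) by (simp add: u_param_def field_simps)
qed

text \<open>
  With fewer than \<open>u / 4\<close> large prime factors the large part of \<open>n\<close> is at most \<open>x powr (1 / 4)\<close>. Hence,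
  unless \<open>n \<le> x powr (9 / 10)\<close>, the remaining part is at least \<open>x powr (65 / 100)\<close>. A number in the short
  interval without any large prime factor falls under this case too, as \<open>k0 \<ge> 1\<close>.
\<close>

lemma exceptional_subset:
  assumes y: "y > 1" and x: "x \<ge> 1" and k0: "real k0 \<le> u_param x y / 4 + 1" "k0 \<ge> 1"
  shows "exceptional x y h k0 \<subseteq>
     {n \<in> smooth_upto x y. \<exists>p. prime p \<and> sqrt y < real p \<and> p\<^sup>2 dvd n} \<union>
     {n \<in> smooth_upto x y. real n > x * exp (- h) \<and> (\<exists>p. prime p \<and> p dvd n \<and> sqrt y < real p)} \<union>
     (smooth_upto (x powr (9/10)) y \<union>
     {n \<in> smooth_upto x y. \<exists>m\<in>smooth_upto x (sqrt y). m dvd n \<and> x powr (65/100) \<le> real m})"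
    (is "_ \<subseteq> ?A \<union> ?B \<union> (?C \<union> ?D)")
proof
  fix n assume n: "n \<in> exceptional x y h k0"
  hence nN: "n \<in> smooth_upto x y" by (simp add: exceptional_def)
  have n0: "n > 0" using nN by (simp add: smooth_upto_def)
  show "n \<in> ?A \<union> ?B \<union> (?C \<union> ?D)"
  proof (cases "large_Omega (sqrt y) n < k0")
    case True
    have "n \<in> ?D" if big: "n \<notin> ?C"
    proof -
      have nx: "real n > x powr (9/10)" using big nN by (auto simp: smooth_upto_def)
      have y1: "y \<ge> 1" using y by simp
      obtain m l where ml: "n = m * l" "m \<in> smooth_upto x (sqrt y)"
        "real l \<le> y ^ large_Omega (sqrt y) n"
        using large_part_decomposition[OF y1 nN] by metis
      have ml0: "m > 0" "l > 0" using ml n0 by auto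
      have "ln (real l) \<le> ln (y ^ large_Omega (sqrt y) n)"
        using ml ml0 y by (intro ln_mono) auto
      also have "\<dots> = real (large_Omega (sqrt y) n) * ln y" by (simp add: ln_realpow)
      also have "\<dots> \<le> u_param x y / 4 * ln y"
      proof (intro mult_right_mono)
        have "real (large_Omega (sqrt y) n) + 1 \<le> real k0" using True by linarith
        thus "real (large_Omega (sqrt y) n) \<le> u_param x y / 4" using k0 by linarith
      qed (use y in auto)
      also have "\<dots> = ln x / 4" using y by (simp add: u_param_def)
      finally have lnl: "ln (real l) \<le> ln x / 4" .
      have "9 / 10 * ln x \<le> ln (real n)"
      proof -
        have "ln (x powr (9/10)) \<le> ln (real n)" using nx x by (intro ln_mono) auto
        thus ?thesis using x by (simp add: ln_powr)
      qed
      also have "ln (real n) = ln (real m) + ln (real l)" using ml(1) ml0 by (simp add: ln_mult)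
      finally have "65 / 100 * ln x \<le> ln (real m)" using lnl by simp
      hence "exp (65 / 100 * ln x) \<le> exp (ln (real m))" by simp
      hence "x powr (65/100) \<le> real m" using x ml0 by (simp add: powr_def)
      thus ?thesis using ml nN by (auto intro!: bexI[of _ m])
    qed
    thus ?thesis by blast
  next
    case False
    hence "large_Omega (sqrt y) n \<noteq> 0" using k0 by linarith
    hence "large_primes (sqrt y) n \<noteq> {}" by (auto simp: large_Omega_def)
    then obtain p where "prime p" "p dvd n" "sqrt y < real p"
      by (auto simp: large_primes_def in_prime_factors_iff)
    thus ?thesis using n False by (auto simp: exceptional_def)
  qed
qed

lemma central_binomial_ge: "2 ^ k \<le> (real k + 1) * real (k choose (k div 2))"
proof -
  have "(2::nat) ^ k = (\<Sum>i\<le>k. k choose i)" by (rule choose_row_sum [symmetric])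
  also have "\<dots> \<le> (\<Sum>i\<le>k. k choose (k div 2))" by (intro sum_mono binomial_maximum)
  also have "\<dots> = (k + 1) * (k choose (k div 2))" by simp
  finally have "real (2 ^ k) \<le> real ((k + 1) * (k choose (k div 2)))" by (rule of_nat_mono)
  thus ?thesis by (simp add: algebra_simps)
qed

lemma sum_sqrt_central_binomial_le:
  assumes "u \<ge> 1" "real k0 \<ge> u / 4" "real K \<le> 2 * u" "W \<ge> 0"
  shows "(\<Sum>k\<in>{k0..K}. sqrt (W / real (k choose (k div 2))))
           \<le> sqrt ((2 * u + 1) ^ 3 * 2 powr (- u / 4) * W)"
proof -
  have "(\<Sum>k\<in>{k0..K}. sqrt (W / real (k choose (k div 2)))) \<le>
      (\<Sum>k\<in>{k0..K}. sqrt ((2 * u + 1) * 2 powr (- u / 4) * W))"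
  proof (intro sum_mono real_sqrt_le_mono)
    fix k assume k: "k \<in> {k0..K}"
    define b where "b = real (k choose (k div 2))"
    have b: "b > 0" by (simp add: b_def)
    have ku: "real k \<ge> u / 4" "real k \<le> 2 * u" using k assms by auto
    have "2 powr (u / 4) \<le> 2 powr real k" using ku by (intro powr_mono) auto
    also have "\<dots> = 2 ^ k" by (simp add: powr_realpow)
    also have "\<dots> \<le> (real k + 1) * b" unfolding b_def by (rule central_binomial_ge)
    also have "\<dots> \<le> (2 * u + 1) * b" using ku b by (intro mult_right_mono) auto
    finally have "1 / b \<le> (2 * u + 1) / 2 powr (u / 4)" using b by (simp add: field_simps)
    hence "1 / b * W \<le> (2 * u + 1) / 2 powr (u / 4) * W" using assms by (intro mult_right_mono)
    thus "W / real (k choose (k div 2)) \<le> (2 * u + 1) * 2 powr (- u / 4) * W"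
      by (simp add: b_def powr_minus field_simps)
  qed
  also have "\<dots> = real (card {k0..K}) * sqrt ((2 * u + 1) * 2 powr (- u / 4) * W)" by simp
  also have "\<dots> \<le> (2 * u + 1) * sqrt ((2 * u + 1) * 2 powr (- u / 4) * W)"
    using assms by (intro mult_right_mono) auto
  also have "\<dots> = sqrt ((2 * u + 1)\<^sup>2 * ((2 * u + 1) * 2 powr (- u / 4) * W))"
    unfolding real_sqrt_mult[of "(2 * u + 1)\<^sup>2"] using assms by simp
  also have "(2 * u + 1)\<^sup>2 * ((2 * u + 1) * 2 powr (- u / 4) * W) = (2 * u + 1) ^ 3 * 2 powr (- u / 4) * W"
    by (simp add: power2_eq_square power3_eq_cube)
  finally show ?thesis .
qed

text \<open>
  The upper bound, relative to \<open>Psi x y\<close>, that the argument gives for the square of the mean. The first term comes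
  from squares of large primes and from the short interval.
\<close>

definition saving :: "real \<Rightarrow> real \<Rightarrow> real" where
  "saving x y = (ln x)\<^sup>2 / sqrt y + ln x * exp (- u_param x y / 16)"

text \<open>
  The choice \<open>h = 1 / sqrt y + exp (- u / 16)\<close> is the smallest step for which short intervals can be
  counted, up to the second term, which limits the number of bins. Then the square of the main sum is at most
  \<open>Psi x y * ln x * exp (- u / 16)\<close> times \<open>exp (u / 8) * 2 powr (- u / 4)\<close> and a power of \<open>u\<close>, which tends
  to \<open>0\<close> because \<open>ln 2 / 4 > 1 / 8\<close>.
\<close>

lemma character_mean_smooth_le_saving:
  obtains C U where "C > 0"
    "\<And>q x y. \<lbrakk>u_param x y \<ge> U; y > 0; ln y \<ge> 72; x > 0; ln x ^ 6 \<le> y; 32 * ln (ln x) \<le> u_param x y;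
        q > 0; x \<le> real q\<rbrakk> \<Longrightarrow>
       character_mean q (\<lambda>\<chi>. cmod (\<Sum>n\<in>smooth_upto x y. \<chi> n)) \<le> C * sqrt (real (Psi x y) * saving x y)"
proof -
  obtain C1 U1 where C1: "C1 > 0" and few:
    "\<And>x y. \<lbrakk>u_param x y \<ge> U1; y > 0; ln y \<ge> 72; x > 0; ln x ^ 6 \<le> y; 32 * ln (ln x) \<le> u_param x y\<rbrakk> \<Longrightarrow>
       real (card {n \<in> smooth_upto x y. \<exists>m\<in>smooth_upto x (sqrt y). m dvd n \<and> x powr (65/100) \<le> real m})
         \<le> C1 * ln x * exp (- u_param x y / 16) * real (Psi x y)"
    using card_smooth_many_small_primes_le by blast
  have "eventually (\<lambda>u::real. 2 * (2 * u + 1) ^ 3 * exp (- u / 6) * exp (u / 8) \<le> 1) at_top"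
    by real_asymp
  then obtain U2 :: real where U2': "\<And>u. u \<ge> U2 \<Longrightarrow> 2 * (2 * u + 1) ^ 3 * exp (- u / 6) * exp (u / 8) \<le> 1"
    by (auto simp: eventually_at_top_linorder)
  have U2: "2 * (2 * u + 1) ^ 3 * 2 powr (- u / 4) * exp (u / 8) \<le> 1" if "u \<ge> U2" "u \<ge> 1" for u
  proof -
    have "u / 4 * (2 / 3) \<le> u / 4 * ln 2" using that ln_2_bounds(1) by (intro mult_left_mono) auto
    hence "2 powr (- u / 4) \<le> exp (- u / 6)" by (simp add: powr_def)
    hence "2 * (2 * u + 1) ^ 3 * 2 powr (- u / 4) * exp (u / 8) \<le>
        2 * (2 * u + 1) ^ 3 * exp (- u / 6) * exp (u / 8)"
      using that by (intro mult_right_mono mult_left_mono) auto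
    also have "\<dots> \<le> 1" by (rule U2'[OF that(1)])
    finally show ?thesis .
  qed
  define C where "C = sqrt (90 + C1) + 1"
  define U where "U = Max {1, U1, U2}"
  show ?thesis
  proof (rule that[of C U])
    show "C > 0" unfolding C_def using C1 by (intro add_nonneg_pos) auto
    fix q :: nat and x y :: real
    assume asm: "u_param x y \<ge> U" "y > 0" "ln y \<ge> 72" "x > 0" "ln x ^ 6 \<le> y"
      "32 * ln (ln x) \<le> u_param x y" "q > 0" "x \<le> real q"
    let ?E = "character_mean q (\<lambda>\<chi>. cmod (\<Sum>n\<in>smooth_upto x y. \<chi> n))"
    define u where "u = u_param x y"
    have u: "u \<ge> 1" "u \<ge> U1" "u \<ge> U2" using asm(1) by (auto simp: u_def U_def)
    have ly: "ln y \<ge> 1" using asm(3) by linarith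
    have lx: "u \<le> ln x" "ln y \<le> ln x"
      using u_param_le_ln[OF _ ly, of x] u(1) by (auto simp only: u_def)
    have lx1: "ln x \<ge> 1" using ly lx by linarith
    have x1: "x \<ge> 1" using lx1 ln_ge_zero_iff[OF asm(4)] by linarith
    have y4: "y \<ge> 4" using asm(2,3) ln_le_minus_one[of y] by linarith
    define h where "h = 1 / sqrt y + exp (- u / 16)"
    have h: "h > 0" "h \<ge> 1 / sqrt y" "h \<ge> exp (- u / 16)"
      using y4 by (auto simp: h_def intro!: add_nonneg_pos)
    \<comment> \<open>Rounding up makes \<open>L n < k0\<close> equivalent to \<open>L n < u / 4\<close>.\<close>
    define k0 where "k0 = nat \<lceil>u / 4\<rceil>"
    have k0: "real k0 \<ge> u / 4" "real k0 \<le> u / 4 + 1" "k0 \<ge> 1"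
      using u(1) unfolding k0_def by linarith+
    define K where "K = nat \<lfloor>2 * u\<rfloor>"
    have K: "real K \<le> 2 * u" using u(1) unfolding K_def by linarith
    have KL: "large_Omega (sqrt y) n \<le> K" if "n \<in> smooth_upto x y" for n
      using large_Omega_le[OF _ x1 that] y4 by (simp add: K_def u_def le_nat_floor)
    define \<Psi> where "\<Psi> = real (Psi x y)"
    have \<Psi>: "\<Psi> \<ge> 0" by (simp add: \<Psi>_def)
    define E where "E = exceptional x y h k0"
    have E: "real (card E) \<le> (90 + C1) * saving x y * \<Psi>"
    proof -
      define A where "A = {n \<in> smooth_upto x y. \<exists>p. prime p \<and> sqrt y < real p \<and> p\<^sup>2 dvd n}"
      define B where "B = {n \<in> smooth_upto x y. real n > x * exp (- h) \<and> (\<exists>p. prime p \<and> p dvd n \<and> sqrt y < real p)}"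
      define D where "D = {n \<in> smooth_upto x y. \<exists>m\<in>smooth_upto x (sqrt y). m dvd n \<and> x powr (65/100) \<le> real m}"
      let ?C = "smooth_upto (x powr (9/10)) y"
      have "E \<subseteq> A \<union> B \<union> (?C \<union> D)"
        unfolding E_def A_def B_def D_def using y4 x1 k0 by (intro exceptional_subset) (auto simp: u_def)
      hence "card E \<le> card (A \<union> B \<union> (?C \<union> D))"
        by (intro card_mono) (auto simp: A_def B_def D_def)
      also have "\<dots> \<le> card A + card B + (card ?C + card D)"
        by (intro order_trans[OF card_Un_le] add_mono order_refl card_Un_le)
      finally have "real (card E) \<le> real (card A) + real (card B) + (real (Psi (x powr (9/10)) y) + real (card D))"
        by (simp add: Psi_def)
      also have "\<dots> \<le> 72 * (ln x)\<^sup>2 / sqrt y * \<Psi> + 12 * h * ln x * \<Psi> +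
          (6 * ln x * exp (- u / 16) * \<Psi> + C1 * ln x * exp (- u / 16) * \<Psi>)"
        unfolding \<Psi>_def
      proof (intro add_mono)
        show "real (card A) \<le> 72 * (ln x)\<^sup>2 / sqrt y * real (Psi x y)"
          unfolding A_def by (intro card_smooth_large_square_le y4 asm lx1)
        show "real (card B) \<le> 12 * h * ln x * real (Psi x y)"
          unfolding B_def by (intro card_smooth_short_interval_le y4 h asm lx1)
        show "real (Psi (x powr (9/10)) y) \<le> 6 * ln x * exp (- u / 16) * real (Psi x y)"
          using Psi_small_argument_le[of x y] u asm by (simp add: u_def)
        show "real (card D) \<le> C1 * ln x * exp (- u / 16) * real (Psi x y)"
          unfolding D_def u_def using u asm by (intro few) (auto simp: u_def)
      qed
      also have "\<dots> \<le> (90 + C1) * saving x y * \<Psi>"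
      proof -
        have a: "ln x / sqrt y \<le> (ln x)\<^sup>2 / sqrt y"
          using lx1 y4 by (intro divide_right_mono) (auto simp: power2_eq_square)
        define s where "s = (ln x)\<^sup>2 / sqrt y"
        define t where "t = ln x * exp (- u / 16)"
        have st: "s \<ge> 0" "t \<ge> 0" using lx1 y4 by (auto simp: s_def t_def)
        have "72 * s + 12 * (h * ln x) + (6 * t + C1 * t) \<le> (90 + C1) * (s + t)"
        proof -
          have "h * ln x = ln x / sqrt y + t" by (simp add: h_def t_def algebra_simps)
          hence "h * ln x \<le> s + t" using a by (simp add: s_def)
          moreover have "0 \<le> C1 * s" using C1 st by simp
          ultimately show ?thesis using st by (simp add: algebra_simps)
        qed
        hence "(72 * s + 12 * (h * ln x) + (6 * t + C1 * t)) * \<Psi> \<le> (90 + C1) * (s + t) * \<Psi>"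
          using \<Psi> by (rule mult_right_mono)
        thus ?thesis by (simp add: s_def t_def saving_def u_def algebra_simps)
      qed
      finally show ?thesis .
    qed
    have "?E \<le>
        sqrt (real (card E)) + (\<Sum>k\<in>{k0..K}. sqrt ((ln x / h + 1) * \<Psi> / real (k choose (k div 2))))"
      unfolding E_def \<Psi>_def using asm x1 y4 h KL by (intro character_mean_smooth_sum_le) auto
    also have "sqrt (real (card E)) \<le> sqrt ((90 + C1) * saving x y * \<Psi>)"
      using E by (intro real_sqrt_le_mono)
    also have "(\<Sum>k\<in>{k0..K}. sqrt ((ln x / h + 1) * \<Psi> / real (k choose (k div 2)))) \<le>
        sqrt ((2 * u + 1) ^ 3 * 2 powr (- u / 4) * ((ln x / h + 1) * \<Psi>))"
      using u k0 K h lx1 \<Psi> by (intro sum_sqrt_central_binomial_le) (auto intro!: mult_nonneg_nonneg add_nonneg_nonneg divide_nonneg_nonneg)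
    also have "\<dots> \<le> sqrt (saving x y * \<Psi>)"
    proof (intro real_sqrt_le_mono)
      \<comment> \<open>Of the gain \<open>exp (- u / 8)\<close>, one factor \<open>exp (- u / 16)\<close> pays for the number of bins, and the
        other one is the saving.\<close>
      have "ln x / h \<le> ln x / exp (- u / 16)"
        using h lx1 by (intro divide_left_mono) auto
      also have "\<dots> = ln x * exp (u / 16)" by (simp add: exp_minus field_simps)
      finally have "ln x / h + 1 \<le> 2 * ln x * exp (u / 16)"
        using lx1 u mult_mono[of 1 "ln x" 1 "exp (u / 16)"] by simp
      hence "(2 * u + 1) ^ 3 * 2 powr (- u / 4) * ((ln x / h + 1) * \<Psi>) \<le>
          (2 * u + 1) ^ 3 * 2 powr (- u / 4) * ((2 * ln x * exp (u / 16)) * \<Psi>)"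
        using u \<Psi> by (intro mult_left_mono mult_right_mono) auto
      also have "exp (u / 16) = exp (u / 8) * exp (- u / 16)" by (simp add: exp_add [symmetric])
      also have "(2 * u + 1) ^ 3 * 2 powr (- u / 4) * ((2 * ln x * (exp (u / 8) * exp (- u / 16))) * \<Psi>) =
          (2 * (2 * u + 1) ^ 3 * 2 powr (- u / 4) * exp (u / 8)) * (ln x * exp (- u / 16) * \<Psi>)"
        by (simp add: mult_ac)
      also have "\<dots> \<le> 1 * (ln x * exp (- u / 16) * \<Psi>)"
        using U2[OF u(3,1)] lx1 \<Psi> by (intro mult_right_mono) auto
      also have "\<dots> \<le> saving x y * \<Psi>"
        using \<Psi> y4 by (simp add: saving_def u_def distrib_right)
      finally show "(2 * u + 1) ^ 3 * 2 powr (- u / 4) * ((ln x / h + 1) * \<Psi>) \<le> saving x y * \<Psi>" .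
    qed
    also have "sqrt ((90 + C1) * saving x y * \<Psi>) + sqrt (saving x y * \<Psi>) = C * sqrt (\<Psi> * saving x y)"
    proof -
      have "a * b * c + b * c = (a + 1) * (c * b)" for a b c :: real by (simp add: algebra_simps)
      thus ?thesis unfolding C_def real_sqrt_mult .
    qed
    finally show "?E \<le> C * sqrt (real (Psi x y) * saving x y)"
      by (simp add: \<Psi>_def)
  qed
qed

section \<open>Comparison with S\<close>

lemma S_min_factor_le:
  assumes "x > 1" "x \<le> real q"
  shows "(ln (min (real q) (x powr (3/2))) / ln x - 1)\<^sup>2 \<le> 1 / 4"
proof -
  let ?m = "ln (min (real q) (x powr (3/2)))"
  have lx: "ln x > 0" using assms by simp
  have "x powr 1 \<le> x powr (3/2)" using assms by (intro powr_mono) auto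
  hence "x \<le> min (real q) (x powr (3/2))" using assms by simp
  hence lo: "ln x \<le> ?m" using assms by (intro ln_mono) auto
  have "?m \<le> ln (x powr (3/2))" using assms by (intro ln_mono) auto
  also have "\<dots> = 3/2 * ln x" using assms by (simp add: ln_powr)
  finally have hi: "?m \<le> 3/2 * ln x" .
  define r where "r = ?m / ln x - 1"
  have "0 \<le> r" "r \<le> 1/2" using lo hi lx by (auto simp: r_def field_simps)
  hence "r\<^sup>2 \<le> (1/2)\<^sup>2" by (intro power_mono) auto
  thus ?thesis by (simp add: r_def power_divide)
qed

lemma S_ge_exp:
  assumes "x > 1" "x \<le> real q" "y > 1"
  shows "S x y q \<ge> ln x powr (3/2) * ln y powr (1/2) *
           (y powr (1/2 - saddle_point x y) + exp (- u_param x y / 16))"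
proof -
  have "u_param x y > 0" using assms by (simp add: u_param_def)
  hence "u_param x y / 4 * (ln (min (real q) (x powr (3/2))) / ln x - 1)\<^sup>2 \<le> u_param x y / 4 * (1 / 4)"
    using S_min_factor_le[OF assms(1,2)] by (intro mult_left_mono) auto
  hence "exp (- u_param x y / 16) \<le>
      exp (- (u_param x y / 4) * (ln (min (real q) (x powr (3/2))) / ln x - 1)\<^sup>2)" by simp
  thus ?thesis unfolding S_def by (intro mult_left_mono add_left_mono) auto
qed

lemma saving_le_S:
  assumes "y > 0" "ln y \<ge> 4" "u_param x y > 8" "ln x ^ 6 \<le> y" "x > 0" "x \<le> real q"
  shows "saving x y \<le> 8 * S x y q"
proof -
  define u where "u = u_param x y"
  have ly: "ln y \<ge> 1" using assms(2) by linarith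
  have u1: "u \<ge> 1" using assms(3) by (simp add: u_def)
  have lx: "ln y \<le> ln x" using u_param_le_ln(2)[OF _ ly, of x] u1 by (simp only: u_def)
  have lx1: "ln x \<ge> 1" using ly lx by linarith
  have x1: "x > 1" using lx1 ln_gt_zero_iff[OF assms(5)] by linarith
  have y1: "y > 1" using ly ln_gt_zero_iff[OF assms(1)] by linarith
  define w where "w = ln x powr (3/2) * ln y powr (1/2)"
  have w0: "w \<ge> 0" by (simp add: w_def)
  have w_ge: "w \<ge> ln x"
  proof -
    have "ln x powr 1 * 1 \<le> ln x powr (3/2) * ln y powr (1/2)"
      using lx1 ly by (intro mult_mono powr_mono ge_one_powr_ge_zero) auto
    thus ?thesis using lx1 by (simp add: w_def)
  qed
  have wu_ge: "w * u \<ge> (ln x)\<^sup>2"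
  proof -
    have "(ln x)\<^sup>2 = ln x powr (3/2) * ln x powr (1/2)"
      using lx1 by (simp add: powr_add [symmetric])
    also have "\<dots> = w * (ln x powr (1/2) / ln y powr (1/2))" using ly by (simp add: w_def)
    also have "ln x powr (1/2) / ln y powr (1/2) = u powr (1/2)"
      using lx1 ly by (simp add: u_def u_param_def powr_divide)
    also have "\<dots> \<le> u powr 1" using u1 by (intro powr_mono) auto
    also have "u powr 1 = u" using u1 by simp
    finally show ?thesis using w0 by (simp add: mult_left_mono)
  qed
  have "saving x y = (ln x)\<^sup>2 / sqrt y + ln x * exp (- u / 16)" by (simp add: saving_def u_def)
  also have "\<dots> \<le> w * u / sqrt y + w * exp (- u / 16)"
    using wu_ge w_ge y1 by (intro add_mono divide_right_mono mult_right_mono) auto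
  also have "\<dots> \<le> 8 * (w * (u / 8 / sqrt y + exp (- u / 16)))"
    using w0 by (simp add: algebra_simps)
  also have "\<dots> \<le> 8 * (w * (y powr (1/2 - saddle_point x y) + exp (- u / 16)))"
    using saddle_powr_ge[OF assms(1-5)] w0
    by (intro mult_left_mono add_right_mono) (auto simp: u_def)
  also have "\<dots> \<le> 8 * S x y q"
    using S_ge_exp[OF x1 assms(6) y1] by (simp add: w_def u_def)
  finally show ?thesis .
qed

lemma ln_le_of_le_powr:
  fixes x y :: real
  assumes "y > 0" "x > 0" "ln (ln x) > 0" "y \<le> x powr (1 / (32 * ln (ln x)))"
  shows "32 * ln (ln x) * ln y \<le> ln x"
proof -
  have "ln y \<le> ln (x powr (1 / (32 * ln (ln x))))" using assms by (intro ln_mono) auto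
  also have "\<dots> = ln x / (32 * ln (ln x))" using assms by (simp add: ln_powr)
  finally show ?thesis using assms(3) by (simp add: field_simps)
qed

lemma u_param_ge_of_le_powr:
  assumes "y > 1" "x > 0" "ln (ln x) > 0" "y \<le> x powr (1 / (32 * ln (ln x)))"
  shows "32 * ln (ln x) \<le> u_param x y"
  using ln_le_of_le_powr[of y x] assms by (simp add: u_param_def pos_le_divide_eq)

text \<open>
  Large \<open>x\<close> satisfy \<open>u \<ge> 32 * ln (ln x)\<close> and \<open>ln y \<ge> 6 * ln (ln x)\<close>, so that all thresholds are met. For
  bounded \<open>x\<close> the trivial bound \<open>Psi x y\<close> suffices, since there \<open>S\<close> is bounded below. Such \<open>x\<close> do occur in the
  range: near \<open>exp 1\<close> the exponent \<open>1 / (32 * ln (ln x))\<close> is large.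
\<close>

lemma character_mean_smooth_le_S:
  "\<exists>C::real. C > 0 \<and>
     (\<forall>(q::nat) (x::real) (y::real).
        q > 0 \<longrightarrow> 2 \<le> y \<longrightarrow> y \<le> x \<longrightarrow> 2 \<le> x \<longrightarrow> x \<le> real q \<longrightarrow>
        ln x ^ 6 \<le> y \<longrightarrow> y \<le> x powr (1 / (32 * ln (ln x))) \<longrightarrow>
        1 / real (totient q) *
          (\<Sum>\<chi>\<in>dirichlet_characters q. cmod (\<Sum>n\<in>smooth_upto x y. \<chi> n))
        \<le> C * sqrt (real (Psi x y) * S x y q))"
proof -
  obtain C U where C: "C > 0" and bound:
    "\<And>q x y. \<lbrakk>u_param x y \<ge> U; y > 0; ln y \<ge> 72; x > 0; ln x ^ 6 \<le> y; 32 * ln (ln x) \<le> u_param x y;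
        q > 0; x \<le> real q\<rbrakk> \<Longrightarrow>
       character_mean q (\<lambda>\<chi>. cmod (\<Sum>n\<in>smooth_upto x y. \<chi> n)) \<le> C * sqrt (real (Psi x y) * saving x y)"
    using character_mean_smooth_le_saving by blast
  define T where "T = max U 12"
  define X where "X = exp (exp T)"
  define s where "s = (ln 2)\<^sup>2 * exp (- ln X / (16 * ln 2))"
  have s: "s > 0" by (simp add: s_def)
  have X: "X > 0" by (simp add: X_def)
  define C' where "C' = max (C * sqrt 8) (sqrt (X / s))"
  show ?thesis
  proof (intro exI[of _ C'] conjI allI impI)
    show "C' > 0" using C by (simp add: C'_def less_max_iff_disj)
    fix q :: nat and x y :: real
    assume asm: "q > 0" "2 \<le> y" "y \<le> x" "2 \<le> x" "x \<le> real q" "ln x ^ 6 \<le> y"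
      "y \<le> x powr (1 / (32 * ln (ln x)))"
    let ?E = "character_mean q (\<lambda>\<chi>. cmod (\<Sum>n\<in>smooth_upto x y. \<chi> n))"
    define \<Psi> where "\<Psi> = real (Psi x y)"
    have \<Psi>: "\<Psi> \<ge> 0" by (simp add: \<Psi>_def)
    have S0: "S x y q \<ge> 0" unfolding S_def by (intro mult_nonneg_nonneg add_nonneg_nonneg) auto
    have "?E \<le> C' * sqrt (\<Psi> * S x y q)"
    proof (cases "x \<ge> X")
      case True
      have lx: "ln x \<ge> exp T" using True asm(4) by (subst ln_ge_iff) (auto simp: X_def)
      have lx0: "ln x > 0" using asm by simp
      have llx: "ln (ln x) \<ge> T" using lx lx0 by (subst ln_ge_iff) auto
      hence llx12: "ln (ln x) \<ge> 12" "ln (ln x) \<ge> U" by (auto simp: T_def)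
      have llx0: "ln (ln x) > 0" using llx12 by linarith
      have u: "32 * ln (ln x) \<le> u_param x y"
        using asm by (intro u_param_ge_of_le_powr[OF _ _ llx0]) auto
      have "ln (ln x ^ 6) \<le> ln y" using asm lx0 by (intro ln_mono) auto
      hence ly: "ln y \<ge> 72" using llx12 by (simp add: ln_realpow)
      have "?E \<le> C * sqrt (\<Psi> * saving x y)"
        unfolding \<Psi>_def using asm u ly llx12 by (intro bound) auto
      also have "\<dots> \<le> C * sqrt (\<Psi> * (8 * S x y q))"
      proof (intro mult_left_mono real_sqrt_le_mono \<Psi>)
        show "saving x y \<le> 8 * S x y q" using asm u ly llx12 by (intro saving_le_S) auto
      qed (use C in auto)
      also have "\<dots> = (C * sqrt 8) * sqrt (\<Psi> * S x y q)" by (simp add: real_sqrt_mult)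
      also have "\<dots> \<le> C' * sqrt (\<Psi> * S x y q)"
        using \<Psi> S0 by (intro mult_right_mono) (auto simp: C'_def)
      finally show ?thesis .
    next
      case False
      have sS: "s \<le> S x y q"
      proof -
        have l2: "ln 2 \<le> ln x" "ln 2 \<le> ln y" "(0::real) < ln 2" using asm by (auto intro: ln_mono)
        have "s \<le> (ln 2 powr (3/2) * ln 2 powr (1/2)) * exp (- u_param x y / 16)"
        proof -
          have "u_param x y \<le> ln X / ln 2" unfolding u_param_def
            using l2 False asm X by (intro frac_le ln_mono) auto
          hence "exp (- ln X / (16 * ln 2)) \<le> exp (- u_param x y / 16)" by simp
          moreover have "(ln 2)\<^sup>2 = (ln 2 :: real) powr (3/2) * ln 2 powr (1/2)"
            using l2 by (simp add: powr_add [symmetric])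
          ultimately show ?thesis unfolding s_def by (simp add: mult_left_mono)
        qed
        also have "\<dots> \<le> (ln x powr (3/2) * ln y powr (1/2)) *
            (y powr (1/2 - saddle_point x y) + exp (- u_param x y / 16))"
          using l2 by (intro mult_mono powr_mono2) auto
        also have "\<dots> \<le> S x y q" using asm by (intro S_ge_exp) auto
        finally show ?thesis .
      qed
      have "?E \<le> character_mean q (\<lambda>\<chi>. \<Psi>)"
      proof (rule character_mean_mono)
        fix \<chi> assume \<chi>: "\<chi> \<in> dirichlet_characters q"
        have "cmod (\<Sum>n\<in>smooth_upto x y. \<chi> n) \<le> (\<Sum>n\<in>smooth_upto x y. 1)"
          using norm_dirichlet_character_le[OF \<chi> asm(1)] by (intro sum_norm_le) auto
        thus "cmod (\<Sum>n\<in>smooth_upto x y. \<chi> n) \<le> \<Psi>" by (simp add: \<Psi>_def Psi_def)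
      qed
      also have "\<dots> \<le> \<Psi>" by (rule character_mean_const_le[OF asm(1) \<Psi>])
      also have "\<dots> = sqrt (\<Psi> * \<Psi>)" using \<Psi> by simp
      also have "\<dots> \<le> sqrt (\<Psi> * (X / s * S x y q))"
      proof (intro real_sqrt_le_mono mult_left_mono \<Psi>)
        have "\<Psi> \<le> x" unfolding \<Psi>_def using asm by (intro Psi_le) auto
        also have "\<dots> \<le> X * 1" using False by simp
        also have "\<dots> \<le> X * (S x y q / s)" using sS s X by (intro mult_left_mono) (auto simp: field_simps)
        finally show "\<Psi> \<le> X / s * S x y q" by simp
      qed
      also have "\<dots> = sqrt (X / s) * sqrt (\<Psi> * S x y q)"
        by (simp only: real_sqrt_mult mult_ac)
      also have "\<dots> \<le> C' * sqrt (\<Psi> * S x y q)"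
        using \<Psi> S0 by (intro mult_right_mono) (auto simp: C'_def)
      finally show ?thesis .
    qed
    thus "1 / real (totient q) * (\<Sum>\<chi>\<in>dirichlet_characters q. cmod (\<Sum>n\<in>smooth_upto x y. \<chi> n))
        \<le> C' * sqrt (real (Psi x y) * S x y q)"
      by (simp only: character_mean_def \<Psi>_def)
  qed
qed

text \<open>
  The bound \<open>y powr (1 / 2 - \<alpha>) \<le> 6 * ln x / sqrt y\<close> leaves \<open>(ln x) powr (5 / 2)\<close> against
  \<open>sqrt y \<ge> (ln x) ^ 3\<close>. The remaining half power of \<open>ln x\<close> pays for \<open>sqrt (ln y)\<close>.
\<close>

lemma S_first_term_le:
  assumes "x > 0" "ln x \<ge> 2" "ln x ^ 6 \<le> y"
  shows "ln x powr (3/2) * ln y powr (1/2) * y powr (1/2 - saddle_point x y) \<le> 24 * ln x powr - (1/4)"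
proof -
  define l where "l = ln x"
  have l: "l \<ge> 2" using assms by (simp add: l_def)
  have x1: "x > 1" using assms ln_gt_zero_iff[OF assms(1)] by linarith
  have "(2::real) ^ 6 \<le> l ^ 6" using l by (intro power_mono) auto
  hence y: "y \<ge> 64" "l ^ 6 \<le> y" using assms by (auto simp: l_def)
  have "ln y = 12 * ln (y powr (1/12))" using y by (simp add: ln_powr)
  also have "\<dots> \<le> 12 * y powr (1/12)" using y ln_le_minus_one[of "y powr (1/12)"] by simp
  finally have "ln y powr (1/2) \<le> (12 * y powr (1/12)) powr (1/2)"
    using y by (intro powr_mono2) auto
  also have "\<dots> = 12 powr (1/2) * y powr (1/24)" by (simp add: powr_mult powr_powr)
  also have "(12::real) powr (1/2) \<le> 4"
    by (simp add: powr_half_sqrt real_le_lsqrt)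
  finally have ly: "ln y powr (1/2) \<le> 4 * y powr (1/24)" by (simp add: mult_right_mono)
  have "l powr (3/2) * ln y powr (1/2) * y powr (1/2 - saddle_point x y) \<le>
      l powr (3/2) * (4 * y powr (1/24)) * (6 * l / sqrt y)"
    using ly saddle_powr_le[of y x] y x1 by (intro mult_mono mult_left_mono) (auto simp: l_def)
  also have "\<dots> = 24 * (l powr (3/2) * l powr 1) * (y powr (1/24) * y powr - (1/2))"
    using y l by (simp add: powr_half_sqrt [symmetric] powr_minus field_simps)
  also have "\<dots> = 24 * l powr (5/2) * y powr - (11/24)"
    by (simp only: powr_add [symmetric]) simp
  also have "\<dots> \<le> 24 * l powr (5/2) * (l powr 6) powr - (11/24)"
    using y l by (intro mult_left_mono powr_mono2') (auto simp: powr_numeral)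
  also have "\<dots> = 24 * (l powr (5/2) * l powr - (11/4))" by (simp add: powr_powr)
  also have "\<dots> = 24 * l powr - (1/4)" by (simp only: powr_add [symmetric]) simp
  finally show ?thesis by (simp add: l_def)
qed

text \<open>
  For \<open>q < x powr (3 / 2)\<close> the lower bound on \<open>q\<close> is made to cancel the powers of \<open>ln x\<close> and \<open>ln y\<close>
  exactly. For larger \<open>q\<close> the exponential is \<open>exp (- u / 16) \<le> (ln x) powr - 2\<close>, and what remains is
  \<open>(ln y / ln x) powr (1 / 2)\<close>.
\<close>

lemma S_second_term_le:
  assumes "x > 0" "ln (ln x) > 0" "y > 1" "y \<le> x powr (1 / (32 * ln (ln x)))" "q > 0" "t > 0"
    and q: "ln (real q) / ln x \<ge> 1 + sqrt ((6 * ln (ln x) + 2 * ln (ln y) + t) / u_param x y)"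
    and ly: "ln y \<ge> 1"
  shows "ln x powr (3/2) * ln y powr (1/2) *
           exp (- (u_param x y / 4) * (ln (min (real q) (x powr (3/2))) / ln x - 1)\<^sup>2)
         \<le> (32 * ln (ln x)) powr - (1/2) + exp (- t / 4)"
proof -
  let ?r = "ln (min (real q) (x powr (3/2))) / ln x - 1"
  define u where "u = u_param x y"
  define l where "l = ln (ln x)"
  define w where "w = ln x powr (3/2) * ln y powr (1/2)"
  have l: "l > 0" using assms by (simp add: l_def)
  have u: "32 * l \<le> u" unfolding l_def u_def by (rule u_param_ge_of_le_powr[OF assms(3,1,2,4)])
  have lx0: "ln x > 0"
  proof -
    have "0 < u * ln y" using u l ly by (intro mult_pos_pos) linarith+
    thus ?thesis using u_param_mult_ln[of y x] assms(3) by (simp add: u_def)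
  qed
  have x1: "x > 1" using lx0 ln_gt_zero_iff[OF assms(1)] by blast
  have lexp: "ln x = exp l" using lx0 by (simp add: l_def)
  have w: "w = exp (3/2 * l + 1/2 * ln (ln y))"
    using lx0 ly by (simp add: w_def powr_def l_def exp_add)
  show ?thesis
  proof (cases "real q \<ge> x powr (3/2)")
    case True
    hence r: "?r = 1/2"
      using x1 lx0 by (simp add: min_absorb2 ln_powr)
    have "w * exp (- (u / 4) * ?r\<^sup>2) = w * exp (- u / 16)"
      unfolding r by (simp add: power2_eq_square)
    also have "\<dots> \<le> w * exp (- 2 * l)" using u by (intro mult_left_mono) (auto simp: w_def)
    also have "\<dots> = exp (- (1/2) * (l - ln (ln y)))"
      unfolding w exp_add [symmetric] by (simp add: field_simps)
    also have "l - ln (ln y) = ln u"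
      using lx0 ly by (simp add: l_def u_def u_param_def ln_div)
    also have "exp (- (1/2) * ln u) = u powr - (1/2)" using u l by (simp add: powr_def)
    also have "\<dots> \<le> (32 * l) powr - (1/2)" using u l by (intro powr_mono2') auto
    finally show ?thesis by (simp add: u_def w_def l_def add_increasing2)
  next
    case False
    define r where "r = (6 * l + 2 * ln (ln y) + t) / u"
    have u0: "u > 0" using u l by linarith
    have lly: "ln (ln y) \<ge> 0" using ly by simp
    have r: "r > 0" using l lly assms(6) u0 by (auto simp: r_def intro!: divide_pos_pos add_pos_pos add_pos_nonneg)
    have "?r \<ge> sqrt r"
      using False q by (simp add: min_def r_def l_def u_def)
    hence "(sqrt r)\<^sup>2 \<le> ?r\<^sup>2"
      using r by (intro power_mono) auto
    hence "r \<le> ?r\<^sup>2" using r by simp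
    hence "u / 4 * r \<le> u / 4 * ?r\<^sup>2"
      using u0 by (intro mult_left_mono) auto
    moreover have "u / 4 * r = (6 * l + 2 * ln (ln y) + t) / 4" using u0 by (simp add: r_def)
    ultimately have "w * exp (- (u / 4) * ?r\<^sup>2) \<le>
        w * exp (- (6 * l + 2 * ln (ln y) + t) / 4)"
      by (intro mult_left_mono) (auto simp: w_def)
    also have "\<dots> = exp (- t / 4)" by (simp add: w exp_add [symmetric] field_simps)
    finally show ?thesis by (simp add: u_def w_def add_increasing)
  qed
qed

lemma S_tendsto_0:
  assumes "filterlim \<eta> at_top at_top" "\<epsilon> > (0::real)"
  shows "\<forall>\<^sub>F x in at_top. \<forall>(y::real) (q::nat).
           q > 0 \<longrightarrow> ln x ^ 6 \<le> y \<longrightarrow> y \<le> x powr (1 / (32 * ln (ln x))) \<longrightarrow>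
           ln (real q) / ln x \<ge> 1 + sqrt ((6 * ln (ln x) + 2 * ln (ln y) + \<eta> x) / u_param x y) \<longrightarrow>
           \<bar>S x y q\<bar> < \<epsilon>"
proof -
  have "((\<lambda>x. exp (- \<eta> x / 4)) \<longlongrightarrow> 0) at_top"
    by (rule filterlim_compose[OF _ assms(1)]) real_asymp
  hence e1: "\<forall>\<^sub>F x in at_top. exp (- \<eta> x / 4) < \<epsilon> / 3"
    by (rule order_tendstoD) (use assms in simp)
  have "((\<lambda>x::real. 24 * ln x powr - (1/4)) \<longlongrightarrow> 0) at_top" by real_asymp
  hence e2: "\<forall>\<^sub>F x::real in at_top. 24 * ln x powr - (1/4) < \<epsilon> / 3"
    by (rule order_tendstoD) (use assms in simp)
  have "((\<lambda>x::real. (32 * ln (ln x)) powr - (1/2)) \<longlongrightarrow> 0) at_top" by real_asymp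
  hence e3: "\<forall>\<^sub>F x::real in at_top. (32 * ln (ln x)) powr - (1/2) < \<epsilon> / 3"
    by (rule order_tendstoD) (use assms in simp)
  have e4: "\<forall>\<^sub>F x::real in at_top. ln x \<ge> 2" by real_asymp
  have e5: "\<forall>\<^sub>F x::real in at_top. ln (ln x) > 0" by real_asymp
  have e6: "\<forall>\<^sub>F x in at_top. \<eta> x > 0" using assms(1) by (simp add: filterlim_at_top_dense)
  show ?thesis using e1 e2 e3 e4 e5 e6 eventually_gt_at_top[of 0]
  proof eventually_elim
    case (elim x)
    show ?case
    proof (intro allI impI)
      fix y :: real and q :: nat
      assume asm: "q > 0" "ln x ^ 6 \<le> y" "y \<le> x powr (1 / (32 * ln (ln x)))"
        "ln (real q) / ln x \<ge> 1 + sqrt ((6 * ln (ln x) + 2 * ln (ln y) + \<eta> x) / u_param x y)"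
      have "(2::real) ^ 6 \<le> ln x ^ 6" using elim by (intro power_mono) auto
      hence y: "y \<ge> 64" using asm by simp
      have "exp 1 \<le> y" using y exp_1_le by linarith
      hence ly: "ln y \<ge> 1" using y by (subst ln_ge_iff) auto
      define w where "w = ln x powr (3/2) * ln y powr (1/2)"
      have "S x y q = w * y powr (1/2 - saddle_point x y) +
          w * exp (- (u_param x y / 4) * (ln (min (real q) (x powr (3/2))) / ln x - 1)\<^sup>2)"
        by (simp add: S_def w_def algebra_simps)
      also have "w * y powr (1/2 - saddle_point x y) \<le> 24 * ln x powr - (1/4)"
        unfolding w_def using elim asm by (intro S_first_term_le) auto
      also have "w * exp (- (u_param x y / 4) * (ln (min (real q) (x powr (3/2))) / ln x - 1)\<^sup>2) \<le>
          (32 * ln (ln x)) powr - (1/2) + exp (- \<eta> x / 4)"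
        unfolding w_def using elim asm y ly by (intro S_second_term_le) auto
      finally have "S x y q < \<epsilon>" using elim by linarith
      moreover have "S x y q \<ge> 0" unfolding S_def by (intro mult_nonneg_nonneg add_nonneg_nonneg) auto
      ultimately show "\<bar>S x y q\<bar> < \<epsilon>" by simp
    qed
  qed
qed

theorem theorem1:
  shows "(\<exists>C::real. C > 0 \<and>
           (\<forall>(q::nat) (x::real) (y::real).
              q > 0 \<longrightarrow> 2 \<le> y \<longrightarrow> y \<le> x \<longrightarrow> 2 \<le> x \<longrightarrow> x \<le> real q \<longrightarrow>
              ln x ^ 6 \<le> y \<longrightarrow> y \<le> x powr (1 / (32 * ln (ln x))) \<longrightarrow>
              1 / real (totient q) *
                (\<Sum>\<chi>\<in>dirichlet_characters q. cmod (\<Sum>n\<in>smooth_upto x y. \<chi> n))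
              \<le> C * sqrt (real (Psi x y) * S x y q)))
         \<and>
         (\<forall>\<eta> :: real \<Rightarrow> real. filterlim \<eta> at_top at_top \<longrightarrow>
           (\<forall>\<epsilon>::real. \<epsilon> > 0 \<longrightarrow>
             (\<forall>\<^sub>F x in at_top. \<forall>(y::real) (q::nat).
                q > 0 \<longrightarrow>
                ln x ^ 6 \<le> y \<longrightarrow> y \<le> x powr (1 / (32 * ln (ln x))) \<longrightarrow>
                ln (real q) / ln x \<ge>
                  1 + sqrt ((6 * ln (ln x) + 2 * ln (ln y) + \<eta> x) / u_param x y) \<longrightarrow>
                \<bar>S x y q\<bar> < \<epsilon>)))"
proof (rule conjI, goal_cases)
  case 1
  show ?case by (rule character_mean_smooth_le_S)
next
  case 2
  show ?case by (intro allI impI, rule S_tendsto_0)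
qed

end
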